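(* Let $d=1$ and $\alpha>0$. Then the least-action ground states $Q_\epsilon$ satisfy, as $\epsilon\to0^+$, $$S_{1+\epsilon}(Q_\epsilon)\approx\|Q_\epsilon\|_{L^{\alpha+2}(\mathbb R)}^{\alpha+2}\approx\epsilon^{\frac{\alpha+4}{2\alpha}}.$$
   Context: For $\epsilon>0$, with the unitary Fourier transform, $$\mathcal R_\epsilon(\alpha)=\inf_{u\in H^2(\mathbb R)\setminus\{0\}}\frac{\int_{\mathbb R}\big((\xi^2-1)^2+\epsilon\big)|\hat u(\xi)|^2\,d\xi}{\|u\|_{L^{\alpha+2}(\mathbb R)}^2}.$$ $Q_\epsilon=\mathcal R_\epsilon(\alpha)^{1/\alpha}v_\epsilon$, where $v_\epsilon$ is a minimizer for $\mathcal R_\epsilon(\alpha)$ with $\|v_\epsilon\|_{L^{\alpha+2}}=1$ (a least-action ground state of $Q^{(4)}+2Q''+(1+\epsilon)Q-|Q|^\alpha Q=0$). The action is $$S_{1+\epsilon}(u)=\frac12\|u''\|_{L^2}^2-\|u'\|_{L^2}^2+\frac{1+\epsilon}2\|u\|_{L^2}^2-\frac1{\alpha+2}\|u\|_{L^{\alpha+2}}^{\alpha+2}.$$ $A_\epsilon\approx B_\epsilon$ means: there are constants $0<c<C<\infty$ independent of $\epsilon$ with $cB_\epsilon\le A_\epsilon\le CB_\epsilon$ for all sufficiently small $\epsilon>0$. *)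

theory Defs
  imports "HOL-Analysis.Analysis"
begin

(* Elements of L^p are represented by Borel functions; equality in L^p is equality almost
   everywhere. The value of Lp_norm is meaningful only on Lp_space, since the Bochner integral
   of a non-integrable function is 0. *)

definition Lp_space :: "real \<Rightarrow> (real \<Rightarrow> complex) set" where
  "Lp_space p = {u \<in> borel_measurable borel. integrable lborel (\<lambda>x. norm (u x) powr p)}"

definition Lp_norm :: "real \<Rightarrow> (real \<Rightarrow> complex) \<Rightarrow> real" where
  "Lp_norm p u = (LINT x|lborel. norm (u x) powr p) powr (1 / p)"

definition fourier_integral :: "(real \<Rightarrow> complex) \<Rightarrow> real \<Rightarrow> complex" where
  "fourier_integral u \<xi> = (LINT x|lborel. cis (- (\<xi> * x)) * u x) / complex_of_real (sqrt (2 * pi))"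

(* The unitary Fourier transform on L^2: the L^2-limit of the transforms of the truncations of u,
   which lie in both L^1 and L^2. It is determined up to a null set. *)

definition fourier_L2 :: "(real \<Rightarrow> complex) \<Rightarrow> real \<Rightarrow> complex" where
  "fourier_L2 u = (SOME g. g \<in> Lp_space 2 \<and>
     (\<lambda>n::nat. Lp_norm 2 (\<lambda>\<xi>. g \<xi> -
        fourier_integral (\<lambda>x. indicator {- real n..real n} x *\<^sub>R u x) \<xi>)) \<longlonglongrightarrow> 0)"

definition test_function :: "(real \<Rightarrow> real) \<Rightarrow> bool" where
  "test_function \<phi> \<longleftrightarrow>
     (\<forall>n. (deriv ^^ n) \<phi> differentiable_on UNIV) \<and> (\<exists>r. \<forall>x. \<bar>x\<bar> > r \<longrightarrow> \<phi> x = 0)"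

definition has_L2_weak_deriv :: "nat \<Rightarrow> (real \<Rightarrow> complex) \<Rightarrow> (real \<Rightarrow> complex) \<Rightarrow> bool" where
  "has_L2_weak_deriv k u g \<longleftrightarrow> u \<in> Lp_space 2 \<and> g \<in> Lp_space 2 \<and>
     (\<forall>\<phi>. test_function \<phi> \<longrightarrow>
        (LINT x|lborel. (deriv ^^ k) \<phi> x *\<^sub>R u x) = (- 1) ^ k * (LINT x|lborel. \<phi> x *\<^sub>R g x))"

(* Determined up to a null set, whenever a weak derivative in L^2 exists. *)

definition weak_deriv :: "nat \<Rightarrow> (real \<Rightarrow> complex) \<Rightarrow> real \<Rightarrow> complex" where
  "weak_deriv k u = (SOME g. has_L2_weak_deriv k u g)"

definition H2 :: "(real \<Rightarrow> complex) set" where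
  "H2 = {u \<in> Lp_space 2. \<forall>k\<le>2. \<exists>g. has_L2_weak_deriv k u g}"

definition rayleigh_quotient :: "real \<Rightarrow> real \<Rightarrow> (real \<Rightarrow> complex) \<Rightarrow> real" where
  "rayleigh_quotient \<alpha> \<epsilon> u =
     (LINT \<xi>|lborel. ((\<xi>\<^sup>2 - 1)\<^sup>2 + \<epsilon>) * (norm (fourier_L2 u \<xi>))\<^sup>2) / (Lp_norm (\<alpha> + 2) u)\<^sup>2"

definition H2_nonzero :: "(real \<Rightarrow> complex) set" where
  "H2_nonzero = {u \<in> H2. \<not> (AE x in lborel. u x = 0)}"

definition rayleigh_inf :: "real \<Rightarrow> real \<Rightarrow> real" where
  "rayleigh_inf \<alpha> \<epsilon> = (INF u\<in>H2_nonzero. rayleigh_quotient \<alpha> \<epsilon> u)"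

definition rayleigh_minimizer :: "real \<Rightarrow> real \<Rightarrow> (real \<Rightarrow> complex) \<Rightarrow> bool" where
  "rayleigh_minimizer \<alpha> \<epsilon> v \<longleftrightarrow>
     v \<in> H2_nonzero \<and> rayleigh_quotient \<alpha> \<epsilon> v = rayleigh_inf \<alpha> \<epsilon>"

definition ground_state :: "real \<Rightarrow> real \<Rightarrow> (real \<Rightarrow> complex) \<Rightarrow> bool" where
  "ground_state \<alpha> \<epsilon> Q \<longleftrightarrow>
     (\<exists>v. rayleigh_minimizer \<alpha> \<epsilon> v \<and> Lp_norm (\<alpha> + 2) v = 1 \<and>
          Q = (\<lambda>x. (rayleigh_inf \<alpha> \<epsilon> powr (1 / \<alpha>)) *\<^sub>R v x))"

(* action \<alpha> \<omega> is the functional S_\<omega> of the equation Q'''' + 2 Q'' + \<omega> Q = |Q|^\<alpha> Q. *)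

definition action :: "real \<Rightarrow> real \<Rightarrow> (real \<Rightarrow> complex) \<Rightarrow> real" where
  "action \<alpha> \<omega> u =
     1 / 2 * (Lp_norm 2 (weak_deriv 2 u))\<^sup>2 - (Lp_norm 2 (weak_deriv 1 u))\<^sup>2
     + \<omega> / 2 * (Lp_norm 2 u)\<^sup>2 - 1 / (\<alpha> + 2) * Lp_norm (\<alpha> + 2) u powr (\<alpha> + 2)"

definition comparable :: "(real \<Rightarrow> real) \<Rightarrow> (real \<Rightarrow> real) \<Rightarrow> bool" where
  "comparable A B \<longleftrightarrow>
     (\<exists>c C. 0 < c \<and> c < C \<and> (\<forall>\<^sub>F \<epsilon> in at_right 0. c * B \<epsilon> \<le> A \<epsilon> \<and> A \<epsilon> \<le> C * B \<epsilon>))"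

end

(* Put f = Q'' + Q. By Plancherel the numerator of the Rayleigh quotient is |f|^2 + eps |u|^2 (L^2 norms),
   and integration by parts turns it into twice the quadratic part of the action; hence the action of a
   ground state is exactly (1/2 - 1/(alpha+2)) R^((alpha+2)/alpha) with R the infimum, and
   R^((alpha+2)/alpha) is the (alpha+2)-th power of its norm. It remains to see that
   R is comparable to eps^((alpha+4)/(2(alpha+2))). The upper bound is a wave packet e^(ix) psi(sqrt(eps) x).
   For the lower bound, the derivative of |u'|^2 + |u|^2 is 2 Re(f conj(u')), which gives
   sup |u|^2 <= 2 N / sqrt eps for the numerator N; interpolate with |u|^2 <= N / eps.

   An element of H^2 is given only through test functions, and its Fourier transform through an arbitrary
   choice, so all of this rests on Plancherel's theorem (Gaussian weights for continuous functions, then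
   density) and on the du Bois-Reymond lemma. *)

theory Submission
  imports Defs "HOL-Probability.Characteristic_Functions"
begin

subsection \<open>Functions with a locally integrable derivative\<close>

text \<open>The symbol \<open>(\<xi>\<^sup>2 - 1)\<^sup>2 + \<epsilon>\<close> is only of size
  \<epsilon> at the frequencies 1 and -1, so a generic Sobolev estimate gives sup |u|^2 \<le> C N /
  \<epsilon>, too weak by a factor sqrt \<epsilon>. The gain comes from the free equation u'' + u =
  0, which conserves |u'|^2 + |u|^2: this energy can change only through f. For |v| = 1 in
  L^(\<alpha>+2) the interpolation reads 1 \<le> (2 R / sqrt \<epsilon>)^(\<alpha>/2) R /
  \<epsilon>, whose exponent (1 + \<alpha>/4) / (1 + \<alpha>/2) agrees with that of the packet: a
  numerator of order sqrt \<epsilon> over a squared norm of order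
  \<epsilon>^(-1/(\<alpha>+2)).\<close>

definition primitive :: "(real \<Rightarrow> complex) \<Rightarrow> (real \<Rightarrow> complex) \<Rightarrow> bool" where
  "primitive F f \<longleftrightarrow> f \<in> borel_measurable borel \<and>
     (\<forall>a b. a \<le> b \<longrightarrow> set_integrable lborel {a..b} f \<and> (LINT x:{a..b}|lborel. f x) = F b - F a)"

lemma primitiveD:
  assumes "primitive F f"
  shows "f \<in> borel_measurable borel"
    and "a \<le> b \<Longrightarrow> set_integrable lborel {a..b} f"
    and "a \<le> b \<Longrightarrow> (LINT x:{a..b}|lborel. f x) = F b - F a"
  using assms by (auto simp: primitive_def)

lemma primitive_continuous:
  assumes "primitive F f"
  shows "continuous_on S F"
proof -
  have "isCont F x" for x
  proof -
    have 1: "set_integrable lborel {x-1..x+1} f"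
      using primitiveD(2)[OF assms] by simp
    then have "f integrable_on {x-1..x+1}"
      by (rule set_borel_integral_eq_integral)
    then have "continuous_on {x-1..x+1} (\<lambda>t. integral {x-1..t} f)"
      by (rule indefinite_integral_continuous_1)
    moreover have "integral {x-1..t} f + F (x-1) = F t" if "t \<in> {x-1..x+1}" for t
    proof -
      have "set_integrable lborel {x-1..t} f" "(LINT x:{x-1..t}|lborel. f x) = F t - F (x-1)"
        using primitiveD(2,3)[OF assms, of "x-1" t] that by auto
      with set_borel_integral_eq_integral(2)[OF this(1)] show ?thesis
        by (metis diff_add_cancel)
    qed
    ultimately have "continuous_on {x-1..x+1} F"
      using continuous_on_eq[of "{x-1..x+1}" "\<lambda>t. integral {x-1..t} f + F (x-1)" F]
      by (simp add: continuous_intros)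
    then show ?thesis
      by (rule continuous_on_interior) auto
  qed
  then show ?thesis
    by (simp add: continuous_at_imp_continuous_on)
qed

lemma primitive_measurable:
  assumes "primitive F f" shows "F \<in> borel_measurable borel"
  using primitive_continuous[OF assms] by (rule borel_measurable_continuous_onI)

lemma integrable_pair_mult:
  fixes f g :: "real \<Rightarrow> complex"
  assumes "integrable lborel f" "integrable lborel g"
  shows "integrable (lborel \<Otimes>\<^sub>M lborel) (\<lambda>(x,y). f x * g y)"
proof (rule lborel_pair.Fubini_integrable)
  have [measurable]: "f \<in> borel_measurable borel" "g \<in> borel_measurable borel"
    using assms by auto
  show "(\<lambda>(x, y). f x * g y) \<in> borel_measurable (lborel \<Otimes>\<^sub>M lborel)" by measurable
  show "integrable lborel (\<lambda>x. LINT y|lborel. norm (case (x, y) of (x, y) \<Rightarrow> f x * g y))"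
    using assms by (simp add: norm_mult)
  show "AE x in lborel. integrable lborel (\<lambda>y. case (x, y) of (x, y) \<Rightarrow> f x * g y)"
    using assms by simp
qed

lemma set_integrable_mult_continuous:
  fixes f g :: "real \<Rightarrow> complex"
  assumes "set_integrable lborel {a..b} f" "continuous_on {a..b} g" "g \<in> borel_measurable borel"
  shows "set_integrable lborel {a..b} (\<lambda>x. f x * g x)"
proof -
  have "compact (g ` {a..b})"
    using assms(2) by (intro compact_continuous_image) auto
  then obtain B where B: "\<And>x. x \<in> {a..b} \<Longrightarrow> norm (g x) \<le> B"
    using compact_imp_bounded bounded_iff by (metis (mono_tags, lifting) imageI)
  have "integrable lborel (\<lambda>x. B * norm (indicator {a..b} x *\<^sub>R f x))"
    using assms(1) unfolding set_integrable_def by (intro integrable_mult_right integrable_norm)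
  then have "integrable lborel (\<lambda>x. (indicator {a..b} x *\<^sub>R f x) * g x)"
  proof (rule Bochner_Integration.integrable_bound)
    show "(\<lambda>x. (indicator {a..b} x *\<^sub>R f x) * g x) \<in> borel_measurable lborel"
      using borel_measurable_integrable[OF assms(1)[unfolded set_integrable_def]] assms(3)
      by (intro borel_measurable_times) simp_all
    have "norm ((indicator {a..b} x *\<^sub>R f x) * g x) \<le> norm (B * norm (indicator {a..b} x *\<^sub>R f x))" for x
    proof (cases "x \<in> {a..b}")
      case True
      have "norm (g x) \<le> \<bar>B\<bar>" using B[OF True] by simp
      then show ?thesis using True
        by (auto simp: norm_mult abs_mult mult.commute[of "\<bar>B\<bar>"] intro!: mult_left_mono)
    qed simp
    then show "AE x in lborel. norm ((indicator {a..b} x *\<^sub>R f x) * g x) \<le> norm (B * norm (indicator {a..b} x *\<^sub>R f x))" by simp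
  qed
  then show ?thesis unfolding set_integrable_def by (simp add: mult_ac)
qed

text \<open>Integration by parts via Fubini: \<open>f x * h y\<close> is integrated over the
  triangle \<open>x \<le> y\<close> in the square over [a, b], in both orders. One order produces
  increments of H, the other increments of F.\<close>

lemma primitive_mult:
  assumes F: "primitive F f" and H: "primitive H h"
  shows "primitive (\<lambda>x. F x * H x) (\<lambda>x. f x * H x + F x * h x)"
proof -
  note [measurable] = primitive_measurable[OF F] primitive_measurable[OF H] primitiveD(1)[OF F] primitiveD(1)[OF H]
  note cF = primitive_continuous[OF F] and cH = primitive_continuous[OF H]
  have "set_integrable lborel {a..b} (\<lambda>x. f x * H x + F x * h x) \<and>
     (LINT x:{a..b}|lborel. f x * H x + F x * h x) = F b * H b - F a * H a" if "a \<le> b" for a b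
  proof -
    define f' where "f' = (\<lambda>x. indicator {a..b} x *\<^sub>R f x)"
    define h' where "h' = (\<lambda>x. indicator {a..b} x *\<^sub>R h x)"
    have [measurable]: "f' \<in> borel_measurable borel" "h' \<in> borel_measurable borel"
      unfolding f'_def h'_def by measurable
    have f': "integrable lborel f'" and h': "integrable lborel h'"
      using primitiveD(2)[OF F that] primitiveD(2)[OF H that] by (auto simp: f'_def h'_def set_integrable_def)
    have fH: "set_integrable lborel {a..b} (\<lambda>x. f x * H x)"
      using primitiveD(2)[OF F that] cH by (rule set_integrable_mult_continuous) simp
    have hF: "set_integrable lborel {a..b} (\<lambda>x. h x * F x)"
      using primitiveD(2)[OF H that] cF by (rule set_integrable_mult_continuous) simp
    have fH': "integrable lborel (\<lambda>x. f' x * H x)" and hF': "integrable lborel (\<lambda>x. h' x * F x)"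
      using fH hF by (simp_all add: f'_def h'_def set_integrable_def)
    define T where "T = (\<lambda>x y. if x \<le> y then f' x * h' y else 0)"
    have T: "integrable (lborel \<Otimes>\<^sub>M lborel) (case_prod T)"
    proof (rule Bochner_Integration.integrable_bound[OF integrable_pair_mult[OF f' h']])
      show "(\<lambda>(x, y). T x y) \<in> borel_measurable (lborel \<Otimes>\<^sub>M lborel)"
        unfolding T_def by measurable
    qed (auto simp: T_def)
    have 1: "(LINT y|lborel. T x y) = f' x * (H b - H x)" for x
    proof (cases "x \<in> {a..b}")
      case True
      then have "(LINT y|lborel. T x y) = (LINT y|lborel. f' x * (indicator {x..b} y *\<^sub>R h y))"
        by (intro Bochner_Integration.integral_cong) (auto simp: T_def h'_def indicator_def)
      also have "\<dots> = f' x * (LINT y:{x..b}|lborel. h y)"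
        unfolding set_lebesgue_integral_def by (simp del: mult_scaleR_right)
      finally show ?thesis using primitiveD(3)[OF H, of x b] True by simp
    next
      case False
      then have "f' x = 0" by (simp add: f'_def)
      then show ?thesis by (simp add: T_def cong: if_cong)
    qed
    have 2: "(LINT x|lborel. T x y) = h' y * (F y - F a)" for y
    proof (cases "y \<in> {a..b}")
      case True
      then have "(LINT x|lborel. T x y) = (LINT x|lborel. h' y * (indicator {a..y} x *\<^sub>R f x))"
        by (intro Bochner_Integration.integral_cong) (auto simp: T_def f'_def indicator_def)
      also have "\<dots> = h' y * (LINT x:{a..y}|lborel. f x)"
        unfolding set_lebesgue_integral_def by (simp del: mult_scaleR_right)
      finally show ?thesis using primitiveD(3)[OF F, of a y] True by simp
    next
      case False
      then have "h' y = 0" by (simp add: h'_def)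
      then show ?thesis by (simp add: T_def cong: if_cong)
    qed
    have "(LINT y|lborel. h' y * (F y - F a)) = (LINT x|lborel. f' x * (H b - H x))"
      using lborel_pair.Fubini_integral[OF T] by (simp add: 1 2)
    moreover have "(LINT y|lborel. h' y * (F y - F a)) = (LINT y|lborel. h' y * F y) - (LINT y|lborel. h' y) * F a"
      using hF' h' by (simp add: right_diff_distrib)
    moreover have "(LINT x|lborel. f' x * (H b - H x)) = (LINT x|lborel. f' x) * H b - (LINT x|lborel. f' x * H x)"
      using fH' f' by (simp add: right_diff_distrib)
    moreover have "(LINT x|lborel. f' x) = F b - F a" "(LINT x|lborel. h' x) = H b - H a"
      using primitiveD(3)[OF F that] primitiveD(3)[OF H that] by (auto simp: f'_def h'_def set_lebesgue_integral_def)
    ultimately have "(LINT y|lborel. h' y * F y) - (H b - H a) * F a = (F b - F a) * H b - (LINT x|lborel. f' x * H x)"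
      by metis
    then have "(LINT y|lborel. h' y * F y) + (LINT x|lborel. f' x * H x) = F b * H b - F a * H a"
      by (simp add: algebra_simps)
    moreover have "(LINT x:{a..b}|lborel. f x * H x + F x * h x) = (LINT y|lborel. h' y * F y) + (LINT x|lborel. f' x * H x)"
      using hF' fH' unfolding set_lebesgue_integral_def f'_def h'_def
      by (subst Bochner_Integration.integral_add[symmetric]) (simp_all add: algebra_simps)
    moreover have "set_integrable lborel {a..b} (\<lambda>x. f x * H x + F x * h x)"
      using set_integral_add(1)[OF fH hF] by (simp add: mult.commute)
    ultimately show ?thesis by simp
  qed
  moreover have "(\<lambda>x. f x * H x + F x * h x) \<in> borel_measurable borel"
    by measurable
  ultimately show ?thesis by (auto simp: primitive_def)
qed

lemma primitive_add:
  assumes F: "primitive F f" and H: "primitive H h"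
  shows "primitive (\<lambda>x. F x + H x) (\<lambda>x. f x + h x)"
  using assms unfolding primitive_def by (auto intro!: set_integral_add)

lemma primitive_cnj:
  assumes F: "primitive F f"
  shows "primitive (\<lambda>x. cnj (F x)) (\<lambda>x. cnj (f x))"
proof -
  have *: "indicator A x *\<^sub>R cnj z = cnj (indicator A x *\<^sub>R z)" for A and x :: real and z by simp
  have "(\<lambda>x. cnj (f x)) \<in> borel_measurable borel"
    using primitiveD(1)[OF F] by (rule measurable_compose) (intro borel_measurable_continuous_onI continuous_intros)
  then show ?thesis
    using assms unfolding primitive_def set_integrable_def set_lebesgue_integral_def *
    by (auto simp: integral_cnj integrable_cnj simp del: complex_cnj_scaleR)
qed

lemma primitive_C1:
  assumes "\<And>x. (F has_vector_derivative f x) (at x)" "continuous_on UNIV f"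
  shows "primitive F f"
  unfolding primitive_def
proof (intro conjI allI impI)
  show "f \<in> borel_measurable borel" using assms(2) by (rule borel_measurable_continuous_onI)
  fix a b :: real assume ab: "a \<le> b"
  have "continuous_on {a..b} f" using assms(2) continuous_on_subset by blast
  then show "set_integrable lborel {a..b} f" by (rule borel_integrable_atLeastAtMost')
  show "(LINT x:{a..b}|lborel. f x) = F b - F a"
    unfolding set_lebesgue_integral_def
    by (rule integral_FTC_atLeastAtMost[OF ab has_vector_derivative_at_within[OF assms(1)] \<open>continuous_on {a..b} f\<close>])
qed

text \<open>Allows the derivative to be exchanged for its continuous representative once that is
  known.\<close>

lemma primitive_cong_AE:
  assumes "primitive F f" "AE x in lborel. f x = g x" "g \<in> borel_measurable borel"
  shows "primitive F g"
proof -
  note [measurable] = assms(3) primitiveD(1)[OF assms(1)]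
  have "set_integrable lborel {a..b} f = set_integrable lborel {a..b} g" for a b
    unfolding set_integrable_def using assms(2) by (intro integrable_cong_AE) auto
  moreover have "(LINT x:{a..b}|lborel. f x) = (LINT x:{a..b}|lborel. g x)" for a b
    unfolding set_lebesgue_integral_def using assms(2) by (intro integral_cong_AE) auto
  ultimately show ?thesis using assms(1,3) by (auto simp: primitive_def)
qed

lemma primitive_exists:
  assumes "f \<in> borel_measurable borel" "\<And>a b. set_integrable lborel {a..b} f"
  obtains F where "primitive F f"
proof -
  define F where "F = (\<lambda>x. if 0 \<le> x then (LINT t:{0..x}|lborel. f t) else - (LINT t:{x..0}|lborel. f t))"
  have add: "(LINT t:{a..c}|lborel. f t) = (LINT t:{a..b}|lborel. f t) + (LINT t:{b..c}|lborel. f t)"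
    if "a \<le> b" "b \<le> c" for a b c
  proof -
    have "(LINT t:{a..b} \<union> {b..c}|lborel. f t) = (LINT t:{a..b}|lborel. f t) + (LINT t:{b..c}|lborel. f t)"
    proof (rule set_integral_Un_AE)
      show "AE x in lborel. \<not> (x \<in> {a..b} \<and> x \<in> {b..c})"
        using AE_lborel_singleton[of b] by eventually_elim auto
    qed (use assms in auto)
    then show ?thesis using that by (simp add: ivl_disj_un_two_touch)
  qed
  have "(LINT x:{a..b}|lborel. f x) = F b - F a" if "a \<le> b" for a b
    using add[of a b 0] add[of a 0 b] add[of 0 a b] that by (auto simp: F_def)
  then show thesis using assms that[of F] by (auto simp: primitive_def)
qed

lemma primitive_shift:
  assumes "primitive F f" shows "primitive (\<lambda>x. F x + c) f"
  using assms by (auto simp: primitive_def)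

section \<open>Behaviour at infinity\<close>

text \<open>For y in [x, x+1] the value at x differs from that at y by at most \<open>J\<close>, the
  mass of f on this window. Averaging over y costs nothing because the window has length 1.\<close>

lemma primitive_norm_le:
  assumes F: "primitive F f" and "integrable lborel F" "integrable lborel f"
  shows "norm (F x) \<le> (LINT y|lborel. indicator {x..x+1} y *\<^sub>R (norm (F y) + norm (f y)))"
proof -
  define J where "J = (LINT y|lborel. indicator {x..x+1} y *\<^sub>R norm (f y))"
  have iF: "integrable lborel (\<lambda>y. indicator {x..x+1} y *\<^sub>R norm (F y))"
    and jf: "integrable lborel (\<lambda>y. indicator {x..x+1} y *\<^sub>R norm (f y))"
    using assms by (auto intro!: integrable_mult_indicator simp del: real_scaleR_def)
  have *: "norm (F x) \<le> norm (F y) + J" if y: "y \<in> {x..x+1}" for y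
  proof -
    have "norm (LINT t:{x..y}|lborel. f t) \<le> (LINT t:{x..y}|lborel. norm (f t))"
      using primitiveD(2)[OF F, of x y] y by (intro set_integral_norm_bound) auto
    also have "\<dots> \<le> J"
      unfolding J_def set_lebesgue_integral_def using assms y
      by (intro integral_mono integrable_mult_indicator) (auto simp: indicator_def)
    finally have "norm (F y - F x) \<le> J" using primitiveD(3)[OF F, of x y] y by simp
    then show ?thesis by norm
  qed
  have "norm (F x) = (LINT y|lborel. indicator {x..x+1} y *\<^sub>R norm (F x))" by simp
  also have "\<dots> \<le> (LINT y|lborel. indicator {x..x+1} y *\<^sub>R norm (F y) + indicator {x..x+1} y *\<^sub>R J)"
  proof (rule integral_mono)
    show "integrable lborel (\<lambda>y. indicator {x..x+1} y *\<^sub>R norm (F y) + indicator {x..x+1} y *\<^sub>R J)"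
      by (intro Bochner_Integration.integrable_add iF) simp
    show "integrable lborel (\<lambda>y. indicator {x..x+1} y *\<^sub>R norm (F x))" by simp
  qed (use * in \<open>auto simp: indicator_def\<close>)
  also have "\<dots> = (LINT y|lborel. indicator {x..x+1} y *\<^sub>R norm (F y)) + J"
    by (subst Bochner_Integration.integral_add[OF iF]) simp_all
  also have "\<dots> = (LINT y|lborel. indicator {x..x+1} y *\<^sub>R norm (F y) + indicator {x..x+1} y *\<^sub>R norm (f y))"
    unfolding J_def by (rule Bochner_Integration.integral_add[OF iF jf, symmetric])
  finally show ?thesis by (simp add: algebra_simps)
qed

text \<open>The unit window at \<open>X n\<close> eventually leaves every fixed point, so dominated
  convergence applies to the preceding bound. Assuming only that \<open>\<bar>X n\<bar>\<close>
  diverges covers both ends of the line.\<close>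

lemma primitive_tendsto_0:
  assumes F: "primitive F f" and int: "integrable lborel F" "integrable lborel f"
    and X: "filterlim (\<lambda>n. \<bar>X n\<bar>) at_top sequentially"
  shows "(\<lambda>n. F (X n)) \<longlonglongrightarrow> 0"
proof (rule Lim_null_comparison)
  let ?w = "\<lambda>y. norm (F y) + norm (f y)"
  show "\<forall>\<^sub>F n in sequentially. norm (F (X n)) \<le> (LINT y|lborel. indicator {X n..X n+1} y *\<^sub>R ?w y)"
    using primitive_norm_le[OF F int] by simp
  have "(\<lambda>n. LINT y|lborel. indicator {X n..X n+1} y *\<^sub>R ?w y) \<longlonglongrightarrow> (LINT y::real|lborel. 0::real)"
  proof (rule integral_dominated_convergence[where w="?w"])
    have [measurable]: "F \<in> borel_measurable borel" "f \<in> borel_measurable borel"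
      using int by auto
    show "(\<lambda>y. indicator {X n..X n+1} y *\<^sub>R ?w y) \<in> borel_measurable lborel" for n
      by measurable
    show "AE y in lborel. (\<lambda>n. indicator {X n..X n+1} y *\<^sub>R ?w y) \<longlonglongrightarrow> 0"
    proof (intro AE_I2)
      fix y
      \<comment> \<open>The extra 1 is the length of the window: for negative \<open>X n\<close> its
        right end \<open>X n + 1\<close> must still lie below y.\<close>
      have "\<forall>\<^sub>F n in sequentially. \<bar>y\<bar> + 1 < \<bar>X n\<bar>"
        using X by (simp add: filterlim_at_top_dense)
      then have "\<forall>\<^sub>F n in sequentially. indicator {X n..X n+1} y *\<^sub>R ?w y = 0"
        by eventually_elim (auto simp: indicator_def abs_if split: if_splits)
      then show "(\<lambda>n. indicator {X n..X n+1} y *\<^sub>R ?w y) \<longlonglongrightarrow> 0"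
        by (rule tendsto_eventually)
    qed
  qed (use int in \<open>auto simp: indicator_def\<close>)
  then show "(\<lambda>n. LINT y|lborel. indicator {X n..X n+1} y *\<^sub>R ?w y) \<longlonglongrightarrow> 0" by simp
qed

lemma filterlim_abs_real_sequentially:
  "filterlim (\<lambda>n. \<bar>real n\<bar>) at_top sequentially" "filterlim (\<lambda>n. \<bar>- real n\<bar>) at_top sequentially"
  by (simp_all add: filterlim_real_sequentially)

lemma primitive_integral_eq_0:
  assumes F: "primitive F f" and int: "integrable lborel F" "integrable lborel f"
  shows "(LINT x|lborel. f x) = 0"
proof (rule LIMSEQ_unique)
  show "(\<lambda>n. LINT x|lborel. indicator {-real n..real n} x *\<^sub>R f x) \<longlonglongrightarrow> (LINT x|lborel. f x)"
  proof (rule integral_dominated_convergence[where w="\<lambda>x. norm (f x)"])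
    show "AE x in lborel. (\<lambda>n. indicator {-real n..real n} x *\<^sub>R f x) \<longlonglongrightarrow> f x"
    proof (intro AE_I2)
      fix x
      have "\<forall>\<^sub>F n in sequentially. \<bar>x\<bar> \<le> real n"
        using filterlim_real_sequentially by (simp add: filterlim_at_top)
      then have "\<forall>\<^sub>F n in sequentially. indicator {-real n..real n} x *\<^sub>R f x = f x"
        by eventually_elim (auto simp: indicator_def)
      then show "(\<lambda>n. indicator {-real n..real n} x *\<^sub>R f x) \<longlonglongrightarrow> f x"
        by (rule tendsto_eventually)
    qed
  qed (use int in \<open>auto simp: indicator_def\<close>)
  have "(\<lambda>n. F (real n) - F (- real n)) \<longlonglongrightarrow> 0 - 0"
    by (intro tendsto_diff primitive_tendsto_0[OF F int] filterlim_abs_real_sequentially)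
  moreover have "(LINT x|lborel. indicator {-real n..real n} x *\<^sub>R f x) = F (real n) - F (- real n)" for n
    using primitiveD(3)[OF F, of "-real n" "real n"] by (simp add: set_lebesgue_integral_def)
  ultimately show "(\<lambda>n. LINT x|lborel. indicator {-real n..real n} x *\<^sub>R f x) \<longlonglongrightarrow> 0" by simp
qed

text \<open>F vanishes at minus infinity, so \<open>F x\<close> is the integral of f over the
  half-line up to x.\<close>

lemma primitive_le_integral_norm_deriv:
  assumes F: "primitive F f" and int: "integrable lborel F" "integrable lborel f"
  shows "norm (F x) \<le> (LINT y|lborel. norm (f y))"
proof (rule LIMSEQ_le_const2)
  have "(\<lambda>n. F x - F (- real n)) \<longlonglongrightarrow> F x - 0"
    by (intro tendsto_diff tendsto_const primitive_tendsto_0[OF F int] filterlim_abs_real_sequentially)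
  then show "(\<lambda>n. norm (F x - F (- real n))) \<longlonglongrightarrow> norm (F x)"
    using tendsto_norm by fastforce
  have "norm (F x - F (- real n)) \<le> (LINT y|lborel. norm (f y))" if "n \<ge> nat \<lceil>\<bar>x\<bar>\<rceil>" for n
  proof -
    have n: "- real n \<le> x" using that by linarith
    have "norm (LINT t:{-real n..x}|lborel. f t) \<le> (LINT t:{-real n..x}|lborel. norm (f t))"
      using primitiveD(2)[OF F n] by (intro set_integral_norm_bound) auto
    also have "\<dots> \<le> (LINT y|lborel. norm (f y))"
      unfolding set_lebesgue_integral_def using int
      by (intro integral_mono integrable_mult_indicator) (auto simp: indicator_def)
    finally show ?thesis using primitiveD(3)[OF F n] by simp
  qed
  then show "\<exists>N. \<forall>n\<ge>N. norm (F x - F (- real n)) \<le> (LINT y|lborel. norm (f y))" by blast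
qed

subsection \<open>Test functions and weak derivatives\<close>

text \<open>The first half of \<open>test_function\<close>, separated because the factors from which
  bumps are built have no compact support.\<close>

definition smooth :: "(real \<Rightarrow> real) \<Rightarrow> bool" where
  "smooth f \<longleftrightarrow> (\<forall>n. (deriv ^^ n) f differentiable_on UNIV)"

lemma smoothD:
  assumes "smooth f"
  shows "(f has_real_derivative deriv f x) (at x)" "smooth (deriv f)"
proof -
  have "(deriv ^^ 0) f differentiable_on UNIV"
    using assms unfolding smooth_def by blast
  then show "(f has_real_derivative deriv f x) (at x)"
    by (simp add: differentiable_on_def DERIV_deriv_iff_real_differentiable)
  have "(deriv ^^ n) (deriv f) differentiable_on UNIV" for n
    using assms unfolding smooth_def by (metis funpow_swap1 funpow.simps(2) o_apply)
  then show "smooth (deriv f)" by (simp add: smooth_def)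
qed

text \<open>A class containing a derivative of each of its members consists of smooth functions.
  Exhibiting such a class replaces explicit formulas for n-th derivatives.\<close>

lemma smooth_coinduct:
  assumes "S f" "\<And>g. S g \<Longrightarrow> \<exists>g'. S g' \<and> (\<forall>x. (g has_real_derivative g' x) (at x))"
  shows "smooth f"
proof -
  have *: "S (deriv g) \<and> g differentiable_on UNIV" if "S g" for g
  proof -
    obtain g' where g': "S g'" "\<And>x. (g has_real_derivative g' x) (at x)"
      using assms(2) \<open>S g\<close> by blast
    then have "deriv g = g'" by (auto intro: DERIV_imp_deriv)
    with g' show ?thesis
      by (auto simp: differentiable_on_def real_differentiable_def)
  qed
  have "S ((deriv ^^ n) f)" for n
    by (induction n) (auto simp: assms(1) *)
  then show ?thesis by (simp add: smooth_def *)
qed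

lemma smooth_affine:
  assumes "smooth f" shows "smooth (\<lambda>x. f (a * x + b))"
\<comment> \<open>Each differentiation brings out a factor \<open>a\<close>, so constant multiples
  have to belong to the class.\<close>
proof (rule smooth_coinduct[where S="\<lambda>h. \<exists>g c. smooth g \<and> h = (\<lambda>x. c * g (a * x + b))"])
  show "\<exists>g c. smooth g \<and> (\<lambda>x. f (a * x + b)) = (\<lambda>x. c * g (a * x + b))"
    using assms by (intro exI[of _ f] exI[of _ 1]) simp
  fix h assume "\<exists>g c. smooth g \<and> h = (\<lambda>x. c * g (a * x + b))"
  then obtain g c where g: "smooth g" and h: "h = (\<lambda>x. c * g (a * x + b))" by blast
  have "(h has_real_derivative (c * a) * deriv g (a * x + b)) (at x)" for x
    unfolding h by (rule derivative_eq_intros DERIV_chain2[OF smoothD(1)[OF g]] | simp)+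
  then show "\<exists>g'. (\<exists>g c. smooth g \<and> g' = (\<lambda>x. c * g (a * x + b))) \<and> (\<forall>x. (h has_real_derivative g' x) (at x))"
    using smoothD(2)[OF g] by (intro exI[of _ "\<lambda>x. (c * a) * deriv g (a * x + b)"]) blast
qed

text \<open>The product rule turns one product into a sum of two, so finite sums of products form a
  class closed under differentiation.\<close>

inductive smooth_products :: "(real \<Rightarrow> real) \<Rightarrow> bool" where
  mult: "smooth f \<Longrightarrow> smooth g \<Longrightarrow> smooth_products (\<lambda>x. f x * g x)"
| add: "smooth_products f \<Longrightarrow> smooth_products g \<Longrightarrow> smooth_products (\<lambda>x. f x + g x)"

lemma smooth_products_smooth:
  assumes "smooth_products f" shows "smooth f"
  using assms
proof (rule smooth_coinduct)
  fix g assume "smooth_products g"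
  then show "\<exists>g'. smooth_products g' \<and> (\<forall>x. (g has_real_derivative g' x) (at x))"
  proof induction
    case (mult f g)
    then have "smooth_products (\<lambda>x. deriv f x * g x + f x * deriv g x)"
      by (intro smooth_products.intros smoothD)
    moreover have "((\<lambda>x. f x * g x) has_real_derivative deriv f x * g x + f x * deriv g x) (at x)" for x
      using mult by (auto intro!: derivative_eq_intros smoothD simp: mult.commute)
    ultimately show ?case by blast
  next
    case (add f g)
    then obtain f' g' where "smooth_products f'" "smooth_products g'"
      "\<And>x. (f has_real_derivative f' x) (at x)" "\<And>x. (g has_real_derivative g' x) (at x)" by blast
    then show ?case
      by (intro exI[of _ "\<lambda>x. f' x + g' x"]) (auto intro!: smooth_products.add derivative_intros)
  qed
qed

lemma smooth_mult: "smooth f \<Longrightarrow> smooth g \<Longrightarrow> smooth (\<lambda>x. f x * g x)"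
  by (rule smooth_products_smooth[OF smooth_products.mult])

lemma smooth_const: "smooth (\<lambda>x. c)"
proof (rule smooth_coinduct[where S="\<lambda>f. \<exists>c. f = (\<lambda>x. c)"])
  fix g assume "\<exists>c::real. g = (\<lambda>x::real. c)"
  then show "\<exists>g'. (\<exists>c. g' = (\<lambda>x. c)) \<and> (\<forall>x. (g has_real_derivative g' x) (at x))"
    by (intro exI[of _ "\<lambda>x. 0"]) auto
qed blast

text \<open>The class is generated by products only; each summand enters as a product with the
  constant 1.\<close>

lemma smooth_add:
  assumes "smooth f" "smooth g" shows "smooth (\<lambda>x. f x + g x)"
  using smooth_products_smooth[OF smooth_products.add[OF smooth_products.mult[OF assms(1) smooth_const[of 1]]
    smooth_products.mult[OF assms(2) smooth_const[of 1]]]] by simp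

section \<open>Smooth bump functions\<close>

text \<open>\<open>flat 1\<close> is the classical function exp (-1/x) extended by 0. The polynomial
  in 1/x makes the family closed under differentiation.\<close>

definition flat :: "real poly \<Rightarrow> real \<Rightarrow> real" where
  "flat p x = (if x > 0 then poly p (1 / x) * exp (- (1 / x)) else 0)"

lemma poly_times_exp_tendsto_0: "((\<lambda>y::real. poly p y * exp (- y)) \<longlongrightarrow> 0) at_top"
proof -
  have "((\<lambda>y::real. \<Sum>i\<le>degree p. coeff p i * (y ^ i / exp y)) \<longlongrightarrow> (\<Sum>i\<le>degree p. coeff p i * 0)) at_top"
    by (intro tendsto_intros tendsto_power_div_exp_0)
  then show ?thesis
    by (simp add: poly_altdef sum_distrib_right exp_minus divide_inverse mult.assoc)
qed

text \<open>With y = 1/x the derivative of y is -y^2, whence the factor \<open>[:0, 0, 1:]\<close>.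
  At the origin the difference quotient equals p(y) y exp (-y) on the right, which tends to 0, and
  is 0 on the left.\<close>

lemma flat_derivative:
  "(flat p has_real_derivative flat ([:0, 0, 1:] * (p - pderiv p)) x) (at x)"
proof (cases "x = 0")
  case False
  show ?thesis
  proof (cases "x > 0")
    case True
    have "((\<lambda>x. poly p (1 / x) * exp (- (1 / x))) has_real_derivative
        flat ([:0, 0, 1:] * (p - pderiv p)) x) (at x)"
      using True
      by (auto intro!: derivative_eq_intros DERIV_chain2[OF poly_DERIV]
          simp: flat_def field_simps power2_eq_square)
    moreover have "\<forall>\<^sub>F y in nhds x. poly p (1 / y) * exp (- (1 / y)) = flat p y"
      using True by (intro eventually_nhds_in_open[of "{0<..}", THEN eventually_mono]) (auto simp: flat_def)
    ultimately show ?thesis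
      by (subst DERIV_cong_ev[OF refl _ refl, symmetric]) auto
  next
    case f: False
    have "((\<lambda>x. 0) has_real_derivative 0) (at x)" by simp
    moreover have "\<forall>\<^sub>F y in nhds x. (0::real) = flat p y"
      using False f by (intro eventually_nhds_in_open[of "{..<0}", THEN eventually_mono]) (auto simp: flat_def)
    ultimately show ?thesis
      using DERIV_cong_ev[OF refl _ refl, of "\<lambda>_. 0" "flat p" x 0] f by (simp add: flat_def)
  qed
next
  case True
  have "((\<lambda>h. flat p h / h) \<longlongrightarrow> 0) (at_right 0)"
  proof -
    have "((\<lambda>h. poly ([:0, 1:] * p) (inverse h) * exp (- inverse h)) \<longlongrightarrow> 0) (at_right (0::real))"
      by (rule filterlim_compose[OF poly_times_exp_tendsto_0 filterlim_inverse_at_top_right])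
    moreover have "\<forall>\<^sub>F h in at_right (0::real). poly ([:0, 1:] * p) (inverse h) * exp (- inverse h) = flat p h / h"
      by (auto simp: eventually_at_right_field flat_def field_simps intro!: exI[of _ 1])
    ultimately show ?thesis by (rule Lim_transform_eventually)
  qed
  moreover have "((\<lambda>h. flat p h / h) \<longlongrightarrow> 0) (at_left 0)"
    by (rule tendsto_eventually) (auto simp: eventually_at_left_field flat_def intro!: exI[of _ "-1"])
  ultimately have "((\<lambda>h. flat p h / h) \<longlongrightarrow> 0) (at 0)"
    by (simp add: filterlim_split_at)
  then show ?thesis using True by (simp add: DERIV_def flat_def)
qed

lemma smooth_flat: "smooth (flat p)"
  by (rule smooth_coinduct[where S="\<lambda>f. \<exists>p. f = flat p"]) (use flat_derivative in blast)+

lemma test_function_iff: "test_function \<phi> \<longleftrightarrow> smooth \<phi> \<and> (\<exists>r. \<forall>x. \<bar>x\<bar> > r \<longrightarrow> \<phi> x = 0)"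
  by (simp add: test_function_def smooth_def)

text \<open>Positive exactly on the interval from a to b. Dividing by \<open>s\<close> inside
  \<open>flat 1\<close> multiplies the exponents by \<open>s\<close>: the support stays fixed while
  the values inside tend to 1 as \<open>s\<close> decreases to 0.\<close>

definition bump :: "real \<Rightarrow> real \<Rightarrow> real \<Rightarrow> real \<Rightarrow> real" where
  "bump a b s x = flat 1 ((x - a) / s) * flat 1 ((b - x) / s)"

lemma bump_eq:
  assumes "s > 0"
  shows "bump a b s x = (if a < x \<and> x < b then exp (- (s / (x - a))) * exp (- (s / (b - x))) else 0)"
  using assms by (auto simp: bump_def flat_def zero_less_divide_iff)

lemma test_function_bump:
  assumes "s > 0" shows "test_function (bump a b s)"
  unfolding test_function_iff
proof
  have *: "bump a b s = (\<lambda>x. flat 1 ((1/s) * x + (- a / s)) * flat 1 ((- 1/s) * x + b / s))"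
    by (auto simp: bump_def diff_divide_distrib)
  show "smooth (bump a b s)"
    unfolding * by (intro smooth_mult smooth_affine smooth_flat)
  show "\<exists>r. \<forall>x. r < \<bar>x\<bar> \<longrightarrow> bump a b s x = 0"
    by (intro exI[of _ "max \<bar>a\<bar> \<bar>b\<bar>"]) (auto simp: bump_eq[OF assms])
qed

lemma test_functionE:
  assumes "test_function \<phi>"
  obtains r where "r > 0" "\<And>x. \<bar>x\<bar> \<ge> r \<Longrightarrow> \<phi> x = 0"
proof -
  obtain r where "\<And>x. \<bar>x\<bar> > r \<Longrightarrow> \<phi> x = 0"
    using assms by (auto simp: test_function_def)
  \<comment> \<open>Enlarging the radius makes it positive and lets the function vanish also at
    distance exactly r, so that boundary terms at r and -r disappear.\<close>
  then show thesis by (intro that[of "\<bar>r\<bar> + 1"]) auto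
qed

lemma test_function_DERIV:
  assumes "test_function \<phi>" shows "(\<phi> has_real_derivative deriv \<phi> x) (at x)"
  using assms smoothD(1) by (auto simp: test_function_iff)

lemma test_function_continuous:
  assumes "test_function \<phi>" shows "continuous_on S \<phi>"
  using test_function_DERIV[OF assms] by (meson DERIV_isCont continuous_at_imp_continuous_on)

lemma test_function_measurable:
  assumes "test_function \<phi>" shows "\<phi> \<in> borel_measurable borel"
  using test_function_continuous[OF assms] by (rule borel_measurable_continuous_onI)

lemma test_function_deriv:
  assumes "test_function \<phi>" shows "test_function (deriv \<phi>)"
proof -
  obtain r where r: "r > 0" "\<And>x. \<bar>x\<bar> \<ge> r \<Longrightarrow> \<phi> x = 0" using assms test_functionE by blast
  have "deriv \<phi> x = 0" if "\<bar>x\<bar> > r" for x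
  proof -
    have "\<forall>\<^sub>F y in nhds x. \<phi> y = 0"
      using that r by (intro eventually_nhds_in_open[of "{y. \<bar>y\<bar> > r}", THEN eventually_mono])
        (auto intro!: open_Collect_less continuous_intros)
    then have "(\<phi> has_real_derivative 0) (at x)"
      by (subst DERIV_cong_ev[OF refl _ refl, of _ "\<lambda>_. 0"]) auto
    then show ?thesis by (rule DERIV_imp_deriv)
  qed
  then show ?thesis using assms smoothD(2) by (auto simp: test_function_iff)
qed

lemma test_function_primitive:
  assumes "test_function \<phi>"
  shows "primitive (\<lambda>x. complex_of_real (\<phi> x)) (\<lambda>x. complex_of_real (deriv \<phi> x))"
proof (rule primitive_C1)
  show "((\<lambda>x. complex_of_real (\<phi> x)) has_vector_derivative complex_of_real (deriv \<phi> x)) (at x)" for x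
    by (rule has_vector_derivative_of_real[OF test_function_DERIV[OF assms]])
  show "continuous_on UNIV (\<lambda>x. complex_of_real (deriv \<phi> x))"
    using test_function_continuous[OF test_function_deriv[OF assms]] by (intro continuous_intros)
qed

lemma test_function_integrable:
  fixes w :: "real \<Rightarrow> complex"
  assumes "test_function \<phi>" "\<And>a b. set_integrable lborel {a..b} w"
  shows "integrable lborel (\<lambda>x. \<phi> x *\<^sub>R w x)"
proof -
  obtain r where r: "r > 0" "\<And>x. \<bar>x\<bar> \<ge> r \<Longrightarrow> \<phi> x = 0" using assms test_functionE by blast
  have "set_integrable lborel {-r..r} (\<lambda>x. w x * complex_of_real (\<phi> x))"
    using assms test_function_measurable[OF assms(1)]
    by (intro set_integrable_mult_continuous continuous_intros test_function_continuous) measurable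
  moreover have "indicator {-r..r} x *\<^sub>R (w x * complex_of_real (\<phi> x)) = \<phi> x *\<^sub>R w x" for x
    using r(2)[of x] by (cases "\<bar>x\<bar> \<ge> r") (auto simp: indicator_def scaleR_conv_of_real)
  ultimately show ?thesis by (simp add: set_integrable_def)
qed

text \<open>As \<open>s \<rightarrow> 0\<close>, the functions \<open>bump a b s\<close> increase to the indicator of \<open>{a<..<b}\<close>.\<close>

lemma integral_Ioc_eq_0_if_test_functions:
  fixes w :: "real \<Rightarrow> complex"
  assumes [measurable]: "w \<in> borel_measurable borel" and w: "\<And>a b. set_integrable lborel {a..b} w"
    and 0: "\<And>\<phi>. test_function \<phi> \<Longrightarrow> (LINT x|lborel. \<phi> x *\<^sub>R w x) = 0"
  shows "(LINT x:{a<..b}|lborel. w x) = 0"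
proof -
  let ?s = "\<lambda>n. inverse (real (Suc n))"
  have [measurable]: "bump a b (?s n) \<in> borel_measurable borel" for n
    by (intro test_function_measurable test_function_bump) simp
  have lim: "(\<lambda>n. LINT x|lborel. bump a b (?s n) x *\<^sub>R w x) \<longlonglongrightarrow> (LINT x|lborel. indicator {a<..<b} x *\<^sub>R w x)"
  proof (rule integral_dominated_convergence[where w="\<lambda>x. norm (indicator {a..b} x *\<^sub>R w x)"])
    show "AE x in lborel. (\<lambda>n. bump a b (?s n) x *\<^sub>R w x) \<longlonglongrightarrow> indicator {a<..<b} x *\<^sub>R w x"
    proof (intro AE_I2 tendsto_scaleR tendsto_const)
      fix x
      show "(\<lambda>n. bump a b (?s n) x) \<longlonglongrightarrow> indicator {a<..<b} x"
      proof (cases "a < x \<and> x < b")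
        case True
        have "(\<lambda>n. exp (- (?s n / (x - a))) * exp (- (?s n / (b - x)))) \<longlonglongrightarrow> exp (- (0 / (x - a))) * exp (- (0 / (b - x)))"
          using True by (intro tendsto_intros LIMSEQ_inverse_real_of_nat) auto
        then show ?thesis using True by (simp add: bump_eq)
      qed (auto simp: bump_eq)
    qed
    show "AE x in lborel. norm (bump a b (?s n) x *\<^sub>R w x) \<le> norm (indicator {a..b} x *\<^sub>R w x)" for n
    proof (intro AE_I2)
      fix x
      have "\<bar>bump a b (?s n) x\<bar> \<le> indicator {a..b} x"
        by (auto simp: bump_eq abs_mult intro!: mult_le_one)
      from mult_right_mono[OF this, of "norm (w x)"]
      show "norm (bump a b (?s n) x *\<^sub>R w x) \<le> norm (indicator {a..b} x *\<^sub>R w x)" by simp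
    qed
    show "integrable lborel (\<lambda>x. norm (indicator {a..b} x *\<^sub>R w x))"
      using w[of a b] unfolding set_integrable_def by (rule integrable_norm)
  qed measurable
  have "(LINT x|lborel. indicator {a<..<b} x *\<^sub>R w x) = 0"
    using LIMSEQ_unique[OF lim] 0[OF test_function_bump] by simp
  \<comment> \<open>Half-open intervals are the intersection-stable generator of the Borel sets used
    in the next lemma; the added endpoint is a null set.\<close>
  moreover have "(LINT x|lborel. indicator {a<..<b} x *\<^sub>R w x) = (LINT x|lborel. indicator {a<..b} x *\<^sub>R w x)"
  proof (rule integral_cong_AE)
    show "AE x in lborel. indicator {a<..<b} x *\<^sub>R w x = indicator {a<..b} x *\<^sub>R w x"
      using AE_lborel_singleton[of b] by eventually_elim (auto simp: indicator_def)
  qed measurable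
  ultimately show ?thesis by (simp add: set_lebesgue_integral_def)
qed

text \<open>Vanishing integrals over half-open intervals extend to all Borel sets by the Dynkin
  argument, and then w is zero almost everywhere. Restricting w to (-n, n] first makes it
  integrable, as the complement step requires.\<close>

lemma fundamental_lemma:
  fixes w :: "real \<Rightarrow> complex"
  assumes meas [measurable]: "w \<in> borel_measurable borel" and w: "\<And>a b. set_integrable lborel {a..b} w"
    and 0: "\<And>\<phi>. test_function \<phi> \<Longrightarrow> (LINT x|lborel. \<phi> x *\<^sub>R w x) = 0"
  shows "AE x in lborel. w x = 0"
proof -
  have "AE x in lborel. indicator {-real n<..real n} x *\<^sub>R w x = 0" for n
  proof -
    let ?g = "\<lambda>x. indicator {-real n<..real n} x *\<^sub>R w x"
    have g: "integrable lborel ?g"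
      using set_integrable_subset[OF w[of "-real n" "real n"], of "{-real n<..real n}"]
      unfolding set_integrable_def by (simp add: subset_eq)
    have gA: "set_integrable lborel A ?g" if "A \<in> sets borel" for A
      using integrable_mult_indicator[OF _ g, of A] that by (simp add: set_integrable_def)
    have "(LINT x:A|lborel. ?g x) = 0" if "A \<in> sets lborel" for A
    proof -
      let ?G = "range (\<lambda>(a, b). {a<..b::real})"
      have "A \<in> sigma_sets UNIV ?G"
        using that by (simp add: borel_sigma_sets_Ioc)
      have borel: "A \<in> sets borel" if "A \<in> sigma_sets UNIV ?G" for A
        using that by (simp add: borel_sigma_sets_Ioc)
      have "Int_stable ?G"
        by (auto simp: Int_stable_def Int_greaterThanAtMost)
      moreover have "?G \<subseteq> Pow UNIV" by simp
      ultimately show ?thesis using \<open>A \<in> sigma_sets UNIV ?G\<close>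
      proof (induction rule: sigma_sets_induct_disjoint)
        case (basic A)
        then obtain a b where A: "A = {a<..b}" by auto
        have "(LINT x:A|lborel. ?g x) = (LINT x:{max a (-real n)<..min b (real n)}|lborel. w x)"
          unfolding A set_lebesgue_integral_def
          by (intro Bochner_Integration.integral_cong) (auto simp: indicator_def)
        also have "\<dots> = 0" by (rule integral_Ioc_eq_0_if_test_functions[OF assms])
        finally show ?case .
      next
        case (compl A)
        have "(LINT x:UNIV|lborel. ?g x) = (LINT x:{-real n<..real n}|lborel. w x)"
          by (simp add: set_lebesgue_integral_def)
        also have "\<dots> = 0" by (rule integral_Ioc_eq_0_if_test_functions[OF assms])
        finally have "(LINT x:UNIV - A|lborel. ?g x) + (LINT x:A|lborel. ?g x) = 0"
          using set_integral_Un[of "UNIV - A" A lborel ?g] gA[of A] gA[of "UNIV - A"] borel[OF compl(1)]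
          by (simp add: Diff_Int_distrib2)
        then show ?case using compl by simp
      next
        case (union A)
        have "(LINT x:(\<Union>i. A i)|lborel. ?g x) = (\<Sum>i. (LINT x:(A i)|lborel. ?g x))"
        proof (rule lebesgue_integral_countable_add)
          show Ai: "A i \<in> sets lborel" for i using union borel by auto
          then show "set_integrable lborel (\<Union>i. A i) ?g" by (intro gA) auto
          show "i \<noteq> j \<Longrightarrow> A i \<inter> A j = {}" for i j
            using union(1) by (auto simp: disjoint_family_on_def)
        qed
        then show ?case using union by simp
      qed (auto simp: set_lebesgue_integral_def)
    qed
    then show ?thesis
      using sigma_finite_measure.density_zero[OF sigma_finite_lborel g] by simp
  qed
  then have "AE x in lborel. \<forall>n::nat. indicator {-real n<..real n} x *\<^sub>R w x = 0"
    unfolding AE_all_countable by blast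
  then show ?thesis
  proof eventually_elim
    case (elim x)
    obtain n where "\<bar>x\<bar> < real n" using reals_Archimedean2 by blast
    with elim[rule_format, of n] show ?case by (auto simp: indicator_def split: if_splits)
  qed
qed

section \<open>The du Bois-Reymond lemma\<close>

lemma integral_test_function:
  assumes "test_function \<phi>" "\<And>x. \<bar>x\<bar> \<ge> r \<Longrightarrow> \<phi> x = 0"
  shows "integrable lborel \<phi>" "(LINT x|lborel. \<phi> x) = (LINT x:{-r..r}|lborel. \<phi> x)"
proof -
  have *: "(\<lambda>x. indicator {-r..r} x *\<^sub>R \<phi> x) = \<phi>"
  proof
    fix x show "indicator {-r..r} x *\<^sub>R \<phi> x = \<phi> x"
      using assms(2)[of x] by (cases "\<bar>x\<bar> \<ge> r") (auto simp: indicator_def)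
  qed
  show "integrable lborel \<phi>"
    using borel_integrable_atLeastAtMost'[OF test_function_continuous[OF assms(1)], of "-r" r]
    unfolding set_integrable_def * .
  show "(LINT x|lborel. \<phi> x) = (LINT x:{-r..r}|lborel. \<phi> x)"
    unfolding set_lebesgue_integral_def * ..
qed

lemma test_function_integrable_real: "test_function \<phi> \<Longrightarrow> integrable lborel \<phi>"
  by (rule test_functionE, assumption, rule integral_test_function(1))

text \<open>The antiderivative starting from 0 on the left of the support is constant on its right,
  and that constant is the integral of \<theta>; mean zero is what makes it compactly
  supported.\<close>

lemma test_function_antideriv:
  assumes \<theta>: "test_function \<theta>" and 0: "(LINT x|lborel. \<theta> x) = 0"
  obtains \<phi> where "test_function \<phi>" "deriv \<phi> = \<theta>"
proof -
  obtain r where r: "r > 0" "\<And>x. \<bar>x\<bar> \<ge> r \<Longrightarrow> \<theta> x = 0" using \<theta> test_functionE by blast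
  have cont: "isCont \<theta> x" for x using test_function_DERIV[OF \<theta>] DERIV_isCont by blast
  obtain F where F: "\<And>x. (F has_vector_derivative \<theta> x) (at x)"
    using einterval_antiderivative[of "-\<infinity>" "\<infinity>" \<theta>] cont by auto
  define \<phi> where "\<phi> = (\<lambda>x. F x - F (- r))"
  have D: "(\<phi> has_real_derivative \<theta> x) (at x)" for x
    unfolding \<phi>_def has_real_derivative_iff_has_vector_derivative
    using F by (auto intro!: derivative_eq_intros)
  have FTC: "(LINT x:{a..b}|lborel. \<theta> x) = F b - F a" if "a \<le> b" for a b
    unfolding set_lebesgue_integral_def using that
    by (rule integral_FTC_atLeastAtMost[OF _ has_vector_derivative_at_within[OF F] test_function_continuous[OF \<theta>]])
  have zero: "(LINT x:{a..b}|lborel. \<theta> x) = 0" if "a \<ge> r \<or> b \<le> - r" for a b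
  proof -
    have "indicator {a..b} x *\<^sub>R \<theta> x = 0" for x
      using that r(2)[of x] r(1) by (cases "r \<le> \<bar>x\<bar>") (auto simp: indicator_def)
    then show ?thesis by (simp only: set_lebesgue_integral_def) simp
  qed
  have "F r - F (- r) = 0"
    using FTC[of "-r" r] integral_test_function(2)[OF \<theta> r(2)] r 0 by simp
  then have "\<phi> x = 0" if "\<bar>x\<bar> > r" for x
    using FTC[of x "-r"] FTC[of r x] zero[of x "-r"] zero[of r x] that r
    by (cases "x > r") (auto simp: \<phi>_def abs_if split: if_splits)
  moreover have d: "deriv \<phi> = \<theta>" using D DERIV_imp_deriv by blast
  moreover have "smooth \<phi>"
  \<comment> \<open>Only the first derivative is new, and it is the smooth function \<theta>; hence
    the class is \<phi> together with all smooth functions.\<close>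
  proof (rule smooth_coinduct[where S="\<lambda>f. f = \<phi> \<or> smooth f"])
    fix g assume "g = \<phi> \<or> smooth g"
    then show "\<exists>g'. (g' = \<phi> \<or> smooth g') \<and> (\<forall>x. (g has_real_derivative g' x) (at x))"
    proof
      assume "g = \<phi>"
      then show ?thesis using D \<theta> by (intro exI[of _ \<theta>]) (auto simp: test_function_iff)
    next
      assume "smooth g"
      then show ?thesis using smoothD[of g] by (intro exI[of _ "deriv g"]) auto
    qed
  qed simp
  ultimately show thesis using that by (auto simp: test_function_iff)
qed

lemma test_function_integrate_by_parts:
  assumes \<phi>: "test_function \<phi>" and G: "primitive G g"
  shows "(LINT x|lborel. deriv \<phi> x *\<^sub>R G x) = - (LINT x|lborel. \<phi> x *\<^sub>R g x)"
proof -
  obtain r where r: "r > 0" "\<And>x. \<bar>x\<bar> \<ge> r \<Longrightarrow> \<phi> x = 0" using \<phi> test_functionE by blast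
  obtain r' where r': "r' > 0" "\<And>x. \<bar>x\<bar> \<ge> r' \<Longrightarrow> deriv \<phi> x = 0"
    using test_function_deriv[OF \<phi>] test_functionE by blast
  define R where "R = max r r'"
  have R: "R > 0" "\<And>x. \<bar>x\<bar> \<ge> R \<Longrightarrow> \<phi> x = 0 \<and> deriv \<phi> x = 0" using r r' by (auto simp: R_def)
  have "set_integrable lborel {a..b} G" for a b
    using primitive_continuous[OF G] by (rule borel_integrable_atLeastAtMost')
  moreover have "set_integrable lborel {a..b} g" for a b
    using primitiveD(2)[OF G, of a b] by (cases "a \<le> b") (auto simp: set_integrable_def)
  ultimately have int: "integrable lborel (\<lambda>x. deriv \<phi> x *\<^sub>R G x)" "integrable lborel (\<lambda>x. \<phi> x *\<^sub>R g x)"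
    using test_function_integrable[OF \<phi>] test_function_integrable[OF test_function_deriv[OF \<phi>]] by auto
  have "indicator {-R..R} x *\<^sub>R (of_real (deriv \<phi> x) * G x + of_real (\<phi> x) * g x) = deriv \<phi> x *\<^sub>R G x + \<phi> x *\<^sub>R g x" for x
    using R(2)[of x] by (cases "\<bar>x\<bar> \<ge> R") (auto simp: indicator_def scaleR_conv_of_real)
  then have "(LINT x|lborel. deriv \<phi> x *\<^sub>R G x + \<phi> x *\<^sub>R g x) = of_real (\<phi> R) * G R - of_real (\<phi> (-R)) * G (-R)"
    using primitiveD(3)[OF primitive_mult[OF test_function_primitive[OF \<phi>] G], of "-R" R] R(1)
    by (simp add: set_lebesgue_integral_def)
  also have "\<dots> = 0" using R by simp
  finally show ?thesis using int by (simp add: eq_neg_iff_add_eq_0)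
qed

lemma integral_pos_if_pos_on_Ioo:
  fixes f :: "real \<Rightarrow> real"
  assumes "integrable lborel f" "\<And>x. 0 \<le> f x" "\<And>x. -1 < x \<Longrightarrow> x < 1 \<Longrightarrow> 0 < f x"
  shows "0 < (LINT x|lborel. f x)"
proof (rule ccontr)
  assume "\<not> 0 < (LINT x|lborel. f x)"
  moreover have "0 \<le> (LINT x|lborel. f x)" using assms(2) by simp
  ultimately have "(LINT x|lborel. f x) = 0" by simp
  then have "AE x in lborel. f x = 0"
    using integral_nonneg_eq_0_iff_AE[OF assms(1)] assms(2) by simp
  then have "AE x in lborel. x \<notin> {-1<..<1::real}"
    by eventually_elim (use assms(3) in force)
  moreover have "{x \<in> space lborel. \<not> x \<notin> {-1<..<1::real}} = {-1<..<1}" by auto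
  ultimately have "emeasure lborel {-1<..<1::real} = 0"
    using AE_iff_measurable[of "{-1<..<1::real}" lborel "\<lambda>x. x \<notin> {-1<..<1}"] by simp
  moreover have "emeasure lborel {-1<..<1::real} = 2"
    by (subst emeasure_lborel_Ioo) auto
  ultimately show False by simp
qed

text \<open>\<open>w = u - G\<close> integrates to 0 against every derivative of a test function.
  Every test function is such a derivative plus a multiple of one fixed bump, so w behaves like a
  constant under all tests.\<close>

lemma du_Bois_Reymond:
  fixes u g :: "real \<Rightarrow> complex"
  assumes u: "u \<in> borel_measurable borel" "\<And>a b. set_integrable lborel {a..b} u"
    and g: "g \<in> borel_measurable borel" "\<And>a b. set_integrable lborel {a..b} g"
    and weak: "\<And>\<phi>. test_function \<phi> \<Longrightarrow> (LINT x|lborel. deriv \<phi> x *\<^sub>R u x) = - (LINT x|lborel. \<phi> x *\<^sub>R g x)"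
  obtains U where "primitive U g" "AE x in lborel. u x = U x"
proof -
  obtain G where G: "primitive G g" using primitive_exists g by blast
  have Gint: "set_integrable lborel {a..b} G" for a b
    using primitive_continuous[OF G] by (rule borel_integrable_atLeastAtMost')
  define w where "w = (\<lambda>x. u x - G x)"
  have wmeas: "w \<in> borel_measurable borel"
    using u primitive_measurable[OF G] unfolding w_def by measurable
  have wint: "set_integrable lborel {a..b} w" for a b
    unfolding w_def using u Gint by (intro set_integral_diff) auto
  have w0: "(LINT x|lborel. deriv \<phi> x *\<^sub>R w x) = 0" if "test_function \<phi>" for \<phi>
    using weak[OF that] test_function_integrate_by_parts[OF that G]
      test_function_integrable[OF test_function_deriv[OF that] u(2)]
      test_function_integrable[OF test_function_deriv[OF that] Gint]
    by (simp add: w_def scaleR_diff_right)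
  define \<beta> where "\<beta> = bump (-1) 1 1"
  have \<beta>: "test_function \<beta>" unfolding \<beta>_def by (rule test_function_bump) simp
  have \<beta>int: "integrable lborel \<beta>" using \<beta> by (rule test_function_integrable_real)
  define J where "J = (LINT x|lborel. \<beta> x)"
  have "J > 0"
    unfolding J_def by (rule integral_pos_if_pos_on_Ioo[OF \<beta>int]) (auto simp: \<beta>_def bump_eq)
  then have "J \<noteq> 0" by simp
  \<comment> \<open>The only candidate for the constant: the mean of w weighted by the fixed bump
    \<beta>.\<close>
  define c where "c = (LINT x|lborel. \<beta> x *\<^sub>R w x) /\<^sub>R J"
  have "(LINT x|lborel. \<psi> x *\<^sub>R (w x - c)) = 0" if \<psi>: "test_function \<psi>" for \<psi>
  proof -
    define I where "I = (LINT x|lborel. \<psi> x)"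
    have \<psi>int: "integrable lborel \<psi>" using \<psi> by (rule test_function_integrable_real)
    \<comment> \<open>Subtracting the multiple of \<beta> with the same integral leaves a test
      function of mean zero, which has a compactly supported antiderivative.\<close>
    define \<theta> where "\<theta> = (\<lambda>x. \<psi> x + (- (I / J)) * \<beta> x)"
    have "smooth \<theta>"
      unfolding \<theta>_def using \<psi> \<beta> by (intro smooth_add smooth_mult smooth_const) (auto simp: test_function_iff)
    moreover have "\<exists>r. \<forall>x. \<bar>x\<bar> > r \<longrightarrow> \<theta> x = 0"
    proof -
      obtain r where "\<And>x. \<bar>x\<bar> \<ge> r \<Longrightarrow> \<psi> x = 0" using test_functionE[OF \<psi>] by metis
      moreover obtain r' where "\<And>x. \<bar>x\<bar> \<ge> r' \<Longrightarrow> \<beta> x = 0" using test_functionE[OF \<beta>] by metis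
      ultimately show ?thesis by (intro exI[of _ "max r r'"]) (auto simp: \<theta>_def)
    qed
    ultimately have \<theta>: "test_function \<theta>" by (auto simp: test_function_iff)
    have "(LINT x|lborel. \<theta> x) = I + (- (I / J)) * J"
      unfolding \<theta>_def I_def J_def using \<beta>int \<psi>int by (subst Bochner_Integration.integral_add) auto
    then have "(LINT x|lborel. \<theta> x) = 0" using \<open>J \<noteq> 0\<close> by simp
    then obtain \<phi> where "test_function \<phi>" "deriv \<phi> = \<theta>" by (rule test_function_antideriv[OF \<theta>])
    then have "0 = (LINT x|lborel. \<theta> x *\<^sub>R w x)" using w0[of \<phi>] by simp
    also have "\<dots> = (LINT x|lborel. \<psi> x *\<^sub>R w x + (- (I / J)) *\<^sub>R (\<beta> x *\<^sub>R w x))"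
      by (simp add: \<theta>_def scaleR_add_left scaleR_diff_left)
    also have "\<dots> = (LINT x|lborel. \<psi> x *\<^sub>R w x) + (- (I / J)) *\<^sub>R (LINT x|lborel. \<beta> x *\<^sub>R w x)"
      by (subst Bochner_Integration.integral_add[OF test_function_integrable[OF \<psi> wint]
            integrable_scaleR_right[OF test_function_integrable[OF \<beta> wint]]])
        (simp only: integral_scaleR_right)
    also have "\<dots> = (LINT x|lborel. \<psi> x *\<^sub>R w x) - I *\<^sub>R c"
      by (simp add: c_def divide_inverse)
    also have "I *\<^sub>R c = (LINT x|lborel. \<psi> x *\<^sub>R c)"
      unfolding I_def using \<psi>int by simp
    also have "(LINT x|lborel. \<psi> x *\<^sub>R w x) - \<dots> = (LINT x|lborel. \<psi> x *\<^sub>R (w x - c))"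
      using test_function_integrable[OF \<psi> wint] \<psi>int
      by (subst Bochner_Integration.integral_diff[symmetric]) (auto simp: scaleR_diff_right)
    finally show ?thesis by simp
  qed
  moreover have "set_integrable lborel {a..b} (\<lambda>x. w x - c)" for a b
    by (intro set_integral_diff wint borel_integrable_atLeastAtMost' continuous_intros)
  moreover have "(\<lambda>x. w x - c) \<in> borel_measurable borel" using wmeas by measurable
  ultimately have "AE x in lborel. w x - c = 0" by (intro fundamental_lemma)
  then have "AE x in lborel. u x = G x + c"
    by eventually_elim (auto simp: w_def algebra_simps)
  then show thesis using that[OF primitive_shift[OF G]] by blast
qed

subsection \<open>The Fourier transform on $L^2$\<close>

abbreviation L2 :: "(real \<Rightarrow> complex) set" where
  "L2 \<equiv> Lp_space 2"

definition L2sq :: "(real \<Rightarrow> complex) \<Rightarrow> real" where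
  "L2sq u = (LINT x|lborel. (cmod (u x))\<^sup>2)"

lemma L2_iff: "u \<in> L2 \<longleftrightarrow> u \<in> borel_measurable borel \<and> integrable lborel (\<lambda>x. (cmod (u x))\<^sup>2)"
  by (simp add: Lp_space_def)

lemma L2D:
  assumes "u \<in> L2"
  shows "u \<in> borel_measurable borel" "integrable lborel (\<lambda>x. (cmod (u x))\<^sup>2)"
  using assms by (auto simp: L2_iff)

lemma L2sq_nonneg: "0 \<le> L2sq u"
  by (simp add: L2sq_def)

lemma Lp_norm_2: "Lp_norm 2 u = sqrt (L2sq u)"
  using L2sq_nonneg[of u] by (simp add: Lp_norm_def L2sq_def powr_half_sqrt)

lemma L2_bound:
  assumes "v \<in> borel_measurable borel" "integrable lborel w" "\<And>x. (cmod (v x))\<^sup>2 \<le> w x"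
  shows "v \<in> L2"
  unfolding L2_iff
proof
  have [measurable]: "v \<in> borel_measurable borel" by fact
  show "integrable lborel (\<lambda>x. (cmod (v x))\<^sup>2)"
  proof (rule Bochner_Integration.integrable_bound[OF assms(2)])
    show "AE x in lborel. norm ((cmod (v x))\<^sup>2) \<le> norm (w x)"
    proof (intro AE_I2)
      fix x show "norm ((cmod (v x))\<^sup>2) \<le> norm (w x)" using assms(3)[of x] by simp
    qed
  qed measurable
qed fact

text \<open>The free weight t serves two purposes: t = 1 gives the crude factor 2, and an optimal t
  recovers the triangle inequality.\<close>

lemma norm_add_sq_le:
  fixes a b :: "'a::real_normed_vector"
  assumes "t > 0" shows "(norm (a + b))\<^sup>2 \<le> (1 + t) * (norm a)\<^sup>2 + (1 + 1 / t) * (norm b)\<^sup>2"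
proof -
  have "(norm (a + b))\<^sup>2 \<le> (norm a + norm b)\<^sup>2"
    by (intro power_mono norm_triangle_ineq) simp
  also have "\<dots> = (norm a)\<^sup>2 + (norm b)\<^sup>2 + 2 * (norm a * norm b)" by (simp add: power2_sum)
  also have "2 * (norm a * norm b) \<le> t * (norm a)\<^sup>2 + (norm b)\<^sup>2 / t"
  proof -
    have "0 \<le> (t * norm a - norm b)\<^sup>2 / t" using assms by simp
    also have "\<dots> = t * (norm a)\<^sup>2 + (norm b)\<^sup>2 / t - 2 * (norm a * norm b)"
      using assms by (simp add: field_simps power2_eq_square)
    finally show ?thesis by simp
  qed
  finally show ?thesis by (simp add: algebra_simps)
qed

lemma L2_add:
  assumes "u \<in> L2" "v \<in> L2"
  shows "(\<lambda>x. u x + v x) \<in> L2"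
    and "t > 0 \<Longrightarrow> L2sq (\<lambda>x. u x + v x) \<le> (1 + t) * L2sq u + (1 + 1 / t) * L2sq v"
proof -
  note [measurable] = L2D(1)[OF assms(1)] L2D(1)[OF assms(2)]
  have i: "integrable lborel (\<lambda>x. (1 + t) * (cmod (u x))\<^sup>2 + (1 + 1 / t) * (cmod (v x))\<^sup>2)" for t
    using assms by (auto simp: L2_iff)
  show 1: "(\<lambda>x. u x + v x) \<in> L2"
    by (rule L2_bound[OF _ i[of 1]]) (use norm_add_sq_le[of 1] in auto)
  assume "t > 0"
  then have "L2sq (\<lambda>x. u x + v x) \<le> (LINT x|lborel. (1 + t) * (cmod (u x))\<^sup>2 + (1 + 1 / t) * (cmod (v x))\<^sup>2)"
    unfolding L2sq_def by (intro integral_mono i L2D(2)[OF 1] norm_add_sq_le)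
  also have "\<dots> = (1 + t) * L2sq u + (1 + 1 / t) * L2sq v"
    unfolding L2sq_def using assms by (subst Bochner_Integration.integral_add) (auto simp: L2_iff)
  finally show "L2sq (\<lambda>x. u x + v x) \<le> (1 + t) * L2sq u + (1 + 1 / t) * L2sq v" .
qed

lemma L2_scale:
  assumes "u \<in> L2" shows "(\<lambda>x. c * u x) \<in> L2"
  using assms by (auto simp: L2_iff norm_mult power_mult_distrib)

lemma L2sq_scale: "L2sq (\<lambda>x. c * u x) = (cmod c)\<^sup>2 * L2sq u"
  by (simp add: L2sq_def norm_mult power_mult_distrib)

lemma L2_diff:
  assumes "u \<in> L2" "v \<in> L2" shows "(\<lambda>x. u x - v x) \<in> L2"
  using L2_add(1)[OF assms(1) L2_scale[OF assms(2), of "-1"]] by simp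

lemma L2sq_diff_commute: "L2sq (\<lambda>x. u x - v x) = L2sq (\<lambda>x. v x - u x)"
  by (simp add: L2sq_def norm_minus_commute)

text \<open>The weight \<open>t = b / a\<close> turns the weighted inequality into the perfect
  square \<open>(a + b)\<^sup>2\<close>. The summands e/2 keep a and b positive when a norm
  vanishes.\<close>

lemma L2_triangle:
  assumes "u \<in> L2" "v \<in> L2"
  shows "sqrt (L2sq (\<lambda>x. u x + v x)) \<le> sqrt (L2sq u) + sqrt (L2sq v)"
proof (rule field_le_epsilon)
  fix e :: real assume "e > 0"
  define a b where "a = sqrt (L2sq u) + e/2" and "b = sqrt (L2sq v) + e/2"
  have pos: "a > 0" "b > 0"
    unfolding a_def b_def using \<open>e > 0\<close> by (simp_all add: add_nonneg_pos L2sq_nonneg)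
  have "sqrt (L2sq u) \<le> a" "sqrt (L2sq v) \<le> b" using \<open>e > 0\<close> by (auto simp: a_def b_def)
  then have le: "L2sq u \<le> a\<^sup>2" "L2sq v \<le> b\<^sup>2"
    by (simp_all add: sqrt_le_D)
  have "L2sq (\<lambda>x. u x + v x) \<le> (1 + b / a) * L2sq u + (1 + 1 / (b / a)) * L2sq v"
    using pos by (intro L2_add(2) assms) simp
  also have "\<dots> \<le> (1 + b / a) * a\<^sup>2 + (1 + 1 / (b / a)) * b\<^sup>2"
    using pos le by (intro add_mono mult_left_mono) auto
  also have "\<dots> = (a + b)\<^sup>2" using pos by (simp add: field_simps power2_eq_square)
  finally have "sqrt (L2sq (\<lambda>x. u x + v x)) \<le> a + b"
    using pos by (simp add: real_le_lsqrt)
  then show "sqrt (L2sq (\<lambda>x. u x + v x)) \<le> sqrt (L2sq u) + sqrt (L2sq v) + e" by (simp add: a_def b_def)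
qed

lemma L2sq_tendsto:
  assumes f: "\<And>n. f n \<in> L2" "g \<in> L2" and lim: "(\<lambda>n. L2sq (\<lambda>x. f n x - g x)) \<longlonglongrightarrow> 0"
  shows "(\<lambda>n. L2sq (f n)) \<longlonglongrightarrow> L2sq g"
proof -
  have "norm (sqrt (L2sq (f n)) - sqrt (L2sq g)) \<le> sqrt (L2sq (\<lambda>x. f n x - g x))" for n
    using L2_triangle[OF L2_diff[OF f(1)[of n] f(2)] f(2)] L2_triangle[OF L2_diff[OF f(2) f(1)[of n]] f(1)[of n]]
      L2sq_diff_commute[of g "f n"] by (simp add: abs_le_iff)
  moreover have "(\<lambda>n. sqrt (L2sq (\<lambda>x. f n x - g x))) \<longlonglongrightarrow> 0"
    using tendsto_real_sqrt[OF lim] by simp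
  ultimately have "(\<lambda>n. sqrt (L2sq (f n)) - sqrt (L2sq g)) \<longlonglongrightarrow> 0"
    by - (rule Lim_null_comparison[where g="\<lambda>n. sqrt (L2sq (\<lambda>x. f n x - g x))"]; auto)
  then have "(\<lambda>n. sqrt (L2sq (f n))) \<longlonglongrightarrow> sqrt (L2sq g)" by (simp add: LIM_zero_iff)
  then have "(\<lambda>n. (sqrt (L2sq (f n)))\<^sup>2) \<longlonglongrightarrow> (sqrt (L2sq g))\<^sup>2" by (rule tendsto_power)
  then show ?thesis using L2sq_nonneg by simp
qed

text \<open>The substitute for completeness: an almost everywhere limit inherits both membership in
  L^2 and the bound.\<close>

lemma L2_fatou:
  assumes f: "\<And>n. f n \<in> L2" and g: "g \<in> borel_measurable borel"
    and lim: "AE x in lborel. (\<lambda>n. f n x) \<longlonglongrightarrow> g x" and le: "\<forall>\<^sub>F n in sequentially. L2sq (f n) \<le> C"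
  shows "g \<in> L2" "L2sq g \<le> C"
proof -
  note [measurable] = L2D(1)[OF f] g
  \<comment> \<open>\<open>ennreal\<close> sends negative numbers to 0, so the sign of C is needed
    to return from extended to real inequalities.\<close>
  obtain m where "L2sq (f m) \<le> C" using eventually_happens'[OF _ le] by auto
  then have "C \<ge> 0" using L2sq_nonneg order_trans by blast
  have nn: "(\<integral>\<^sup>+x. ennreal ((cmod (f n x))\<^sup>2) \<partial>lborel) = ennreal (L2sq (f n))" for n
    unfolding L2sq_def by (rule nn_integral_eq_integral[OF L2D(2)[OF f]]) simp
  have "(\<integral>\<^sup>+x. ennreal ((cmod (g x))\<^sup>2) \<partial>lborel) = (\<integral>\<^sup>+x. liminf (\<lambda>n. ennreal ((cmod (f n x))\<^sup>2)) \<partial>lborel)"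
  proof (rule nn_integral_cong_AE)
    show "AE x in lborel. ennreal ((cmod (g x))\<^sup>2) = liminf (\<lambda>n. ennreal ((cmod (f n x))\<^sup>2))"
      using lim
    proof eventually_elim
      case (elim x)
      then have "(\<lambda>n. ennreal ((cmod (f n x))\<^sup>2)) \<longlonglongrightarrow> ennreal ((cmod (g x))\<^sup>2)"
        by (intro tendsto_intros)
      then show ?case by (rule lim_imp_Liminf[OF sequentially_bot, symmetric])
    qed
  qed
  also have "\<dots> \<le> liminf (\<lambda>n. (\<integral>\<^sup>+x. ennreal ((cmod (f n x))\<^sup>2) \<partial>lborel))"
    by (rule nn_integral_liminf) measurable
  also have "\<dots> = liminf (\<lambda>n. ennreal (L2sq (f n)))" by (simp add: nn)
  also have "\<dots> \<le> ennreal C"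
    by (rule Liminf_le) (use le in \<open>auto elim!: eventually_mono intro: ennreal_leI\<close>)
  finally have fin: "(\<integral>\<^sup>+x. ennreal ((cmod (g x))\<^sup>2) \<partial>lborel) \<le> ennreal C" .
  then have "(\<integral>\<^sup>+x. ennreal ((cmod (g x))\<^sup>2) \<partial>lborel) < \<infinity>"
    using le_less_trans ennreal_less_top by fastforce
  then have int: "integrable lborel (\<lambda>x. (cmod (g x))\<^sup>2)"
    by (intro integrableI_bounded) auto
  then show "g \<in> L2" using g by (simp add: L2_iff)
  have "ennreal (L2sq g) \<le> ennreal C"
    using fin unfolding L2sq_def by (subst (asm) nn_integral_eq_integral[OF int]) auto
  then show "L2sq g \<le> C" using \<open>C \<ge> 0\<close> by simp
qed

lemma L2_mult_integrable:
  assumes "u \<in> L2" "v \<in> L2"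
  shows "integrable lborel (\<lambda>x. u x * v x)"
proof (rule Bochner_Integration.integrable_bound)
  note [measurable] = L2D(1)[OF assms(1)] L2D(1)[OF assms(2)]
  show "integrable lborel (\<lambda>x. (cmod (u x))\<^sup>2 + (cmod (v x))\<^sup>2)"
    using assms by (auto simp: L2_iff)
  show "(\<lambda>x. u x * v x) \<in> borel_measurable lborel" by measurable
  have "cmod (u x) * cmod (v x) \<le> (cmod (u x))\<^sup>2 + (cmod (v x))\<^sup>2" for x
  proof -
    have "0 \<le> cmod (u x) * cmod (v x)" by simp
    then show ?thesis using sum_squares_bound[of "cmod (u x)" "cmod (v x)"] by linarith
  qed
  then show "AE x in lborel. norm (u x * v x) \<le> norm ((cmod (u x))\<^sup>2 + (cmod (v x))\<^sup>2)"
    by (simp add: norm_mult)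
qed

lemma L2_cnj: "u \<in> L2 \<Longrightarrow> (\<lambda>x. cnj (u x)) \<in> L2"
  by (auto simp: L2_iff intro!: measurable_compose[OF _ borel_measurable_continuous_onI[OF continuous_on_cnj[OF continuous_on_id]]])

lemma L2_indicator:
  assumes "u \<in> L2" "A \<in> sets borel" shows "(\<lambda>x. indicator A x *\<^sub>R u x) \<in> L2"
proof (rule L2_bound[OF _ L2D(2)[OF assms(1)]])
  show "(\<lambda>x. indicator A x *\<^sub>R u x) \<in> borel_measurable borel"
    using L2D(1)[OF assms(1)] assms(2) by measurable
qed (auto simp: indicator_def)

lemma L2_integrable_interval:
  assumes "u \<in> L2" shows "set_integrable lborel {a..b} u"
proof -
  have "(\<lambda>x. complex_of_real (indicator {a..b} x)) \<in> L2"
  proof (rule L2_bound)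
    show "integrable lborel (indicator {a..b} :: real \<Rightarrow> real)"
      by (rule integrable_real_indicator) (auto simp: emeasure_lborel_Icc_eq)
  qed (auto simp: indicator_def)
  from L2_mult_integrable[OF this assms] show ?thesis
    by (simp add: set_integrable_def scaleR_conv_of_real)
qed

lemma L2_cong_AE:
  assumes "u \<in> L2" "AE x in lborel. u x = v x" "v \<in> borel_measurable borel"
  shows "v \<in> L2" "L2sq v = L2sq u"
proof -
  note [measurable] = L2D(1)[OF assms(1)] assms(3)
  have "integrable lborel (\<lambda>x. (cmod (u x))\<^sup>2) = integrable lborel (\<lambda>x. (cmod (v x))\<^sup>2)"
    using assms(2) by (intro integrable_cong_AE) auto
  then show "v \<in> L2" using assms by (simp add: L2_iff)
  show "L2sq v = L2sq u" unfolding L2sq_def using assms(2) by (intro integral_cong_AE) auto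
qed

section \<open>The Fourier integral of integrable functions\<close>

lemma measurable_cis [measurable]: "cis \<in> borel_measurable borel"
  by (intro borel_measurable_continuous_onI continuous_intros)

lemma cis_mult_integrable:
  assumes "integrable lborel f" "h \<in> borel_measurable borel"
  shows "integrable lborel (\<lambda>x::real. cis (h x) * f x)"
proof (rule Bochner_Integration.integrable_bound[OF assms(1)])
  note [measurable] = borel_measurable_integrable[OF assms(1)] assms(2)
  show "(\<lambda>x. cis (h x) * f x) \<in> borel_measurable lborel" by measurable
qed (simp add: norm_mult)

lemma fourier_integral_diff:
  assumes "integrable lborel f" "integrable lborel g"
  shows "fourier_integral (\<lambda>x. f x - g x) \<xi> = fourier_integral f \<xi> - fourier_integral g \<xi>"
  using cis_mult_integrable[OF assms(1), of "\<lambda>x. - (\<xi> * x)"] cis_mult_integrable[OF assms(2), of "\<lambda>x. - (\<xi> * x)"]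
  by (simp add: fourier_integral_def right_diff_distrib diff_divide_distrib)

lemma fourier_integral_norm_le:
  assumes "integrable lborel f"
  shows "cmod (fourier_integral f \<xi>) \<le> (LINT x|lborel. cmod (f x)) / sqrt (2 * pi)"
proof -
  have "cmod (LINT x|lborel. cis (- (\<xi> * x)) * f x) \<le> (LINT x|lborel. cmod (cis (- (\<xi> * x)) * f x))"
    by (rule integral_norm_bound)
  then show ?thesis
    by (simp add: fourier_integral_def norm_divide norm_mult divide_right_mono)
qed

lemma fourier_integral_measurable:
  assumes "integrable lborel f"
  shows "fourier_integral f \<in> borel_measurable borel"
proof -
  have [measurable]: "f \<in> borel_measurable borel" using assms by simp
  have "(\<lambda>\<xi>. LINT x|lborel. cis (- (\<xi> * x)) * f x) \<in> borel_measurable borel"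
    by (rule lborel.borel_measurable_lebesgue_integral) measurable
  then show ?thesis unfolding fourier_integral_def[abs_def] by measurable
qed

text \<open>Fubini together with the symmetry of the kernel in x and \<xi>.\<close>

lemma fourier_multiplication_formula:
  assumes f: "integrable lborel f" and g: "integrable lborel g"
  shows "(LINT \<xi>|lborel. fourier_integral f \<xi> * g \<xi>) = (LINT x|lborel. f x * fourier_integral g x)"
proof -
  note [measurable] = borel_measurable_integrable[OF f] borel_measurable_integrable[OF g]
  have "integrable (lborel \<Otimes>\<^sub>M lborel) (\<lambda>(x, \<xi>). cis (- (\<xi> * x)) * f x * g \<xi>)"
    by (rule Bochner_Integration.integrable_bound[OF integrable_pair_mult[OF f g]]) (auto simp: norm_mult)
  from lborel_pair.Fubini_integral[OF this]
  have "(LINT \<xi>|lborel. (LINT x|lborel. cis (- (\<xi> * x)) * f x) * g \<xi>)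
      = (LINT x|lborel. f x * (LINT \<xi>|lborel. cis (- (x * \<xi>)) * g \<xi>))"
    by (simp add: mult_ac flip: integral_mult_left_zero integral_mult_right_zero)
  then show ?thesis by (simp add: fourier_integral_def)
qed

section \<open>Gaussian weights and Parseval's identity\<close>

text \<open>Normalised to the value 1 at the origin rather than to unit mass: as s decreases to 0
  the weights increase to 1.\<close>

definition gauss :: "real \<Rightarrow> real \<Rightarrow> real" where
  "gauss s x = exp (- (s * x)\<^sup>2 / 2)"

lemma gauss_std_normal: "gauss s x = sqrt (2 * pi) * std_normal_density (s * x)"
  by (simp add: gauss_def std_normal_density_def)

lemma gauss_integrable:
  assumes "s > 0" shows "integrable lborel (gauss s)"
proof -
  have "integrable lborel (\<lambda>x. std_normal_density (0 + s * x))"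
    using assms by (intro lborel_integrable_real_affine) auto
  then show ?thesis by (simp add: gauss_std_normal[abs_def])
qed

text \<open>After the substitution by s this is the characteristic function of the standard normal
  distribution at -\<xi>/s.\<close>

lemma fourier_gauss:
  assumes "s > 0"
  shows "fourier_integral (\<lambda>x. complex_of_real (gauss s x)) \<xi> = complex_of_real (gauss (1 / s) \<xi> / s)"
proof -
  have "complex_of_real (exp (- ((\<xi> / s)\<^sup>2) / 2)) = char std_normal_distribution (- (\<xi> / s))"
    by (simp add: char_std_normal_distribution)
  also have "\<dots> = (LINT x|lborel. std_normal_density x *\<^sub>R cis (- (\<xi> / s) * x))"
    unfolding char_def cis_conv_exp[symmetric] by (subst integral_density) auto
  also have "\<dots> = s *\<^sub>R (LINT x|lborel. std_normal_density (0 + s * x) *\<^sub>R cis (- (\<xi> / s) * (0 + s * x)))"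
    using assms by (subst lborel_integral_real_affine[of s _ 0]) auto
  also have "(LINT x|lborel. std_normal_density (0 + s * x) *\<^sub>R cis (- (\<xi> / s) * (0 + s * x)))
     = (LINT x|lborel. (cis (- (\<xi> * x)) * complex_of_real (gauss s x)) / complex_of_real (sqrt (2 * pi)))"
    using assms by (intro Bochner_Integration.integral_cong) (auto simp: gauss_std_normal scaleR_conv_of_real)
  also have "\<dots> = fourier_integral (\<lambda>x. complex_of_real (gauss s x)) \<xi>"
    by (simp add: fourier_integral_def)
  finally have *: "s *\<^sub>R fourier_integral (\<lambda>x. complex_of_real (gauss s x)) \<xi> = complex_of_real (exp (- ((\<xi> / s)\<^sup>2) / 2))"
    by simp
  have "fourier_integral (\<lambda>x. complex_of_real (gauss s x)) \<xi> = (1 / s) *\<^sub>R (s *\<^sub>R fourier_integral (\<lambda>x. complex_of_real (gauss s x)) \<xi>)"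
    using assms by simp
  also have "\<dots> = complex_of_real (gauss (1 / s) \<xi> / s)"
    unfolding * by (simp add: gauss_def scaleR_conv_of_real)
  finally show ?thesis .
qed



lemma cnj_fourier_integral:
  "cnj (fourier_integral f \<xi>) = fourier_integral (\<lambda>y. cnj (f (- y))) \<xi>"
proof -
  have "cnj (fourier_integral f \<xi>) = (LINT x|lborel. cis (\<xi> * x) * cnj (f x)) / complex_of_real (sqrt (2 * pi))"
    by (simp add: fourier_integral_def cis_cnj flip: Bochner_Integration.integral_cnj)
  also have "(LINT x|lborel. cis (\<xi> * x) * cnj (f x)) = (LINT x|lborel. cis (\<xi> * (0 + (-1) * x)) * cnj (f (0 + (-1) * x)))"
    by (subst lborel_integral_real_affine[of "-1" _ 0]) auto
  finally show ?thesis by (simp add: fourier_integral_def)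
qed

text \<open>The multiplication formula is applied twice: once to each factor of
  \<open>\<bar>fourier_integral f\<bar>\<^sup>2\<close>.\<close>

lemma weighted_parseval:
  assumes f: "integrable lborel f" and s: "s > 0"
  shows "complex_of_real (LINT \<xi>|lborel. gauss s \<xi> * (cmod (fourier_integral f \<xi>))\<^sup>2)
    = (LINT x|lborel. f x * (LINT z|lborel. std_normal_density z *\<^sub>R cnj (f (x - s * z))))"
proof -
  \<comment> \<open>Conjugation and reflection: the Fourier integral of \<open>f2\<close> is the
    conjugate of that of f.\<close>
  define f2 where "f2 = (\<lambda>y. cnj (f (- y)))"
  have "integrable lborel (\<lambda>y. f (0 + (-1) * y))" by (rule lborel_integrable_real_affine[OF f]) simp
  then have f2: "integrable lborel f2" unfolding f2_def by simp
  define g where "g = (\<lambda>\<xi>. complex_of_real (gauss s \<xi>) * fourier_integral f2 \<xi>)"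
  have gauss_int: "integrable lborel (\<lambda>\<xi>. complex_of_real (gauss s \<xi>))"
    using gauss_integrable[OF s] by simp
  have g: "integrable lborel g"
  proof (rule Bochner_Integration.integrable_bound)
    let ?C = "(LINT x|lborel. cmod (f2 x)) / sqrt (2 * pi)"
    show "integrable lborel (\<lambda>\<xi>. gauss s \<xi> * ?C)" using gauss_integrable[OF s] by simp
    note [measurable] = fourier_integral_measurable[OF f2] borel_measurable_integrable[OF gauss_int]
    show "g \<in> borel_measurable lborel" unfolding g_def by measurable
    show "AE \<xi> in lborel. norm (g \<xi>) \<le> norm (gauss s \<xi> * ?C)"
    proof (intro AE_I2)
      fix \<xi>
      have "norm (g \<xi>) = gauss s \<xi> * cmod (fourier_integral f2 \<xi>)"
        by (simp add: g_def norm_mult gauss_def)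
      also have "\<dots> \<le> gauss s \<xi> * ?C"
        by (intro mult_left_mono fourier_integral_norm_le f2) (simp add: gauss_def)
      also have "\<dots> \<le> norm (gauss s \<xi> * ?C)" by (simp only: real_norm_def abs_ge_self)
      finally show "norm (g \<xi>) \<le> norm (gauss s \<xi> * ?C)" .
    qed
  qed
  \<comment> \<open>The transform of the modulated Gaussian \<open>h\<close> is a Gaussian of width
    s centred at -x. The substitution y = -x + s z then turns the integral into an average against
    the standard normal density.\<close>
  have Fg: "fourier_integral g x = (LINT z|lborel. std_normal_density z *\<^sub>R cnj (f (x - s * z)))" for x
  proof -
    define h where "h = (\<lambda>\<xi>. cis (- (x * \<xi>)) * complex_of_real (gauss s \<xi>))"
    have h: "integrable lborel h" unfolding h_def by (intro cis_mult_integrable gauss_int) simp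
    have Fh: "fourier_integral h y = complex_of_real (gauss (1 / s) (x + y) / s)" for y
    proof -
      have "cis (- (y * t)) * h t = cis (- ((x + y) * t)) * complex_of_real (gauss s t)" for t
        unfolding h_def mult.assoc[symmetric] cis_mult by (simp add: algebra_simps)
      then show ?thesis using fourier_gauss[OF s, of "x + y"] by (simp add: fourier_integral_def)
    qed
    have "fourier_integral g x = (LINT \<xi>|lborel. fourier_integral f2 \<xi> * h \<xi>) / complex_of_real (sqrt (2 * pi))"
      unfolding fourier_integral_def[of g] by (simp add: g_def h_def mult_ac)
    also have "(LINT \<xi>|lborel. fourier_integral f2 \<xi> * h \<xi>) = (LINT y|lborel. f2 y * complex_of_real (gauss (1 / s) (x + y) / s))"
      by (simp add: fourier_multiplication_formula[OF f2 h] Fh)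
    also have "\<dots> = s *\<^sub>R (LINT z|lborel. f2 (- x + s * z) * complex_of_real (gauss (1 / s) (x + (- x + s * z)) / s))"
      using s by (subst lborel_integral_real_affine[of s _ "- x"]) auto
    also have "\<dots> = (LINT z|lborel. s *\<^sub>R (f2 (- x + s * z) * complex_of_real (gauss (1 / s) (x + (- x + s * z)) / s)))"
      by simp
    also have "\<dots> = (LINT z|lborel. complex_of_real (sqrt (2 * pi)) * (std_normal_density z *\<^sub>R cnj (f (x - s * z))))"
      using s by (intro Bochner_Integration.integral_cong)
        (auto simp: f2_def gauss_std_normal scaleR_conv_of_real)
    also have "\<dots> = complex_of_real (sqrt (2 * pi)) * (LINT z|lborel. std_normal_density z *\<^sub>R cnj (f (x - s * z)))"
      by (rule integral_mult_right_zero)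
    finally show ?thesis by simp
  qed
  have "complex_of_real (LINT \<xi>|lborel. gauss s \<xi> * (cmod (fourier_integral f \<xi>))\<^sup>2)
     = (LINT \<xi>|lborel. complex_of_real (gauss s \<xi> * (cmod (fourier_integral f \<xi>))\<^sup>2))"
    by (rule integral_complex_of_real[symmetric])
  also have "\<dots> = (LINT \<xi>|lborel. fourier_integral f \<xi> * g \<xi>)"
    by (intro Bochner_Integration.integral_cong)
      (simp_all add: g_def f2_def cnj_fourier_integral[symmetric] complex_norm_square mult.left_commute del: of_real_power)
  also have "\<dots> = (LINT x|lborel. f x * fourier_integral g x)"
    by (rule fourier_multiplication_formula[OF f g])
  finally show ?thesis by (simp add: Fg)
qed

lemma integrable_std_normal_density: "integrable lborel std_normal_density"
  using integrable_std_normal_moment[of 0] by simp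

lemma integral_std_normal_density: "(LINT x|lborel. std_normal_density x) = 1"
  using integral_std_normal_moment_even[of 0] by simp

text \<open>If f is not integrable, its Bochner integral is 0 and the bound follows from the
  nonnegativity of g.\<close>

lemma norm_integral_le_integral:
  fixes f :: "'a::euclidean_space \<Rightarrow> 'b::{banach, second_countable_topology}"
  assumes "integrable M g" "\<And>x. norm (f x) \<le> g x"
  shows "norm (LINT x|M. f x) \<le> (LINT x|M. g x)"
proof (cases "integrable M f")
  case True
  then show ?thesis using assms by (intro Bochner_Integration.integral_norm_bound_integral)
next
  case False
  have "0 \<le> g x" for x using assms(2)[of x] norm_ge_zero order_trans by blast
  then show ?thesis using False by (simp add: not_integrable_integral_eq)
qed

text \<open>In the weighted identity the physical side converges because Gaussian averages of a
  continuous function converge pointwise. On the Fourier side the weights increase to 1.\<close>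

lemma plancherel_continuous:
  fixes f :: "real \<Rightarrow> complex"
  assumes cont: "continuous_on UNIV f" and supp: "\<And>x. \<bar>x\<bar> > M \<Longrightarrow> f x = 0"
  shows "f \<in> L2" "integrable lborel f" "fourier_integral f \<in> L2" "L2sq (fourier_integral f) = L2sq f"
proof -
  have [measurable]: "f \<in> borel_measurable borel" using cont by (rule borel_measurable_continuous_onI)
  have eq: "indicator {-M..M} x *\<^sub>R f x = f x" for x
    using supp[of x] by (cases "\<bar>x\<bar> > M") (auto simp: indicator_def abs_if split: if_splits)
  have "set_integrable lborel {-M..M} f"
    using cont by (intro borel_integrable_atLeastAtMost') (rule continuous_on_subset, auto)
  then show f: "integrable lborel f" by (simp add: set_integrable_def eq)
  have "compact (f ` {-M..M})"
    using cont by (intro compact_continuous_image) (auto intro: continuous_on_subset)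
  then obtain B where B: "B > 0" "\<And>x. x \<in> {-M..M} \<Longrightarrow> norm (f x) \<le> B"
    using compact_imp_bounded bounded_pos by (metis (mono_tags, lifting) imageI)
  have bound: "norm (f x) \<le> B" for x
    using B(2)[of x] B(1) supp[of x] by (cases "\<bar>x\<bar> > M") (auto simp: abs_if split: if_splits)
  have sq: "(cmod (f x))\<^sup>2 \<le> B * cmod (f x)" for x
    using bound[of x] by (simp add: power2_eq_square mult_right_mono)
  show L2: "f \<in> L2"
    by (rule L2_bound[OF _ _ sq]) (use f in auto)
  let ?s = "\<lambda>n. inverse (real (Suc n))"
  \<comment> \<open>The conjugate of f smoothed at scale \<open>?s n\<close>.\<close>
  define h where "h = (\<lambda>n x. LINT z|lborel. std_normal_density z *\<^sub>R cnj (f (x - ?s n * z)))"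
  have h_lim: "(\<lambda>n. h n x) \<longlonglongrightarrow> cnj (f x)" for x
  proof -
    have "(\<lambda>n. h n x) \<longlonglongrightarrow> (LINT z|lborel. std_normal_density z *\<^sub>R cnj (f x))"
      unfolding h_def
    proof (rule integral_dominated_convergence[where w="\<lambda>z. std_normal_density z * B"])
      show "integrable lborel (\<lambda>z. std_normal_density z * B)"
        using integrable_std_normal_density by simp
      have "(\<lambda>n. f (x - ?s n * z)) \<longlonglongrightarrow> f (x - 0 * z)" for z
      proof (rule isCont_tendsto_compose[where g=f])
        show "isCont f (x - 0 * z)" using cont by (simp add: continuous_on_eq_continuous_at)
        show "(\<lambda>n. x - ?s n * z) \<longlonglongrightarrow> x - 0 * z"
          by (intro tendsto_intros LIMSEQ_inverse_real_of_nat)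
      qed
      then show "AE z in lborel. (\<lambda>n. std_normal_density z *\<^sub>R cnj (f (x - ?s n * z))) \<longlonglongrightarrow> std_normal_density z *\<^sub>R cnj (f x)"
        by (intro AE_I2 tendsto_intros) simp
      have "continuous_on UNIV (\<lambda>z. cnj (f (x - ?s n * z)))" for n
        by (intro continuous_intros continuous_on_compose2[OF cont]) auto
      then have [measurable]: "(\<lambda>z. cnj (f (x - ?s n * z))) \<in> borel_measurable borel" for n
        by (rule borel_measurable_continuous_onI)
      show "(\<lambda>z. std_normal_density z *\<^sub>R cnj (f (x - ?s n * z))) \<in> borel_measurable lborel" for n
        by measurable
      show "AE z in lborel. norm (std_normal_density z *\<^sub>R cnj (f (x - ?s n * z))) \<le> std_normal_density z * B" for n
        using bound by (intro AE_I2) (auto simp: intro!: mult_left_mono)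
    qed measurable
    also have "(LINT z|lborel. std_normal_density z *\<^sub>R cnj (f x)) = cnj (f x)"
      using integrable_std_normal_density by (simp add: integral_std_normal_density)
    finally show ?thesis .
  qed
  have h_bound: "norm (h n x) \<le> B" for n x
  proof -
    have "norm (h n x) \<le> (LINT z|lborel. std_normal_density z * B)"
      unfolding h_def
      by (rule norm_integral_le_integral)
        (use integrable_std_normal_density bound in \<open>auto intro!: mult_left_mono\<close>)
    also have "\<dots> = B" by (simp add: integral_std_normal_density)
    finally show ?thesis .
  qed
  have h_meas [measurable]: "h n \<in> borel_measurable borel" for n
  proof -
    have [measurable]: "(\<lambda>x. cnj (f x)) \<in> borel_measurable borel"
      by (intro borel_measurable_continuous_onI continuous_intros cont)
    show ?thesis unfolding h_def by (rule lborel.borel_measurable_lebesgue_integral) measurable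
  qed
  have "(\<lambda>n. LINT x|lborel. f x * h n x) \<longlonglongrightarrow> (LINT x|lborel. f x * cnj (f x))"
  proof (rule integral_dominated_convergence[where w="\<lambda>x. norm (f x) * B"])
    show "AE x in lborel. (\<lambda>n. f x * h n x) \<longlonglongrightarrow> f x * cnj (f x)"
      by (intro AE_I2 tendsto_intros h_lim)
    show "AE x in lborel. norm (f x * h n x) \<le> norm (f x) * B" for n
      using h_bound by (intro AE_I2) (auto simp: norm_mult intro!: mult_left_mono)
    have [measurable]: "(\<lambda>x. cnj (f x)) \<in> borel_measurable borel"
      by (intro borel_measurable_continuous_onI continuous_intros cont)
    show "(\<lambda>x. f x * cnj (f x)) \<in> borel_measurable lborel" by measurable
  qed (use f in auto)
  moreover have "(LINT x|lborel. f x * cnj (f x)) = complex_of_real (L2sq f)"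
    unfolding L2sq_def integral_complex_of_real[symmetric]
    by (simp add: complex_norm_square del: of_real_power)
  ultimately have lim: "(\<lambda>n. LINT \<xi>|lborel. gauss (?s n) \<xi> * (cmod (fourier_integral f \<xi>))\<^sup>2) \<longlonglongrightarrow> L2sq f"
    using weighted_parseval[OF f, of "?s _"]
    by (simp add: h_def flip: tendsto_of_real_iff[where 'a=complex] del: of_nat_Suc)
  note [measurable] = fourier_integral_measurable[OF f]
  have mono: "mono (\<lambda>n. gauss (?s n) \<xi> * (cmod (fourier_integral f \<xi>))\<^sup>2)" for \<xi>
  proof (rule monoI)
    fix m n :: nat assume "m \<le> n"
    then have "?s n \<le> ?s m" by (simp add: le_imp_inverse_le)
    then have "\<bar>?s n * \<xi>\<bar> \<le> \<bar>?s m * \<xi>\<bar>" by (simp add: abs_mult mult_right_mono)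
    then have "gauss (?s m) \<xi> \<le> gauss (?s n) \<xi>" unfolding gauss_def by (simp add: abs_le_square_iff)
    then show "gauss (?s m) \<xi> * (cmod (fourier_integral f \<xi>))\<^sup>2 \<le> gauss (?s n) \<xi> * (cmod (fourier_integral f \<xi>))\<^sup>2"
      by (rule mult_right_mono) simp
  qed
  have int: "integrable lborel (\<lambda>\<xi>. gauss (?s n) \<xi> * (cmod (fourier_integral f \<xi>))\<^sup>2)" for n
  proof (rule Bochner_Integration.integrable_bound)
    let ?C = "(LINT x|lborel. cmod (f x)) / sqrt (2 * pi)"
    show g: "integrable lborel (\<lambda>\<xi>. gauss (?s n) \<xi> * ?C\<^sup>2)" using gauss_integrable[of "?s n"] by simp
    have [measurable]: "gauss (?s n) \<in> borel_measurable borel"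
      using borel_measurable_integrable[OF gauss_integrable[of "?s n"]] by simp
    show "(\<lambda>\<xi>. gauss (?s n) \<xi> * (cmod (fourier_integral f \<xi>))\<^sup>2) \<in> borel_measurable lborel" by measurable
    show "AE \<xi> in lborel. norm (gauss (?s n) \<xi> * (cmod (fourier_integral f \<xi>))\<^sup>2) \<le> norm (gauss (?s n) \<xi> * ?C\<^sup>2)"
    proof (intro AE_I2)
      fix \<xi>
      have le: "(cmod (fourier_integral f \<xi>))\<^sup>2 \<le> ?C\<^sup>2"
        by (intro power_mono fourier_integral_norm_le f) simp
      show "norm (gauss (?s n) \<xi> * (cmod (fourier_integral f \<xi>))\<^sup>2) \<le> norm (gauss (?s n) \<xi> * ?C\<^sup>2)"
        unfolding norm_mult by (rule mult_left_mono) (simp_all only: real_norm_def abs_power2 le abs_ge_zero)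
    qed
  qed
  have lim2: "(\<lambda>n. gauss (?s n) \<xi> * (cmod (fourier_integral f \<xi>))\<^sup>2) \<longlonglongrightarrow> (cmod (fourier_integral f \<xi>))\<^sup>2" for \<xi>
  proof -
    have "(\<lambda>n. gauss (?s n) \<xi> * (cmod (fourier_integral f \<xi>))\<^sup>2) \<longlonglongrightarrow> exp (- (0 * \<xi>)\<^sup>2 / 2) * (cmod (fourier_integral f \<xi>))\<^sup>2"
      unfolding gauss_def by (intro tendsto_intros LIMSEQ_inverse_real_of_nat) simp
    then show ?thesis by simp
  qed
  \<comment> \<open>Monotone convergence yields square integrability of the transform along with the
    value of the integral.\<close>
  have "integrable lborel (\<lambda>\<xi>. (cmod (fourier_integral f \<xi>))\<^sup>2)" and "(LINT \<xi>|lborel. (cmod (fourier_integral f \<xi>))\<^sup>2) = L2sq f"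
    by (rule integral_monotone_convergence_nonneg[OF int _ _ _ lim]; use mono lim2 in \<open>auto simp: gauss_def\<close>)+
  then show "fourier_integral f \<in> L2" "L2sq (fourier_integral f) = L2sq f"
    by (auto simp: L2_iff L2sq_def)
qed

section \<open>Plancherel's theorem by approximation\<close>

lemma fourier_integral_tendsto:
  assumes f: "\<And>n. integrable lborel (f n)" and g: "integrable lborel g"
    and lim: "(\<lambda>n. LINT x|lborel. cmod (f n x - g x)) \<longlonglongrightarrow> 0"
  shows "(\<lambda>n. fourier_integral (f n) \<xi>) \<longlonglongrightarrow> fourier_integral g \<xi>"
proof -
  have "cmod (fourier_integral (f n) \<xi> - fourier_integral g \<xi>) \<le> (LINT x|lborel. cmod (f n x - g x)) / sqrt (2 * pi)" for n
    using fourier_integral_norm_le[of "\<lambda>x. f n x - g x" \<xi>] f g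
    by (simp add: fourier_integral_diff[OF f g, symmetric])
  moreover have "(\<lambda>n. (LINT x|lborel. cmod (f n x - g x)) / sqrt (2 * pi)) \<longlonglongrightarrow> 0"
    using tendsto_divide[OF lim tendsto_const, of "sqrt (2 * pi)"] by simp
  ultimately have "(\<lambda>n. fourier_integral (f n) \<xi> - fourier_integral g \<xi>) \<longlonglongrightarrow> 0"
    by - (rule Lim_null_comparison[where g="\<lambda>n. (LINT x|lborel. cmod (f n x - g x)) / sqrt (2 * pi)"]; auto)
  then show ?thesis by (simp add: LIM_zero_iff)
qed

text \<open>L^1 convergence gives pointwise convergence of the transforms, and L^2 convergence with
  the isometry \<open>D\<close> on differences makes them Cauchy in L^2. Together these identify the
  L^2 limit as the Fourier integral of g.\<close>

lemma plancherel_limit: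
  assumes f: "\<And>n. integrable lborel (f n)" "\<And>n. f n \<in> L2" and g: "integrable lborel g" "g \<in> L2"
    and L1: "(\<lambda>n. LINT x|lborel. cmod (f n x - g x)) \<longlonglongrightarrow> 0"
    and L2: "(\<lambda>n. L2sq (\<lambda>x. f n x - g x)) \<longlonglongrightarrow> 0"
    and P: "\<And>n. fourier_integral (f n) \<in> L2" "\<And>n. L2sq (fourier_integral (f n)) = L2sq (f n)"
    and D: "\<And>m n. L2sq (fourier_integral (\<lambda>x. f m x - f n x)) = L2sq (\<lambda>x. f m x - f n x)"
  shows "fourier_integral g \<in> L2" "L2sq (fourier_integral g) = L2sq g"
proof -
  let ?F = fourier_integral
  have diff: "L2sq (\<lambda>\<xi>. ?F (f m) \<xi> - ?F (f n) \<xi>) = L2sq (\<lambda>x. f m x - f n x)" for m n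
    using D[of m n] by (simp only: fourier_integral_diff[OF f(1)[of m] f(1)[of n], abs_def])
  \<comment> \<open>Fatou's lemma in n with m fixed; \<open>e\<close> absorbs the part of the Cauchy
    estimate that depends on n.\<close>
  have close: "(\<lambda>\<xi>. ?F (f m) \<xi> - ?F g \<xi>) \<in> L2 \<and> L2sq (\<lambda>\<xi>. ?F (f m) \<xi> - ?F g \<xi>) \<le> 2 * L2sq (\<lambda>x. f m x - g x) + e"
    if "e > 0" for m e
  proof -
    have le: "L2sq (\<lambda>\<xi>. ?F (f m) \<xi> - ?F (f n) \<xi>) \<le> 2 * L2sq (\<lambda>x. f m x - g x) + 2 * L2sq (\<lambda>x. f n x - g x)" for n
      using L2_add(2)[OF L2_diff[OF f(2)[of m] g(2)] L2_diff[OF g(2) f(2)[of n]], of 1]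
      by (simp add: diff L2sq_diff_commute[of g])
    have "\<forall>\<^sub>F n in sequentially. L2sq (\<lambda>x. f n x - g x) < e / 2"
      using L2 that by (intro order_tendstoD(2)[OF L2]) simp
    then have ev: "\<forall>\<^sub>F n in sequentially. L2sq (\<lambda>\<xi>. ?F (f m) \<xi> - ?F (f n) \<xi>) \<le> 2 * L2sq (\<lambda>x. f m x - g x) + e"
    proof (rule eventually_mono)
      fix n
      assume "L2sq (\<lambda>x. f n x - g x) < e / 2"
      then have "2 * L2sq (\<lambda>x. f n x - g x) \<le> e" by linarith
      then show "L2sq (\<lambda>\<xi>. ?F (f m) \<xi> - ?F (f n) \<xi>) \<le> 2 * L2sq (\<lambda>x. f m x - g x) + e"
        using le[of n] by linarith
    qed
    have lim: "AE \<xi> in lborel. (\<lambda>n. ?F (f m) \<xi> - ?F (f n) \<xi>) \<longlonglongrightarrow> ?F (f m) \<xi> - ?F g \<xi>"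
      by (intro AE_I2 tendsto_diff tendsto_const fourier_integral_tendsto f g L1)
    show ?thesis
      using L2_fatou[OF L2_diff[OF P(1)[of m] P(1)] _ lim ev] fourier_integral_measurable[OF f(1)[of m]] fourier_integral_measurable[OF g(1)]
      by simp
  qed
  have "?F g = (\<lambda>\<xi>. ?F (f 0) \<xi> - (?F (f 0) \<xi> - ?F g \<xi>))" by simp
  then show Fg: "?F g \<in> L2"
    using L2_diff[OF P(1)[of 0] conjunct1[OF close[of 1 0]]] by simp
  have "L2sq (\<lambda>\<xi>. ?F (f n) \<xi> - ?F g \<xi>) \<le> 2 * L2sq (\<lambda>x. f n x - g x)" for n
    by (rule field_le_epsilon) (use close in blast)
  moreover have "(\<lambda>n. 2 * L2sq (\<lambda>x. f n x - g x)) \<longlonglongrightarrow> 0"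
    using tendsto_mult[OF tendsto_const L2, of 2] by simp
  ultimately have "(\<lambda>n. L2sq (\<lambda>\<xi>. ?F (f n) \<xi> - ?F g \<xi>)) \<longlonglongrightarrow> 0"
    by - (rule Lim_null_comparison[where g="\<lambda>n. 2 * L2sq (\<lambda>x. f n x - g x)"]; auto simp: L2sq_nonneg)
  from L2sq_tendsto[OF P(1) Fg this] have "(\<lambda>n. L2sq (f n)) \<longlonglongrightarrow> L2sq (?F g)" by (simp add: P)
  with L2sq_tendsto[OF f(2) g(2) L2] show "L2sq (?F g) = L2sq g" by (rule LIMSEQ_unique[symmetric])
qed


lemma dominated_tendsto_L1_L2:
  fixes f :: "nat \<Rightarrow> real \<Rightarrow> complex"
  assumes [measurable]: "\<And>n. f n \<in> borel_measurable borel" "g \<in> borel_measurable borel"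
    and lim: "AE x in lborel. (\<lambda>n. f n x) \<longlonglongrightarrow> g x"
    and bound: "\<And>n x. cmod (f n x - g x) \<le> w x"
    and w: "integrable lborel w" "integrable lborel (\<lambda>x. (w x)\<^sup>2)"
  shows "(\<lambda>n. LINT x|lborel. cmod (f n x - g x)) \<longlonglongrightarrow> 0" "(\<lambda>n. L2sq (\<lambda>x. f n x - g x)) \<longlonglongrightarrow> 0"
proof -
  have lim0: "AE x in lborel. (\<lambda>n. cmod (f n x - g x)) \<longlonglongrightarrow> 0"
    using lim by eventually_elim (simp add: LIM_zero tendsto_norm_zero)
  have "(\<lambda>n. LINT x|lborel. cmod (f n x - g x)) \<longlonglongrightarrow> (LINT x::real|lborel. 0::real)"
    by (rule integral_dominated_convergence[where w=w]) (use lim0 bound w in auto)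
  then show "(\<lambda>n. LINT x|lborel. cmod (f n x - g x)) \<longlonglongrightarrow> 0" by simp
  have "(\<lambda>n. LINT x|lborel. (cmod (f n x - g x))\<^sup>2) \<longlonglongrightarrow> (LINT x::real|lborel. 0::real)"
  proof (rule integral_dominated_convergence[where w="\<lambda>x. (w x)\<^sup>2"])
    show "AE x in lborel. (\<lambda>n. (cmod (f n x - g x))\<^sup>2) \<longlonglongrightarrow> 0"
      using lim0 by eventually_elim (use tendsto_power[where n=2] in fastforce)
    show "AE x in lborel. norm ((cmod (f n x - g x))\<^sup>2) \<le> (w x)\<^sup>2" for n
      using bound by (intro AE_I2) (simp add: power_mono)
  qed (use w in auto)
  then show "(\<lambda>n. L2sq (\<lambda>x. f n x - g x)) \<longlonglongrightarrow> 0" by (simp add: L2sq_def)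
qed

text \<open>A measurable function is an almost everywhere limit of continuous ones. These are
  modified to be uniformly bounded and supported in a common interval, so that dominated convergence
  gives L^1 and L^2 convergence.\<close>

lemma plancherel_bounded:
  fixes f :: "real \<Rightarrow> complex"
  assumes meas [measurable]: "f \<in> borel_measurable borel" and supp: "\<And>x. \<bar>x\<bar> > M \<Longrightarrow> f x = 0" and bound: "\<And>x. cmod (f x) \<le> B"
  shows "f \<in> L2" "integrable lborel f" "fourier_integral f \<in> L2" "L2sq (fourier_integral f) = L2sq f"
proof -
  define C where "C = \<bar>B\<bar> + 1"
  have C: "C > 0" "cmod (f x) \<le> C" for x
    using bound[of x] by (auto simp: C_def)
  \<comment> \<open>The radial retraction onto the disc of radius C, which contains all values of
    f.\<close>
  define c where "c = (\<lambda>z. z / complex_of_real (max 1 (cmod z / C)))"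
  have c_cont: "continuous_on UNIV c" unfolding c_def using C by (intro continuous_intros) auto
  have c_bound: "cmod (c z) \<le> C" for z
    using C by (auto simp: c_def norm_divide max_def field_simps)
  have c_id: "cmod z \<le> C \<Longrightarrow> c z = z" for z using C by (auto simp: c_def max_def)
  \<comment> \<open>Equal to 1 wherever f may be nonzero, decreasing linearly to 0 over a further
    unit of length.\<close>
  define cutoff where "cutoff = (\<lambda>x. max 0 (min 1 (\<bar>M\<bar> + 1 - \<bar>x\<bar>)))"
  have cutoff_cont: "continuous_on UNIV cutoff" unfolding cutoff_def by (intro continuous_intros)
  \<comment> \<open>The factor 2 leaves room for both: f and its approximants are each at most half
    of w.\<close>
  define w where "w = (\<lambda>x. 2 * C * indicator {-(\<bar>M\<bar>+1)..\<bar>M\<bar>+1} x :: real)"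
  have int1: "integrable lborel (indicator {-(\<bar>M\<bar>+1)..\<bar>M\<bar>+1} :: real \<Rightarrow> real)"
    by (rule integrable_real_indicator) (auto simp: emeasure_lborel_Icc_eq)
  then have w1: "integrable lborel w" by (simp add: w_def)
  have "(w x)\<^sup>2 = (2 * C) * w x" for x by (simp add: w_def indicator_def power2_eq_square)
  with w1 have w: "integrable lborel w" "integrable lborel (\<lambda>x. (w x)\<^sup>2)" by simp_all
  have f_le: "cmod (f x) \<le> w x / 2" for x
    using supp[of x] C by (auto simp: w_def indicator_def)
  have f_le': "cmod (f x) \<le> w x" for x
    using f_le[of x] C(1) by (auto simp: w_def indicator_def split: if_splits)
  show fL2: "f \<in> L2"
    by (rule L2_bound[OF meas w(2)]) (simp add: power_mono f_le')
  have "norm (f x) \<le> norm (w x)" for x using f_le'[of x] by simp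
  then show fint: "integrable lborel f"
    by (intro Bochner_Integration.integrable_bound[OF w(1)]) auto
  have "f \<in> borel_measurable lebesgue" using meas by (intro measurable_completion) simp
  then have "f measurable_on UNIV" by (rule lebesgue_measurable_imp_measurable_on) simp
  then obtain N g where N: "negligible N" and g: "\<And>n. continuous_on UNIV (g n)"
    and lim: "\<And>x. x \<notin> N \<Longrightarrow> (\<lambda>n. g n x) \<longlonglongrightarrow> f x"
    unfolding measurable_on_def by auto
  have "AE x in lebesgue. x \<notin> N"
    using N by (intro AE_not_in) (simp add: negligible_iff_null_sets)
  then have AEN: "AE x in lborel. x \<notin> N" by (simp add: AE_completion_iff)
  define k where "k = (\<lambda>n x. cutoff x *\<^sub>R c (g n x))"
  have k_cont: "continuous_on UNIV (k n)" for n
    unfolding k_def by (intro continuous_intros cutoff_cont continuous_on_compose2[OF c_cont g]) auto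
  have k_supp: "k n x = 0" if "\<bar>x\<bar> > \<bar>M\<bar> + 1" for n x using that by (simp add: k_def cutoff_def)
  have k_le: "cmod (k n x) \<le> w x / 2" for n x
    using c_bound[of "g n x"] C(1) mult_mono[of "cutoff x" 1 "cmod (c (g n x))" C]
    by (auto simp: k_def w_def cutoff_def indicator_def)
  have k_lim: "(\<lambda>n. k n x) \<longlonglongrightarrow> f x" if "x \<notin> N" for x
  proof -
    have "isCont c (f x)" using c_cont by (simp add: continuous_on_eq_continuous_at)
    then have "(\<lambda>n. k n x) \<longlonglongrightarrow> cutoff x *\<^sub>R c (f x)"
      unfolding k_def by (intro tendsto_intros isCont_tendsto_compose[where g=c] lim that)
    moreover have "cutoff x *\<^sub>R c (f x) = f x"
      using supp[of x] c_id[OF C(2)[of x]] by (cases "\<bar>x\<bar> > M") (auto simp: cutoff_def)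
    ultimately show ?thesis by simp
  qed
  note pk = plancherel_continuous[OF k_cont k_supp]
  have kd: "continuous_on UNIV (\<lambda>x. k m x - k n x)" for m n by (intro continuous_intros k_cont)
  have pd: "L2sq (fourier_integral (\<lambda>x. k m x - k n x)) = L2sq (\<lambda>x. k m x - k n x)" for m n
    by (rule plancherel_continuous(4)[OF kd, of "\<bar>M\<bar> + 1"]) (simp add: k_supp)
  have AElim: "AE x in lborel. (\<lambda>n. k n x) \<longlonglongrightarrow> f x" using AEN by eventually_elim (rule k_lim)
  have diff_le: "cmod (k n x - f x) \<le> w x" for n x
    using norm_triangle_ineq4[of "k n x" "f x"] k_le[of n x] f_le[of x] by linarith
  note lims = dominated_tendsto_L1_L2[OF L2D(1)[OF pk(1)] meas AElim diff_le w]
  show "fourier_integral f \<in> L2" "L2sq (fourier_integral f) = L2sq f"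
    using plancherel_limit[OF pk(2) pk(1) fint fL2 lims pk(3) pk(4) pd] by auto
qed

text \<open>Large values are removed instead of retracted: \<open>k n\<close> is either f or 0, so
  |f| itself dominates the error.\<close>

lemma plancherel_compact_support:
  fixes f :: "real \<Rightarrow> complex"
  assumes f: "f \<in> L2" and supp: "\<And>x. \<bar>x\<bar> > M \<Longrightarrow> f x = 0"
  shows "integrable lborel f" "fourier_integral f \<in> L2" "L2sq (fourier_integral f) = L2sq f"
proof -
  note [measurable] = L2D(1)[OF f]
  have "indicator {-M..M} x *\<^sub>R f x = f x" for x
    using supp[of x] by (cases "\<bar>x\<bar> > M") (auto simp: indicator_def abs_if split: if_splits)
  then show fint: "integrable lborel f"
    using L2_integrable_interval[OF f, of "-M" M] by (simp add: set_integrable_def)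
  define k where "k = (\<lambda>(n::nat) x. if cmod (f x) \<le> real n then f x else 0)"
  have k_meas [measurable]: "k n \<in> borel_measurable borel" for n unfolding k_def by measurable
  have k_supp: "k n x = 0" if "\<bar>x\<bar> > M" for n x using supp[OF that] by (simp add: k_def)
  have k_bound: "cmod (k n x) \<le> real n" for n x by (simp add: k_def)
  note pk = plancherel_bounded[OF k_meas k_supp k_bound]
  have pd: "L2sq (fourier_integral (\<lambda>x. k m x - k n x)) = L2sq (\<lambda>x. k m x - k n x)" for m n
  proof (rule plancherel_bounded(4))
    show "cmod (k m x - k n x) \<le> real m + real n" for x
      using norm_triangle_ineq4[of "k m x" "k n x"] k_bound[of m x] k_bound[of n x] by linarith
    show "\<bar>x\<bar> > M \<Longrightarrow> k m x - k n x = 0" for x using k_supp by simp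
  qed measurable
  have AElim: "AE x in lborel. (\<lambda>n. k n x) \<longlonglongrightarrow> f x"
  proof (intro AE_I2 tendsto_eventually)
    fix x
    have "\<forall>\<^sub>F n in sequentially. cmod (f x) \<le> real n"
      using filterlim_real_sequentially by (simp add: filterlim_at_top)
    then show "\<forall>\<^sub>F n in sequentially. k n x = f x"
      by eventually_elim (simp add: k_def)
  qed
  have diff_le: "cmod (k n x - f x) \<le> cmod (f x)" for n x by (simp add: k_def)
  note lims = dominated_tendsto_L1_L2[OF k_meas L2D(1)[OF f] AElim diff_le integrable_norm[OF fint] L2D(2)[OF f]]
  show "fourier_integral f \<in> L2" "L2sq (fourier_integral f) = L2sq f"
    using plancherel_limit[OF pk(2) pk(1) fint f lims pk(3) pk(4) pd] by auto
qed

section \<open>Extension of the Fourier transform to L^2\<close>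

abbreviation trunc :: "nat \<Rightarrow> (real \<Rightarrow> complex) \<Rightarrow> real \<Rightarrow> complex" where
  "trunc n u \<equiv> (\<lambda>x. indicator {- real n..real n} x *\<^sub>R u x)"

lemma trunc_L2: "u \<in> L2 \<Longrightarrow> trunc n u \<in> L2"
  by (rule L2_indicator) auto

lemma trunc_supp: "\<bar>x\<bar> > real n \<Longrightarrow> trunc n u x = 0"
  by (auto simp: indicator_def)

lemma trunc_integrable: "u \<in> L2 \<Longrightarrow> integrable lborel (trunc n u)"
  using L2_integrable_interval[of u "- real n" "real n"] by (simp add: set_integrable_def)

lemma trunc_tendsto:
  assumes u: "u \<in> L2"
  shows "(\<lambda>n. L2sq (\<lambda>x. trunc n u x - u x)) \<longlonglongrightarrow> 0"
proof -
  have "(\<lambda>n. LINT x|lborel. (cmod (trunc n u x - u x))\<^sup>2) \<longlonglongrightarrow> (LINT x::real|lborel. 0::real)"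
  proof (rule integral_dominated_convergence[where w="\<lambda>x. (cmod (u x))\<^sup>2"])
    note [measurable] = L2D(1)[OF u]
    show "(\<lambda>x. (cmod (trunc n u x - u x))\<^sup>2) \<in> borel_measurable lborel" for n by measurable
    show "AE x in lborel. (\<lambda>n. (cmod (trunc n u x - u x))\<^sup>2) \<longlonglongrightarrow> 0"
    proof (intro AE_I2 tendsto_eventually)
      fix x
      have "\<forall>\<^sub>F n in sequentially. \<bar>x\<bar> \<le> real n"
        using filterlim_real_sequentially by (simp add: filterlim_at_top)
      then show "\<forall>\<^sub>F n in sequentially. (cmod (trunc n u x - u x))\<^sup>2 = 0"
        by eventually_elim (auto simp: indicator_def)
    qed
    show "AE x in lborel. norm ((cmod (trunc n u x - u x))\<^sup>2) \<le> (cmod (u x))\<^sup>2" for n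
      by (intro AE_I2) (auto simp: indicator_def)
  qed (use L2D[OF u] in auto)
  then show ?thesis by (simp add: L2sq_def)
qed

lemma fourier_trunc:
  assumes u: "u \<in> L2"
  shows "fourier_integral (trunc n u) \<in> L2" "L2sq (fourier_integral (trunc n u)) = L2sq (trunc n u)"
    and "L2sq (\<lambda>\<xi>. fourier_integral (trunc m u) \<xi> - fourier_integral (trunc n u) \<xi>) = L2sq (\<lambda>x. trunc m u x - trunc n u x)"
proof -
  show "fourier_integral (trunc n u) \<in> L2" "L2sq (fourier_integral (trunc n u)) = L2sq (trunc n u)"
    using plancherel_compact_support[OF trunc_L2[OF u, of n] trunc_supp[of n _ u]] by auto
  have *: "(\<lambda>\<xi>. fourier_integral (trunc m u) \<xi> - fourier_integral (trunc n u) \<xi>) = fourier_integral (\<lambda>x. trunc m u x - trunc n u x)"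
    by (rule ext) (rule fourier_integral_diff[OF trunc_integrable[OF u] trunc_integrable[OF u], symmetric])
  show "L2sq (\<lambda>\<xi>. fourier_integral (trunc m u) \<xi> - fourier_integral (trunc n u) \<xi>) = L2sq (\<lambda>x. trunc m u x - trunc n u x)"
    unfolding *
  proof (rule plancherel_compact_support(3)[of _ "max (real m) (real n)"])
    show "trunc m u x - trunc n u x = 0" if "\<bar>x\<bar> > max (real m) (real n)" for x
      using that by (auto simp: indicator_def)
  qed (intro L2_diff trunc_L2 u)
qed

text \<open>A sequence with \<open>\<parallel>h (k + 1) - h k\<parallel>\<^sup>2 \<le> 4\<^sup>-\<^sup>k\<close> converges almost everywhere, because
  \<open>\<Sum>k. 2\<^sup>k \<bar>h (k + 1) - h k\<bar>\<^sup>2\<close> has finite integral.\<close>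

lemma L2_fast_Cauchy_AE_convergent:
  assumes h: "\<And>k. h k \<in> L2" and le: "\<And>k. L2sq (\<lambda>x. h (Suc k) x - h k x) \<le> (1/4) ^ k"
  shows "AE x in lborel. convergent (\<lambda>k. h k x)"
proof -
  define d where "d = (\<lambda>k x. h (Suc k) x - h k x)"
  have d: "d k \<in> L2" for k unfolding d_def by (intro L2_diff h)
  note [measurable] = L2D(1)[OF d]
  have "(\<integral>\<^sup>+x. (\<Sum>k. ennreal (2 ^ k * (cmod (d k x))\<^sup>2)) \<partial>lborel) = (\<Sum>k. \<integral>\<^sup>+x. ennreal (2 ^ k * (cmod (d k x))\<^sup>2) \<partial>lborel)"
    by (rule nn_integral_suminf) measurable
  also have "\<dots> = (\<Sum>k. ennreal (2 ^ k * L2sq (d k)))"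
    unfolding L2sq_def using L2D(2)[OF d] by (subst nn_integral_eq_integral) auto
  also have "\<dots> \<le> (\<Sum>k. ennreal ((1/2) ^ k))"
  proof (intro suminf_le ennreal_leI)
    fix k :: nat
    have "2 ^ k * L2sq (d k) \<le> 2 ^ k * (1/4) ^ k" using le[of k] by (simp add: d_def)
    also have "\<dots> = (1/2) ^ k" by (simp flip: power_mult_distrib)
    finally show "2 ^ k * L2sq (d k) \<le> (1/2) ^ k" .
  qed auto
  also have "\<dots> = ennreal (\<Sum>k. (1/2) ^ k)"
    by (rule suminf_ennreal2) (auto intro: summable_geometric)
  also have "\<dots> < \<infinity>" by simp
  finally have fin: "(\<integral>\<^sup>+x. (\<Sum>k. ennreal (2 ^ k * (cmod (d k x))\<^sup>2)) \<partial>lborel) \<noteq> \<infinity>" by simp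
  have "AE x in lborel. (\<Sum>k. ennreal (2 ^ k * (cmod (d k x))\<^sup>2)) \<noteq> \<infinity>"
    by (rule nn_integral_PInf_AE[OF _ fin]) measurable
  then show ?thesis
  proof eventually_elim
    case (elim x)
    then have "summable (\<lambda>k. 2 ^ k * (cmod (d k x))\<^sup>2)"
      by (intro summable_suminf_not_top) auto
    then have "(\<lambda>k. 2 ^ k * (cmod (d k x))\<^sup>2) \<longlonglongrightarrow> 0" by (rule summable_LIMSEQ_zero)
    then have "\<forall>\<^sub>F k in sequentially. 2 ^ k * (cmod (d k x))\<^sup>2 < 1" by (rule order_tendstoD) simp
    \<comment> \<open>Boundedness of the weighted terms makes the increments geometrically small, so
      the telescoping series converges absolutely.\<close>
    then have "\<forall>\<^sub>F k in sequentially. norm (d k x) \<le> sqrt (1/2) ^ k"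
    proof eventually_elim
      case (elim k)
      have "(cmod (d k x))\<^sup>2 \<le> (1/2) ^ k" using elim by (simp add: field_simps power_one_over)
      then have "(cmod (d k x))\<^sup>2 \<le> (sqrt (1/2) ^ k)\<^sup>2"
        by (simp flip: power_mult add: mult.commute[of k 2]) (simp add: power_mult)
      then show ?case by (rule power2_le_imp_le) simp
    qed
    moreover have "summable (\<lambda>k. sqrt (1/2) ^ k)"
      by (rule summable_geometric) (simp add: real_sqrt_divide)
    ultimately have "summable (\<lambda>k. d k x)"
      by (rule summable_comparison_test_ev)
    then have "convergent (\<lambda>n. \<Sum>k<n. d k x)" by (simp add: summable_iff_convergent)
    then have "convergent (\<lambda>n. h n x - h 0 x)"
      using sum_lessThan_telescope[of "\<lambda>k. h k x"] by (simp add: d_def)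
    then have "convergent (\<lambda>n. (h n x - h 0 x) + h 0 x)" by (intro convergent_add convergent_const)
    then show ?case by simp
  qed
qed

text \<open>Completeness of L^2 for this particular Cauchy sequence: the limit is built pointwise
  along a fast subsequence, and Fatou's lemma then controls the distance from every term.\<close>

lemma L2_fourier_limit_exists:
  assumes u: "u \<in> L2"
  obtains g where "g \<in> L2" "(\<lambda>n. L2sq (\<lambda>\<xi>. g \<xi> - fourier_integral (trunc n u) \<xi>)) \<longlonglongrightarrow> 0"
proof -
  define T where "T = (\<lambda>n. fourier_integral (trunc n u))"
  have T: "T n \<in> L2" for n unfolding T_def by (rule fourier_trunc(1)[OF u])
  have "\<exists>N. \<forall>m\<ge>N. \<forall>n\<ge>N. L2sq (\<lambda>\<xi>. T m \<xi> - T n \<xi>) \<le> (1/4) ^ k" for k :: nat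
  proof -
    have "\<forall>\<^sub>F n in sequentially. L2sq (\<lambda>x. trunc n u x - u x) < (1/4) ^ k / 4"
      using trunc_tendsto[OF u] by (rule order_tendstoD) simp
    then obtain N where N: "\<And>n. n \<ge> N \<Longrightarrow> L2sq (\<lambda>x. trunc n u x - u x) < (1/4) ^ k / 4"
      by (auto simp: eventually_sequentially)
    have "L2sq (\<lambda>\<xi>. T m \<xi> - T n \<xi>) \<le> (1/4) ^ k" if "m \<ge> N" "n \<ge> N" for m n
    proof -
      have "L2sq (\<lambda>\<xi>. T m \<xi> - T n \<xi>) = L2sq (\<lambda>x. (trunc m u x - u x) + (u x - trunc n u x))"
        unfolding T_def fourier_trunc(3)[OF u] by simp
      also have "\<dots> \<le> 2 * L2sq (\<lambda>x. trunc m u x - u x) + 2 * L2sq (\<lambda>x. u x - trunc n u x)"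
        using L2_add(2)[OF L2_diff[OF trunc_L2[OF u] u] L2_diff[OF u trunc_L2[OF u]], of 1 m n] by simp
      also have "\<dots> \<le> (1/4) ^ k"
        using N[OF that(1)] N[OF that(2)] L2sq_diff_commute[of u "trunc n u"] by simp
      finally show ?thesis .
    qed
    then show ?thesis by blast
  qed
  then obtain N where N: "\<And>k m n. m \<ge> N k \<Longrightarrow> n \<ge> N k \<Longrightarrow> L2sq (\<lambda>\<xi>. T m \<xi> - T n \<xi>) \<le> (1/4) ^ k"
    by metis
  \<comment> \<open>Partial sums form a monotone sequence above \<open>N\<close>, so two consecutive
    indices \<open>K k\<close> and \<open>K (Suc k)\<close> are both at least
    \<open>N k\<close>.\<close>
  define K where "K = (\<lambda>k. \<Sum>i\<le>k. N i)"
  have K_mono: "K j \<le> K k" if "j \<le> k" for j k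
    unfolding K_def using that by (intro sum_mono2) auto
  have K: "N k \<le> K k" for k by (simp add: K_def member_le_sum)
  have conv: "AE \<xi> in lborel. convergent (\<lambda>k. T (K k) \<xi>)"
    using L2_fast_Cauchy_AE_convergent[of "\<lambda>k. T (K k)"] T N K K_mono le_trans
    by (metis le_SucI order_refl)
  define g where "g = (\<lambda>\<xi>. lim (\<lambda>k. T (K k) \<xi>))"
  note [measurable] = L2D(1)[OF T]
  have gm [measurable]: "g \<in> borel_measurable borel" unfolding g_def by measurable
  have close: "(\<lambda>\<xi>. g \<xi> - T n \<xi>) \<in> L2 \<and> L2sq (\<lambda>\<xi>. g \<xi> - T n \<xi>) \<le> (1/4) ^ k" if "n \<ge> N k" for n k
  proof -
    have lim: "AE \<xi> in lborel. (\<lambda>j. T (K j) \<xi> - T n \<xi>) \<longlonglongrightarrow> g \<xi> - T n \<xi>"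
      using conv by eventually_elim (auto simp: g_def convergent_LIMSEQ_iff intro!: tendsto_diff)
    have le: "\<forall>\<^sub>F j in sequentially. L2sq (\<lambda>\<xi>. T (K j) \<xi> - T n \<xi>) \<le> (1/4) ^ k"
      unfolding eventually_sequentially
      using N[OF _ that] K[of k] K_mono[of k] le_trans by blast
    show ?thesis
      using L2_fatou[OF L2_diff[OF T T] _ lim le] by simp
  qed
  have "g = (\<lambda>\<xi>. (g \<xi> - T (N 0) \<xi>) + T (N 0) \<xi>)" by simp
  then have g: "g \<in> L2"
    using L2_add(1)[OF conjunct1[OF close[of 0 "N 0"]] T[of "N 0"]] by simp
  have "(\<lambda>n. L2sq (\<lambda>\<xi>. g \<xi> - T n \<xi>)) \<longlonglongrightarrow> 0"
  proof (rule LIMSEQ_I)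
    fix r :: real assume "r > 0"
    then obtain k :: nat where k: "(1/4) ^ k < r" using real_arch_pow_inv[of r "1/4"] by auto
    have "norm (L2sq (\<lambda>\<xi>. g \<xi> - T n \<xi>) - 0) < r" if "n \<ge> N k" for n
      using close[OF that] k L2sq_nonneg[of "\<lambda>\<xi>. g \<xi> - T n \<xi>"] by simp
    then show "\<exists>no. \<forall>n\<ge>no. norm (L2sq (\<lambda>\<xi>. g \<xi> - T n \<xi>) - 0) < r" by blast
  qed
  then show thesis using that[OF g] by (simp add: T_def)
qed

text \<open>Valid for any limit of the truncated transforms, hence for whichever one the choice
  operator selects.\<close>

lemma L2_fourier_limit_isometry:
  assumes u: "u \<in> L2" and g: "g \<in> L2"
    and lim: "(\<lambda>n. L2sq (\<lambda>\<xi>. g \<xi> - fourier_integral (trunc n u) \<xi>)) \<longlonglongrightarrow> 0"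
  shows "L2sq g = L2sq u"
proof (rule LIMSEQ_unique)
  show "(\<lambda>n. L2sq (fourier_integral (trunc n u))) \<longlonglongrightarrow> L2sq g"
    using lim by (intro L2sq_tendsto fourier_trunc u g) (simp add: L2sq_diff_commute[of g])
  show "(\<lambda>n. L2sq (fourier_integral (trunc n u))) \<longlonglongrightarrow> L2sq u"
    unfolding fourier_trunc(2)[OF u] by (intro L2sq_tendsto trunc_L2 u trunc_tendsto)
qed

lemma fourier_L2_limit:
  assumes u: "u \<in> L2"
  shows "fourier_L2 u \<in> L2"
    and "(\<lambda>n. L2sq (\<lambda>\<xi>. fourier_L2 u \<xi> - fourier_integral (trunc n u) \<xi>)) \<longlonglongrightarrow> 0"
proof -
  obtain g where "g \<in> L2" and g: "(\<lambda>n. L2sq (\<lambda>\<xi>. g \<xi> - fourier_integral (trunc n u) \<xi>)) \<longlonglongrightarrow> 0"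
    using L2_fourier_limit_exists[OF u] by blast
  have "\<exists>g. g \<in> L2 \<and> (\<lambda>n::nat. Lp_norm 2 (\<lambda>\<xi>. g \<xi> - fourier_integral (trunc n u) \<xi>)) \<longlonglongrightarrow> 0"
    using \<open>g \<in> L2\<close> tendsto_real_sqrt[OF g] by (auto simp: Lp_norm_2)
  from someI_ex[OF this] have *: "fourier_L2 u \<in> L2"
    "(\<lambda>n. Lp_norm 2 (\<lambda>\<xi>. fourier_L2 u \<xi> - fourier_integral (trunc n u) \<xi>)) \<longlonglongrightarrow> 0"
    unfolding fourier_L2_def by auto
  show "fourier_L2 u \<in> L2" by fact
  show "(\<lambda>n. L2sq (\<lambda>\<xi>. fourier_L2 u \<xi> - fourier_integral (trunc n u) \<xi>)) \<longlonglongrightarrow> 0"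
    using tendsto_power[OF *(2), of 2] by (simp add: Lp_norm_2 L2sq_nonneg)
qed

subsection \<open>Regularity in $H^2$ and the quadratic form\<close>

lemma weak_deriv_unique:
  assumes "has_L2_weak_deriv k u g" "has_L2_weak_deriv k u h"
  shows "AE x in lborel. g x = h x"
proof -
  have g: "g \<in> L2" and h: "h \<in> L2" using assms by (auto simp: has_L2_weak_deriv_def)
  have "AE x in lborel. g x - h x = 0"
  proof (rule fundamental_lemma)
    show "(\<lambda>x. g x - h x) \<in> borel_measurable borel" by (rule L2D(1)[OF L2_diff[OF g h]])
    show "set_integrable lborel {a..b} (\<lambda>x. g x - h x)" for a b
      by (rule L2_integrable_interval[OF L2_diff[OF g h]])
    fix \<phi> assume \<phi>: "test_function \<phi>"
    then have "(- 1) ^ k * (LINT x|lborel. \<phi> x *\<^sub>R g x) = (- 1) ^ k * (LINT x|lborel. \<phi> x *\<^sub>R h x)"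
      using assms unfolding has_L2_weak_deriv_def by metis
    then have "(LINT x|lborel. \<phi> x *\<^sub>R g x) = (LINT x|lborel. \<phi> x *\<^sub>R h x)" by simp
    then show "(LINT x|lborel. \<phi> x *\<^sub>R (g x - h x)) = 0"
      using test_function_integrable[OF \<phi> L2_integrable_interval[OF g]]
        test_function_integrable[OF \<phi> L2_integrable_interval[OF h]]
      by (simp add: scaleR_diff_right)
  qed
  then show ?thesis by simp
qed

text \<open>The norms in \<open>action\<close> thus do not depend on the representative chosen for
  the weak derivative.\<close>

lemma L2sq_weak_deriv:
  assumes "has_L2_weak_deriv k u g"
  shows "L2sq (weak_deriv k u) = L2sq g"
proof -
  have w: "has_L2_weak_deriv k u (weak_deriv k u)"
    unfolding weak_deriv_def using assms by (rule someI[of "has_L2_weak_deriv k u"])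
  then have "weak_deriv k u \<in> borel_measurable borel" by (simp add: has_L2_weak_deriv_def L2_iff)
  moreover have "g \<in> L2" using assms by (simp add: has_L2_weak_deriv_def)
  ultimately show ?thesis using L2_cong_AE(2)[OF _ weak_deriv_unique[OF assms w]] by simp
qed

lemma has_L2_weak_deriv_scale:
  assumes "has_L2_weak_deriv k u g"
  shows "has_L2_weak_deriv k (\<lambda>x. c * u x) (\<lambda>x. c * g x)"
  using assms unfolding has_L2_weak_deriv_def
  by (auto simp: L2_scale mult_scaleR_right[symmetric] simp del: mult_scaleR_right)

lemma has_L2_weak_deriv_primitive:
  assumes "primitive U V" "U \<in> L2" "V \<in> L2"
  shows "has_L2_weak_deriv 1 U V"
  using assms test_function_integrate_by_parts by (auto simp: has_L2_weak_deriv_def)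

lemma has_L2_weak_deriv_primitive2:
  assumes "primitive U V" "primitive V g" "U \<in> L2" "V \<in> L2" "g \<in> L2"
  shows "has_L2_weak_deriv 2 U g"
  using assms test_function_integrate_by_parts[OF test_function_deriv assms(1)]
    test_function_integrate_by_parts[OF _ assms(2)]
  by (auto simp: has_L2_weak_deriv_def numeral_2_eq_2)

text \<open>Du Bois-Reymond is used twice: for the first weak derivative, whose continuous version
  is V, and for u itself, whose version U then has V as derivative.\<close>

lemma H2_regular_representative:
  assumes "u \<in> H2"
  obtains U V g where "AE x in lborel. u x = U x" "primitive U V" "primitive V g"
    "u \<in> L2" "U \<in> L2" "V \<in> L2" "g \<in> L2" "has_L2_weak_deriv 1 u V" "has_L2_weak_deriv 2 u g"
proof -
  have "\<exists>g. has_L2_weak_deriv k u g" if "k \<le> 2" for k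
    using assms that by (simp add: H2_def)
  from this[of 1] this[of 2]
  obtain g1 g2 where g1: "has_L2_weak_deriv 1 u g1" and g2: "has_L2_weak_deriv 2 u g2"
    by auto
  have L2: "u \<in> L2" "g1 \<in> L2" "g2 \<in> L2" using g1 g2 by (auto simp: has_L2_weak_deriv_def)
  have w1: "(LINT x|lborel. deriv \<phi> x *\<^sub>R u x) = - (LINT x|lborel. \<phi> x *\<^sub>R g1 x)" if "test_function \<phi>" for \<phi>
    using g1 that by (simp add: has_L2_weak_deriv_def)
  \<comment> \<open>The first-order identity is tested with \<phi>', which makes the second weak
    derivative of u the weak derivative of g1.\<close>
  have w2: "(LINT x|lborel. deriv \<phi> x *\<^sub>R g1 x) = - (LINT x|lborel. \<phi> x *\<^sub>R g2 x)" if "test_function \<phi>" for \<phi>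
    using w1[OF test_function_deriv[OF that]] g2 that by (simp add: has_L2_weak_deriv_def numeral_2_eq_2)
  obtain V where V: "primitive V g2" "AE x in lborel. g1 x = V x"
    by (rule du_Bois_Reymond[OF L2D(1)[OF L2(2)] L2_integrable_interval[OF L2(2)] L2D(1)[OF L2(3)] L2_integrable_interval[OF L2(3)] w2])
  obtain U where U: "primitive U g1" "AE x in lborel. u x = U x"
    by (rule du_Bois_Reymond[OF L2D(1)[OF L2(1)] L2_integrable_interval[OF L2(1)] L2D(1)[OF L2(2)] L2_integrable_interval[OF L2(2)] w1])
  have UV: "primitive U V" by (rule primitive_cong_AE[OF U(1) V(2) primitive_measurable[OF V(1)]])
  have UL: "U \<in> L2" by (rule L2_cong_AE[OF L2(1) U(2) primitive_measurable[OF U(1)]])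
  have VL: "V \<in> L2" by (rule L2_cong_AE[OF L2(2) V(2) primitive_measurable[OF V(1)]])
  have "has_L2_weak_deriv 1 U V" by (rule has_L2_weak_deriv_primitive[OF UV UL VL])
  moreover have "(LINT x|lborel. deriv \<phi> x *\<^sub>R U x) = (LINT x|lborel. deriv \<phi> x *\<^sub>R u x)" if "test_function \<phi>" for \<phi>
  proof (rule integral_cong_AE)
    note [measurable] = L2D(1)[OF L2(1)] L2D(1)[OF UL] test_function_measurable[OF test_function_deriv[OF that]]
    show "(\<lambda>x. deriv \<phi> x *\<^sub>R U x) \<in> borel_measurable lborel" "(\<lambda>x. deriv \<phi> x *\<^sub>R u x) \<in> borel_measurable lborel"
      by measurable
  qed (use U(2) in auto)
  ultimately have "has_L2_weak_deriv 1 u V" using L2 by (simp add: has_L2_weak_deriv_def)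
  with g2 U V UV UL VL L2 show thesis by (intro that)
qed

section \<open>Decay, integration by parts and the sup bound\<close>

text \<open>U need not be integrable, but |U|^2 is, and its derivative is a sum of products of L^2
  functions; decay is therefore proved for |U|^2.\<close>

lemma L2_primitive_tendsto_0:
  assumes "primitive U V" "U \<in> L2" "V \<in> L2" "filterlim (\<lambda>n. \<bar>X n\<bar>) at_top sequentially"
  shows "(\<lambda>n. U (X n)) \<longlonglongrightarrow> 0"
proof -
  have "(\<lambda>n. U (X n) * cnj (U (X n))) \<longlonglongrightarrow> 0"
  proof (rule primitive_tendsto_0[OF primitive_mult[OF assms(1) primitive_cnj[OF assms(1)]] _ _ assms(4)])
    show "integrable lborel (\<lambda>x. U x * cnj (U x))"
      by (intro L2_mult_integrable L2_cnj assms)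
    show "integrable lborel (\<lambda>x. V x * cnj (U x) + U x * cnj (V x))"
      by (intro Bochner_Integration.integrable_add L2_mult_integrable L2_cnj assms)
  qed
  then have "(\<lambda>n. norm (U (X n) * cnj (U (X n)))) \<longlonglongrightarrow> 0" by (rule tendsto_norm_zero)
  then have "(\<lambda>n. sqrt ((norm (U (X n)))\<^sup>2)) \<longlonglongrightarrow> sqrt 0"
    by (intro tendsto_real_sqrt) (simp add: norm_mult power2_eq_square)
  then show ?thesis by (simp add: tendsto_norm_zero_iff)
qed

lemma complex_L2sq: "complex_of_real (L2sq u) = (LINT x|lborel. u x * cnj (u x))"
  unfolding L2sq_def integral_complex_of_real[symmetric]
  by (simp add: complex_norm_square del: of_real_power)

text \<open>Integration by parts: \<open>\<integral> U'' \<cdot> cnj U = - \<integral> \<bar>U'\<bar>\<^sup>2\<close>.\<close>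

lemma L2sq_add_second_deriv:
  assumes P: "primitive U V" "primitive V g" and L: "U \<in> L2" "V \<in> L2" "g \<in> L2"
  shows "L2sq (\<lambda>x. U x + g x) = L2sq g - 2 * L2sq V + L2sq U"
proof -
  have gU: "integrable lborel (\<lambda>x. g x * cnj (U x))" and VV: "integrable lborel (\<lambda>x. V x * cnj (V x))"
    and UU: "integrable lborel (\<lambda>x. U x * cnj (U x))" and gg: "integrable lborel (\<lambda>x. g x * cnj (g x))"
    by (intro L2_mult_integrable L2_cnj L)+
  have Ug: "integrable lborel (\<lambda>x. U x * cnj (g x))" by (intro L2_mult_integrable L2_cnj L)
  define I where "I = (LINT x|lborel. g x * cnj (U x))"
  have I': "(LINT x|lborel. U x * cnj (g x)) = cnj I"
    unfolding I_def Bochner_Integration.integral_cnj[symmetric] by (simp add: mult.commute)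
  have "(LINT x|lborel. g x * cnj (U x) + V x * cnj (V x)) = 0"
  proof (rule primitive_integral_eq_0[OF primitive_mult[OF P(2) primitive_cnj[OF P(1)]]])
    show "integrable lborel (\<lambda>x. V x * cnj (U x))" by (intro L2_mult_integrable L2_cnj L)
    show "integrable lborel (\<lambda>x. g x * cnj (U x) + V x * cnj (V x))"
      using gU VV by (rule Bochner_Integration.integrable_add)
  qed
  then have I: "I = - complex_of_real (L2sq V)"
    using gU VV by (simp add: I_def complex_L2sq eq_neg_iff_add_eq_0)
  have "complex_of_real (L2sq (\<lambda>x. U x + g x)) = (LINT x|lborel. (U x * cnj (U x) + g x * cnj (g x)) + (g x * cnj (U x) + U x * cnj (g x)))"
    unfolding complex_L2sq by (simp add: algebra_simps)
  also have "\<dots> = (LINT x|lborel. U x * cnj (U x)) + (LINT x|lborel. g x * cnj (g x))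
      + ((LINT x|lborel. g x * cnj (U x)) + (LINT x|lborel. U x * cnj (g x)))"
    using gU Ug UU gg by simp
  also have "\<dots> = (LINT x|lborel. U x * cnj (U x)) + (LINT x|lborel. g x * cnj (g x)) + (I + cnj I)"
    by (simp only: I' I_def[symmetric])
  also have "\<dots> = complex_of_real (L2sq g - 2 * L2sq V + L2sq U)"
    by (simp add: complex_L2sq[symmetric] I)
  finally show ?thesis by (simp only: of_real_eq_iff)
qed

text \<open>With \<open>f = U + U''\<close> the energy \<open>\<bar>U'\<bar>\<^sup>2 + \<bar>U\<bar>\<^sup>2\<close> has derivative \<open>2 Re (f \<cdot> cnj U')\<close>.\<close>

lemma sup_bound_energy:
  assumes P: "primitive U V" "primitive V g" and L: "U \<in> L2" "V \<in> L2" "g \<in> L2" and s: "s > 0"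
  shows "(cmod (U x))\<^sup>2 \<le> s * L2sq (\<lambda>x. U x + g x) + L2sq V / s"
proof -
  define f where "f = (\<lambda>x. U x + g x)"
  have f: "f \<in> L2" unfolding f_def by (intro L2_add L)
  define E where "E = (\<lambda>x. V x * cnj (V x) + U x * cnj (U x))"
  define E' where "E' = (\<lambda>x. (g x * cnj (V x) + V x * cnj (g x)) + (V x * cnj (U x) + U x * cnj (V x)))"
  have PE: "primitive E E'"
    unfolding E_def E'_def by (intro primitive_add primitive_mult primitive_cnj P)
  have intE: "integrable lborel E" "integrable lborel E'"
    unfolding E_def E'_def by (intro Bochner_Integration.integrable_add L2_mult_integrable L2_cnj L)+
  have E'_le: "cmod (E' x) \<le> s * (cmod (f x))\<^sup>2 + (cmod (V x))\<^sup>2 / s" for x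
  proof -
    \<comment> \<open>The terms contributed by |U|^2 complete U'' to f; this is the conservation law
      of the free oscillator.\<close>
    have "E' x = f x * cnj (V x) + V x * cnj (f x)" by (simp add: E'_def f_def algebra_simps)
    also have "cmod \<dots> \<le> 2 * (cmod (f x) * cmod (V x))"
      using norm_triangle_ineq[of "f x * cnj (V x)" "V x * cnj (f x)"]
      by (simp add: norm_mult mult.commute[of "cmod (V x)" "cmod (f x)"])
    also have "\<dots> \<le> s * (cmod (f x))\<^sup>2 + (cmod (V x))\<^sup>2 / s"
    proof -
      have "0 \<le> (s * cmod (f x) - cmod (V x))\<^sup>2 / s" using s by simp
      also have "\<dots> = s * (cmod (f x))\<^sup>2 + (cmod (V x))\<^sup>2 / s - 2 * (cmod (f x) * cmod (V x))"
        using s by (simp add: field_simps power2_eq_square)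
      finally show ?thesis by simp
    qed
    finally show ?thesis .
  qed
  have "(cmod (U x))\<^sup>2 \<le> cmod (E x)"
  proof -
    have "E x = complex_of_real ((cmod (V x))\<^sup>2 + (cmod (U x))\<^sup>2)"
      by (simp add: E_def complex_norm_square del: of_real_power)
    then show ?thesis by (simp only: norm_of_real) simp
  qed
  also have "\<dots> \<le> (LINT y|lborel. cmod (E' y))"
    by (rule primitive_le_integral_norm_deriv[OF PE intE])
  also have "\<dots> \<le> (LINT y|lborel. s * (cmod (f y))\<^sup>2 + (cmod (V y))\<^sup>2 / s)"
    using E'_le intE L2D(2)[OF f] L2D(2)[OF L(2)] by (intro integral_mono) auto
  also have "\<dots> = s * L2sq f + L2sq V / s"
    unfolding L2sq_def using L2D(2)[OF f] L2D(2)[OF L(2)] by simp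
  finally show ?thesis by (simp add: f_def)
qed

text \<open>The weight s = 1 / sqrt \<epsilon> gives U' the coefficient \<epsilon> relative to f,
  the same as that of U in the numerator.\<close>

lemma sup_bound:
  assumes P: "primitive U V" "primitive V g" and L: "U \<in> L2" "V \<in> L2" "g \<in> L2" and \<epsilon>: "0 < \<epsilon>" "\<epsilon> < 1"
  shows "(cmod (U x))\<^sup>2 \<le> 2 * (L2sq (\<lambda>x. U x + g x) + \<epsilon> * L2sq U) / sqrt \<epsilon>"
proof -
  define f where "f = (\<lambda>x. U x + g x)"
  have f: "f \<in> L2" unfolding f_def by (intro L2_add L)
  \<comment> \<open>From g = f - U; inserted into |f|^2 = |g|^2 - 2 |V|^2 + |U|^2 it controls V by f
    and U with constants independent of \<epsilon>.\<close>
  have "L2sq g \<le> 2 * L2sq f + 2 * L2sq U"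
    using L2_add(2)[OF f L2_scale[OF L(1), of "-1"], of 1] L2sq_scale[of "-1" U] by (simp add: f_def)
  then have V: "L2sq V \<le> (L2sq f + 3 * L2sq U) / 2"
    using L2sq_add_second_deriv[OF P L] by (simp add: f_def)
  have "(cmod (U x))\<^sup>2 \<le> (1 / sqrt \<epsilon>) * L2sq f + L2sq V / (1 / sqrt \<epsilon>)"
    unfolding f_def using \<epsilon> by (intro sup_bound_energy[OF P L]) simp
  also have "\<dots> = (L2sq f + \<epsilon> * L2sq V) / sqrt \<epsilon>"
    using \<epsilon> by (simp add: field_simps)
  also have "\<dots> \<le> 2 * (L2sq f + \<epsilon> * L2sq U) / sqrt \<epsilon>"
  proof (rule divide_right_mono)
    have "\<epsilon> * L2sq V \<le> \<epsilon> * ((L2sq f + 3 * L2sq U) / 2)" using V \<epsilon> by (intro mult_left_mono) auto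
    moreover have "\<epsilon> * L2sq f \<le> L2sq f" using \<epsilon> L2sq_nonneg[of f] by (simp add: mult_left_le_one_le)
    moreover have "0 \<le> \<epsilon> * L2sq U" using \<epsilon> L2sq_nonneg[of U] by simp
    ultimately show "L2sq f + \<epsilon> * L2sq V \<le> 2 * (L2sq f + \<epsilon> * L2sq U)"
      using L2sq_nonneg[of f] by (simp add: algebra_simps)
  qed (use \<epsilon> in simp)
  finally show ?thesis by (simp add: f_def)
qed

section \<open>The Fourier multiplier of U + U''\<close>

lemma L2_AE_subseq:
  assumes "\<And>n. h n \<in> L2" "g \<in> L2" "(\<lambda>n. L2sq (\<lambda>\<xi>. g \<xi> - h n \<xi>)) \<longlonglongrightarrow> 0"
  obtains r :: "nat \<Rightarrow> nat" where "strict_mono r" "AE \<xi> in lborel. (\<lambda>n. h (r n) \<xi>) \<longlonglongrightarrow> g \<xi>"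
proof -
  have "\<exists>r::nat\<Rightarrow>nat. strict_mono r \<and> (AE \<xi> in lborel. (\<lambda>n. (cmod (g \<xi> - h (r n) \<xi>))\<^sup>2) \<longlonglongrightarrow> 0)"
  proof (rule tendsto_L1_AE_subseq)
    show "integrable lborel (\<lambda>\<xi>. (cmod (g \<xi> - h n \<xi>))\<^sup>2)" for n
      by (rule L2D(2)[OF L2_diff[OF assms(2,1)]])
    show "(\<lambda>n. LINT \<xi>|lborel. norm ((cmod (g \<xi> - h n \<xi>))\<^sup>2)) \<longlonglongrightarrow> 0"
      using assms(3) by (simp add: L2sq_def)
  qed
  then obtain r :: "nat \<Rightarrow> nat" where r: "strict_mono r" "AE \<xi> in lborel. (\<lambda>n. (cmod (g \<xi> - h (r n) \<xi>))\<^sup>2) \<longlonglongrightarrow> 0"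
    by blast
  have "AE \<xi> in lborel. (\<lambda>n. h (r n) \<xi>) \<longlonglongrightarrow> g \<xi>"
    using r(2)
  proof eventually_elim
    case (elim \<xi>)
    then have "(\<lambda>n. norm (g \<xi> - h (r n) \<xi>)) \<longlonglongrightarrow> 0"
      using tendsto_real_sqrt[OF elim] by simp
    then have "(\<lambda>n. g \<xi> - h (r n) \<xi>) \<longlonglongrightarrow> 0" by (simp only: tendsto_norm_zero_iff)
    from tendsto_diff[OF tendsto_const[of "g \<xi>"] this] show ?case by simp
  qed
  with r(1) show thesis by (rule that)
qed

lemma fourier_integral_cong_AE:
  assumes "AE x in lborel. u x = v x" "u \<in> borel_measurable borel" "v \<in> borel_measurable borel"
  shows "fourier_integral u \<xi> = fourier_integral v \<xi>"
proof -
  note [measurable] = assms(2,3)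
  have "(LINT x|lborel. cis (- (\<xi> * x)) * u x) = (LINT x|lborel. cis (- (\<xi> * x)) * v x)"
    using assms(1) by (intro integral_cong_AE) auto
  then show ?thesis by (simp add: fourier_integral_def)
qed

lemma cis_primitive: "primitive (\<lambda>x. cis (- (\<xi> * x))) (\<lambda>x. - \<i> * complex_of_real \<xi> * cis (- (\<xi> * x)))"
proof (rule primitive_C1)
  show "((\<lambda>x. cis (- (\<xi> * x))) has_vector_derivative - \<i> * complex_of_real \<xi> * cis (- (\<xi> * x))) (at x)" for x
    unfolding has_vector_derivative_def
    by (auto intro!: derivative_eq_intros simp: scaleR_conv_of_real algebra_simps)
qed (intro continuous_intros)

lemma integral_cis_deriv:
  assumes UV: "primitive U V"
  shows "(LINT x:{-real n..real n}|lborel. cis (- (\<xi> * x)) * V x)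
    = (cis (- (\<xi> * real n)) * U (real n) - cis (\<xi> * real n) * U (- real n))
      + \<i> * complex_of_real \<xi> * (LINT x:{-real n..real n}|lborel. cis (- (\<xi> * x)) * U x)"
proof -
  let ?e = "\<lambda>x. cis (- (\<xi> * x))"
  have em: "?e \<in> borel_measurable borel" by measurable
  have iU: "set_integrable lborel {-real n..real n} (\<lambda>x. ?e x * U x)"
    by (intro borel_integrable_atLeastAtMost' continuous_intros primitive_continuous[OF UV])
  have "set_integrable lborel {-real n..real n} (\<lambda>x. V x * ?e x)"
    by (intro set_integrable_mult_continuous primitiveD(2)[OF UV] continuous_intros em) simp
  then have iV: "set_integrable lborel {-real n..real n} (\<lambda>x. ?e x * V x)" by (simp add: mult.commute)
  have "(LINT x:{-real n..real n}|lborel. (- \<i> * complex_of_real \<xi>) * (?e x * U x) + ?e x * V x)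
      = ?e (real n) * U (real n) - ?e (- real n) * U (- real n)"
    using primitiveD(3)[OF primitive_mult[OF cis_primitive UV], of "-real n" "real n" \<xi>] by (simp add: mult.assoc)
  also have "(LINT x:{-real n..real n}|lborel. (- \<i> * complex_of_real \<xi>) * (?e x * U x) + ?e x * V x)
    = (- \<i> * complex_of_real \<xi>) * (LINT x:{-real n..real n}|lborel. ?e x * U x) + (LINT x:{-real n..real n}|lborel. ?e x * V x)"
    by (subst set_integral_add(2)[OF set_integrable_mult_right[OF iU] iV]) (simp only: set_integral_mult_right)
  finally show ?thesis by (simp add: algebra_simps)
qed

lemma fourier_trunc_conv: "fourier_integral (trunc n u) \<xi> = (LINT x:{-real n..real n}|lborel. cis (- (\<xi> * x)) * u x) / complex_of_real (sqrt (2 * pi))"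
  by (simp add: fourier_integral_def set_lebesgue_integral_def)

text \<open>Two integrations by parts on [-n, n] produce the multiplier
  \<open>1 - \<xi>\<^sup>2\<close> exactly, up to the boundary terms \<open>b n\<close>; these
  vanish in the limit because U and V decay.\<close>

lemma fourier_second_deriv:
  assumes P: "primitive U V" "primitive V g" and L: "U \<in> L2" "V \<in> L2" "g \<in> L2"
  shows "(\<lambda>n. fourier_integral (trunc n (\<lambda>x. U x + g x)) \<xi> - complex_of_real (1 - \<xi>\<^sup>2) * fourier_integral (trunc n U) \<xi>) \<longlonglongrightarrow> 0"
proof -
  define b where "b = (\<lambda>n. ((cis (- (\<xi> * real n)) * V (real n) - cis (\<xi> * real n) * V (- real n))
     + \<i> * complex_of_real \<xi> * (cis (- (\<xi> * real n)) * U (real n) - cis (\<xi> * real n) * U (- real n))) / complex_of_real (sqrt (2 * pi)))"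
  have eq: "fourier_integral (trunc n (\<lambda>x. U x + g x)) \<xi> - complex_of_real (1 - \<xi>\<^sup>2) * fourier_integral (trunc n U) \<xi> = b n" for n
  proof -
    have "fourier_integral (trunc n (\<lambda>x. U x + g x)) \<xi> = fourier_integral (\<lambda>x. trunc n U x - (- 1) *\<^sub>R trunc n g x) \<xi>"
      by (simp add: scaleR_add_right)
    also have "\<dots> = fourier_integral (trunc n U) \<xi> + fourier_integral (trunc n g) \<xi>"
      using fourier_integral_diff[OF trunc_integrable[OF L(1)], of "\<lambda>x. (- 1) *\<^sub>R trunc n g x" n \<xi>] trunc_integrable[OF L(3), of n]
      by (simp add: fourier_integral_def[of "\<lambda>x. - f x" for f] fourier_integral_def[of "trunc n g"])
    finally have 1: "fourier_integral (trunc n (\<lambda>x. U x + g x)) \<xi> = fourier_integral (trunc n U) \<xi> + fourier_integral (trunc n g) \<xi>" .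
    have 2: "fourier_integral (trunc n g) \<xi> = b n - complex_of_real (\<xi>\<^sup>2) * fourier_integral (trunc n U) \<xi>"
      unfolding fourier_trunc_conv integral_cis_deriv[OF P(2)] integral_cis_deriv[OF P(1)] b_def
      by (simp add: field_simps power2_eq_square)
    show ?thesis unfolding 1 2 by (simp add: algebra_simps)
  qed
  have z: "(\<lambda>n. cis (t n) * W n) \<longlonglongrightarrow> 0" if "W \<longlonglongrightarrow> 0" for t :: "nat \<Rightarrow> real" and W
    using tendsto_norm_zero[OF that] by (intro tendsto_norm_zero_cancel[where f="\<lambda>n. cis (t n) * W n"]) (simp add: norm_mult)
  note lims = L2_primitive_tendsto_0[OF P(1) L(1,2)] L2_primitive_tendsto_0[OF P(2) L(2,3)]
  have "b \<longlonglongrightarrow> ((0 - 0) + \<i> * complex_of_real \<xi> * (0 - 0)) / complex_of_real (sqrt (2 * pi))"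
    unfolding b_def by (intro tendsto_intros z lims filterlim_abs_real_sequentially) simp
  then show ?thesis unfolding eq by simp
qed

text \<open>Both transforms are known only as L^2 limits, and the multiplier is unbounded, so the
  relation between them is proved pointwise: along a common subsequence both truncated transforms
  converge almost everywhere. Plancherel for f and for u then gives the two terms.\<close>

lemma rayleigh_numerator:
  assumes AE: "AE x in lborel. u x = U x" and P: "primitive U V" "primitive V g"
    and L: "u \<in> L2" "U \<in> L2" "V \<in> L2" "g \<in> L2"
  shows "(LINT \<xi>|lborel. ((\<xi>\<^sup>2 - 1)\<^sup>2 + \<epsilon>) * (norm (fourier_L2 u \<xi>))\<^sup>2) = L2sq (\<lambda>x. U x + g x) + \<epsilon> * L2sq u"
proof -
  define f where "f = (\<lambda>x. U x + g x)"
  have f: "f \<in> L2" unfolding f_def by (intro L2_add L)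
  let ?u = "fourier_L2 u"
  obtain fh where fh: "fh \<in> L2" "(\<lambda>n. L2sq (\<lambda>\<xi>. fh \<xi> - fourier_integral (trunc n f) \<xi>)) \<longlonglongrightarrow> 0"
    using L2_fourier_limit_exists[OF f] by blast
  note uh = fourier_L2_limit[OF L(1)]
  obtain r :: "nat \<Rightarrow> nat" where r: "strict_mono r" "AE \<xi> in lborel. (\<lambda>n. fourier_integral (trunc (r n) u) \<xi>) \<longlonglongrightarrow> ?u \<xi>"
    using L2_AE_subseq[OF fourier_trunc(1)[OF L(1)] uh] by blast
  have "(\<lambda>n. L2sq (\<lambda>\<xi>. fh \<xi> - fourier_integral (trunc (r n) f) \<xi>)) \<longlonglongrightarrow> 0"
    using LIMSEQ_subseq_LIMSEQ[OF fh(2) r(1)] by (simp add: o_def)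
  \<comment> \<open>Extracting a subsequence of \<open>r\<close> keeps the convergence already
    obtained for u.\<close>
  then obtain s :: "nat \<Rightarrow> nat" where s: "strict_mono s" "AE \<xi> in lborel. (\<lambda>n. fourier_integral (trunc (r (s n)) f) \<xi>) \<longlonglongrightarrow> fh \<xi>"
    using L2_AE_subseq[OF fourier_trunc(1)[OF f] fh(1), of r] by blast
  have uU: "fourier_integral (trunc n u) \<xi> = fourier_integral (trunc n U) \<xi>" for n \<xi>
  proof (rule fourier_integral_cong_AE)
    show "AE x in lborel. trunc n u x = trunc n U x" using AE by eventually_elim simp
  qed (rule L2D(1)[OF trunc_L2[OF L(1)]], rule L2D(1)[OF trunc_L2[OF L(2)]])
  have AEf: "AE \<xi> in lborel. fh \<xi> = complex_of_real (1 - \<xi>\<^sup>2) * ?u \<xi>"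
    using r(2) s(2)
  proof eventually_elim
    case (elim \<xi>)
    have "(\<lambda>n. fourier_integral (trunc (r (s n)) u) \<xi>) \<longlonglongrightarrow> ?u \<xi>"
      using LIMSEQ_subseq_LIMSEQ[OF elim(1) s(1)] by (simp add: o_def)
    then have 1: "(\<lambda>n. fourier_integral (trunc (r (s n)) f) \<xi> - complex_of_real (1 - \<xi>\<^sup>2) * fourier_integral (trunc (r (s n)) u) \<xi>)
       \<longlonglongrightarrow> fh \<xi> - complex_of_real (1 - \<xi>\<^sup>2) * ?u \<xi>"
      by (intro tendsto_intros elim(2))
    have 2: "(\<lambda>n. fourier_integral (trunc (r (s n)) f) \<xi> - complex_of_real (1 - \<xi>\<^sup>2) * fourier_integral (trunc (r (s n)) u) \<xi>) \<longlonglongrightarrow> 0"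
      using LIMSEQ_subseq_LIMSEQ[OF fourier_second_deriv[OF P L(2-4), of \<xi>] strict_mono_o[OF r(1) s(1)]]
      by (simp add: o_def f_def uU)
    show ?case using LIMSEQ_unique[OF 1 2] by simp
  qed
  note [measurable] = L2D(1)[OF fh(1)] L2D(1)[OF uh(1)]
  have "(LINT \<xi>|lborel. ((\<xi>\<^sup>2 - 1)\<^sup>2 + \<epsilon>) * (norm (?u \<xi>))\<^sup>2) = (LINT \<xi>|lborel. (cmod (fh \<xi>))\<^sup>2 + \<epsilon> * (cmod (?u \<xi>))\<^sup>2)"
  proof (rule integral_cong_AE)
    show "AE \<xi> in lborel. ((\<xi>\<^sup>2 - 1)\<^sup>2 + \<epsilon>) * (norm (?u \<xi>))\<^sup>2 = (cmod (fh \<xi>))\<^sup>2 + \<epsilon> * (cmod (?u \<xi>))\<^sup>2"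
      using AEf
    proof eventually_elim
      case (elim \<xi>)
      have "(cmod (fh \<xi>))\<^sup>2 = (1 - \<xi>\<^sup>2)\<^sup>2 * (cmod (?u \<xi>))\<^sup>2"
        unfolding elim by (simp only: norm_mult norm_of_real power_mult_distrib power2_abs)
      then show ?case by (simp add: algebra_simps power2_commute[of 1])
    qed
  qed measurable
  also have "\<dots> = L2sq fh + \<epsilon> * L2sq ?u"
    unfolding L2sq_def using L2D(2)[OF fh(1)] L2D(2)[OF uh(1)] by simp
  also have "\<dots> = L2sq f + \<epsilon> * L2sq u"
    using L2_fourier_limit_isometry[OF f fh] L2_fourier_limit_isometry[OF L(1) uh] by simp
  finally show ?thesis by (simp add: f_def)
qed

subsection \<open>Two-sided bounds on the infimum\<close>

lemma test_function_scale:
  assumes "test_function \<phi>" "\<delta> > 0"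
  shows "test_function (\<lambda>x. \<phi> (\<delta> * x))" "deriv (\<lambda>x. c * \<phi> (\<delta> * x)) = (\<lambda>x. (c * \<delta>) * deriv \<phi> (\<delta> * x))"
proof -
  obtain r where r: "r > 0" "\<And>x. \<bar>x\<bar> \<ge> r \<Longrightarrow> \<phi> x = 0" using test_functionE[OF assms(1)] by metis
  have "\<phi> (\<delta> * x) = 0" if "\<bar>x\<bar> > r / \<delta>" for x
    using r(2)[of "\<delta> * x"] that assms(2) by (simp add: field_simps abs_mult)
  moreover have "smooth (\<lambda>x. \<phi> (\<delta> * x + 0))"
    using assms by (intro smooth_affine) (simp add: test_function_iff)
  ultimately show "test_function (\<lambda>x. \<phi> (\<delta> * x))" by (auto simp: test_function_iff)
  have "((\<lambda>x. c * \<phi> (\<delta> * x)) has_real_derivative (c * \<delta>) * deriv \<phi> (\<delta> * x)) (at x)" for x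
    by (rule derivative_eq_intros DERIV_chain2[OF test_function_DERIV[OF assms(1)]] | simp)+
  then show "deriv (\<lambda>x. c * \<phi> (\<delta> * x)) = (\<lambda>x. (c * \<delta>) * deriv \<phi> (\<delta> * x))"
    using DERIV_imp_deriv by blast
qed

lemma test_function_sq_integrable:
  assumes "test_function \<phi>" shows "integrable lborel (\<lambda>x. (\<phi> x)\<^sup>2)"
proof -
  have "test_function (\<lambda>x. \<phi> x * \<phi> x)"
    using assms by (auto simp: test_function_iff intro!: smooth_mult)
  then show ?thesis using test_function_integrable_real by (simp add: power2_eq_square)
qed

lemma test_function_cis_L2:
  assumes "test_function \<phi>" shows "(\<lambda>x. complex_of_real (\<phi> x) * cis x) \<in> L2"
  using test_function_sq_integrable[OF assms] test_function_measurable[OF assms]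
  by (auto simp: L2_iff norm_mult)

lemma primitive_const: "primitive (\<lambda>x. c) (\<lambda>x. 0)"
  by (rule primitive_C1) auto

lemma primitive_cmult: "primitive F f \<Longrightarrow> primitive (\<lambda>x. c * F x) (\<lambda>x. c * f x)"
  using primitive_mult[OF primitive_const[of c]] by simp

lemma primitive_test_function_cis:
  assumes "test_function \<phi>"
  shows "primitive (\<lambda>x. complex_of_real (\<phi> x) * cis x)
    (\<lambda>x. complex_of_real (deriv \<phi> x) * cis x + \<i> * (complex_of_real (\<phi> x) * cis x))"
  using primitive_mult[OF test_function_primitive[OF assms] cis_primitive[of "-1"]]
  by (simp add: mult_ac)

lemma integral_scale:
  fixes h :: "real \<Rightarrow> real"
  assumes "\<delta> > 0" shows "(LINT x|lborel. h (\<delta> * x)) = (LINT x|lborel. h x) / \<delta>"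
  using lborel_integral_real_affine[of \<delta> h 0] assms by simp

lemma has_L2_weak_deriv_0: "u \<in> L2 \<Longrightarrow> has_L2_weak_deriv 0 u u"
  by (simp add: has_L2_weak_deriv_def)

lemma rayleigh_quotient_nonneg: "\<epsilon> \<ge> 0 \<Longrightarrow> 0 \<le> rayleigh_quotient \<alpha> \<epsilon> u"
  unfolding rayleigh_quotient_def by (intro divide_nonneg_nonneg integral_nonneg) auto

lemma rayleigh_inf_le:
  assumes "\<epsilon> \<ge> 0" "u \<in> H2_nonzero" shows "rayleigh_inf \<alpha> \<epsilon> \<le> rayleigh_quotient \<alpha> \<epsilon> u"
  unfolding rayleigh_inf_def
  using rayleigh_quotient_nonneg[OF assms(1)] assms(2) by (intro cINF_lower bdd_belowI[of _ 0]) auto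

text \<open>The trial function \<open>\<psi> (\<delta> x) e\<^sup>i\<^sup>x\<close> with \<open>\<delta> = \<surd>\<epsilon>\<close> is a wave packet at frequency 1 of width \<open>\<delta>\<close>
  in Fourier space, where the symbol \<open>(\<xi>\<^sup>2 - 1)\<^sup>2 + \<epsilon>\<close> is of size \<open>\<epsilon>\<close>.\<close>

lemma rayleigh_inf_upper:
  assumes "\<alpha> > 0"
  obtains C where "C > 0" "\<And>\<epsilon>. 0 < \<epsilon> \<Longrightarrow> \<epsilon> < 1 \<Longrightarrow> rayleigh_inf \<alpha> \<epsilon> \<le> C * \<epsilon> powr ((\<alpha> + 4) / (2 * (\<alpha> + 2)))"
proof -
  define p where "p = \<alpha> + 2"
  have p: "p > 2" using assms by (simp add: p_def)
  define \<psi> where "\<psi> = bump (-1) 1 1"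
  have \<psi>: "test_function \<psi>" unfolding \<psi>_def by (rule test_function_bump) simp
  have \<psi>_nonneg: "0 \<le> \<psi> x" and \<psi>_pos: "-1 < x \<Longrightarrow> x < 1 \<Longrightarrow> 0 < \<psi> x" for x by (auto simp: \<psi>_def bump_eq)
  note \<psi>1 = test_function_deriv[OF \<psi>]
  note \<psi>2 = test_function_deriv[OF \<psi>1]
  define A0 A1 A2 where "A0 = (LINT x|lborel. (\<psi> x)\<^sup>2)" and "A1 = (LINT x|lborel. (deriv \<psi> x)\<^sup>2)"
    and "A2 = (LINT x|lborel. (deriv (deriv \<psi>) x)\<^sup>2)"
  define Ap where "Ap = (LINT x|lborel. \<psi> x powr p)"
  have A0: "A0 > 0"
    unfolding A0_def by (rule integral_pos_if_pos_on_Ioo) (use test_function_sq_integrable[OF \<psi>] \<psi>_pos in \<open>auto simp: less_imp_neq[symmetric]\<close>)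
  have A1: "A1 \<ge> 0" and A2: "A2 \<ge> 0" unfolding A1_def A2_def by auto
  have "integrable lborel (\<lambda>x. \<psi> x powr p)"
  proof (rule Bochner_Integration.integrable_bound[OF test_function_sq_integrable[OF \<psi>]])
    show "(\<lambda>x. \<psi> x powr p) \<in> borel_measurable lborel"
      using test_function_measurable[OF \<psi>] by measurable
    \<comment> \<open>Since p exceeds 2 and the bump takes values between 0 and 1.\<close>
    have "\<psi> x powr p \<le> (\<psi> x)\<^sup>2" for x
    proof (cases "\<psi> x = 0")
      case False
      then have "0 < \<psi> x" using \<psi>_nonneg[of x] by simp
      moreover have "\<psi> x \<le> 1" by (auto simp: \<psi>_def bump_eq intro!: mult_le_one)
      ultimately have "\<psi> x powr p \<le> \<psi> x powr 2" using p by (intro powr_mono') auto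
      then show ?thesis using \<open>0 < \<psi> x\<close> by simp
    qed simp
    then show "AE x in lborel. norm (\<psi> x powr p) \<le> norm ((\<psi> x)\<^sup>2)" by simp
  qed
  then have Ap: "Ap > 0"
    unfolding Ap_def by (rule integral_pos_if_pos_on_Ioo) (use \<psi>_pos in \<open>auto simp: less_imp_neq[symmetric]\<close>)
  \<comment> \<open>The quotient of the packet with all powers of \<delta> removed.\<close>
  define C where "C = (A2 + 4 * A1 + A0) / Ap powr (2 / p)"
  have "rayleigh_inf \<alpha> \<epsilon> \<le> C * \<epsilon> powr ((\<alpha> + 4) / (2 * (\<alpha> + 2)))" if \<epsilon>: "0 < \<epsilon>" "\<epsilon> < 1" for \<epsilon>
  proof -
    define \<delta> where "\<delta> = sqrt \<epsilon>"
    have \<delta>: "0 < \<delta>" "\<delta> < 1" "\<delta>\<^sup>2 = \<epsilon>" using \<epsilon> by (auto simp: \<delta>_def)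
    define w where "w = (\<lambda>x. \<psi> (\<delta> * x))"
    have w: "test_function w" unfolding w_def by (rule test_function_scale(1)[OF \<psi> \<delta>(1)])
    have dw: "deriv w = (\<lambda>x. \<delta> * deriv \<psi> (\<delta> * x))"
      using test_function_scale(2)[OF \<psi> \<delta>(1), of 1] by (simp add: w_def)
    have ddw: "deriv (deriv w) = (\<lambda>x. \<delta>\<^sup>2 * deriv (deriv \<psi>) (\<delta> * x))"
      unfolding dw using test_function_scale(2)[OF \<psi>1 \<delta>(1), of \<delta>] by (simp add: power2_eq_square)
    note w1 = test_function_deriv[OF w]
    note w2 = test_function_deriv[OF w1]
    define u where "u = (\<lambda>x. complex_of_real (w x) * cis x)"
    define v where "v = (\<lambda>x. complex_of_real (deriv w x) * cis x + \<i> * (complex_of_real (w x) * cis x))"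
    define g where "g = (\<lambda>x. (complex_of_real (deriv (deriv w) x) * cis x + \<i> * (complex_of_real (deriv w x) * cis x))
      + \<i> * (complex_of_real (deriv w x) * cis x + \<i> * (complex_of_real (w x) * cis x)))"
    have uv: "primitive u v" unfolding u_def v_def by (rule primitive_test_function_cis[OF w])
    have vg: "primitive v g"
      unfolding v_def g_def
      by (intro primitive_add primitive_cmult primitive_test_function_cis w w1)
    have L: "u \<in> L2" "v \<in> L2" "g \<in> L2"
      unfolding u_def v_def g_def by (intro L2_add(1) L2_scale test_function_cis_L2 w w1 w2)+
    have N: "L2sq (\<lambda>x. u x + g x) + \<epsilon> * L2sq u \<le> \<delta> * (A2 + 4 * A1 + A0)"
    proof -
      \<comment> \<open>Since cis'' + cis = 0, only w'' + 2 i w' survives; each remaining term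
        carries a derivative of the slow envelope and hence a factor \<delta>.\<close>
      have "u x + g x = Complex (deriv (deriv w) x) (2 * deriv w x) * cis x" for x
        by (simp add: u_def g_def complex_eq_iff algebra_simps)
      then have sq: "(cmod (u x + g x))\<^sup>2 = (deriv (deriv w) x)\<^sup>2 + 4 * (deriv w x)\<^sup>2" for x
        by (simp add: norm_mult cmod_power2 power_mult_distrib)
      have "L2sq (\<lambda>x. u x + g x) = (LINT x|lborel. (deriv (deriv w) x)\<^sup>2) + 4 * (LINT x|lborel. (deriv w x)\<^sup>2)"
        unfolding L2sq_def sq using test_function_sq_integrable[OF w1] test_function_sq_integrable[OF w2] by simp
      also have "(LINT x|lborel. (deriv (deriv w) x)\<^sup>2) = \<delta> ^ 4 * (A2 / \<delta>)"
        unfolding ddw A2_def integral_scale[OF \<delta>(1), of "\<lambda>x. (deriv (deriv \<psi>) x)\<^sup>2", symmetric]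
        by (simp add: power_mult_distrib)
      also have "(LINT x|lborel. (deriv w x)\<^sup>2) = \<delta>\<^sup>2 * (A1 / \<delta>)"
        unfolding dw A1_def integral_scale[OF \<delta>(1), of "\<lambda>x. (deriv \<psi> x)\<^sup>2", symmetric]
        by (simp add: power_mult_distrib)
      finally have 1: "L2sq (\<lambda>x. u x + g x) = \<delta> ^ 3 * A2 + 4 * (\<delta> * A1)"
        using \<delta>(1) by (simp add: power2_eq_square power3_eq_cube power4_eq_xxxx)
      have "L2sq u = (LINT x|lborel. (w x)\<^sup>2)" by (simp add: L2sq_def u_def norm_mult)
      also have "\<dots> = A0 / \<delta>"
        unfolding w_def A0_def by (rule integral_scale[OF \<delta>(1), of "\<lambda>x. (\<psi> x)\<^sup>2"])
      finally have "\<epsilon> * L2sq u = \<delta> * A0" using \<delta> by (simp add: power2_eq_square flip: \<delta>(3))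
      \<comment> \<open>The w'' term is of lower order. The w' term and the \<epsilon> term both
        scale like \<delta>^2 / \<delta>, which is why sqrt \<epsilon> is the right frequency
        width.\<close>
      moreover have "\<delta> ^ 3 * A2 \<le> \<delta> * A2"
        using \<delta> A2 power_decreasing[of 1 3 \<delta>] by (intro mult_right_mono) auto
      ultimately show ?thesis using 1 by (simp add: algebra_simps)
    qed
    have "(LINT x|lborel. norm (u x) powr p) = (LINT x|lborel. (\<lambda>x. \<psi> x powr p) (\<delta> * x))"
      using \<psi>_nonneg by (simp add: u_def w_def norm_mult)
    also have "\<dots> = Ap / \<delta>" unfolding Ap_def by (rule integral_scale[OF \<delta>(1)])
    finally have Iu: "(LINT x|lborel. norm (u x) powr p) = Ap / \<delta>" .
    have Lp: "(Lp_norm (\<alpha> + 2) u)\<^sup>2 = Ap powr (2 / p) / \<delta> powr (2 / p)"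
    proof -
      have "(Lp_norm (\<alpha> + 2) u)\<^sup>2 = ((Ap / \<delta>) powr (1 / p)) powr 2"
        using Ap \<delta> by (simp add: Lp_norm_def p_def[symmetric] Iu)
      also have "\<dots> = (Ap / \<delta>) powr (2 / p)" by (simp add: powr_powr)
      finally show ?thesis using Ap \<delta> by (simp add: powr_divide)
    qed
    have "u \<in> H2_nonzero"
    proof -
      have "\<not> (AE x in lborel. u x = 0)"
      proof
        assume "AE x in lborel. u x = 0"
        then have "(LINT x|lborel. norm (u x) powr p) = (LINT x::real|lborel. 0::real)"
          using L2D(1)[OF L(1)] by (intro integral_cong_AE) auto
        then show False using Iu Ap \<delta> by simp
      qed
      moreover have "\<exists>g. has_L2_weak_deriv k u g" if "k \<le> 2" for k
      proof -
        consider "k = 0" | "k = 1" | "k = 2" using \<open>k \<le> 2\<close> by linarith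
        then show ?thesis
          using has_L2_weak_deriv_0[OF L(1)] has_L2_weak_deriv_primitive[OF uv L(1,2)]
            has_L2_weak_deriv_primitive2[OF uv vg L] by cases blast+
      qed
      ultimately show ?thesis using L(1) by (simp add: H2_nonzero_def H2_def)
    qed
    then have "rayleigh_inf \<alpha> \<epsilon> \<le> rayleigh_quotient \<alpha> \<epsilon> u" using \<epsilon> by (intro rayleigh_inf_le) auto
    also have "\<dots> = (L2sq (\<lambda>x. u x + g x) + \<epsilon> * L2sq u) / (Ap powr (2 / p) / \<delta> powr (2 / p))"
      unfolding rayleigh_quotient_def Lp using rayleigh_numerator[OF AE_I2[OF refl] uv vg L(1) L(1,2,3)] by simp
    also have "\<dots> \<le> (\<delta> * (A2 + 4 * A1 + A0)) / (Ap powr (2 / p) / \<delta> powr (2 / p))"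
      using N by (intro divide_right_mono) auto
    also have "\<dots> = C * (\<delta> * \<delta> powr (2 / p))" by (simp add: C_def)
    also have "\<delta> * \<delta> powr (2 / p) = \<delta> powr (1 + 2 / p)" using \<delta> by (simp add: powr_add)
    also have "\<dots> = \<epsilon> powr ((1 + 2 / p) / 2)" using \<epsilon> by (simp add: \<delta>_def powr_half_sqrt[symmetric] powr_powr)
    also have "(1 + 2 / p) / 2 = (\<alpha> + 4) / (2 * (\<alpha> + 2))" using assms by (simp add: p_def field_simps)
    finally show ?thesis .
  qed
  moreover have "C > 0" unfolding C_def using A0 A1 A2 Ap by (intro divide_pos_pos add_nonneg_pos) auto
  ultimately show thesis by (rule that[rotated])
qed

section \<open>Ground states: lower bound, norm and action\<close>

text \<open>The normalised minimizer v makes R equal to its numerator, so the sup bound and the L^2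
  bound apply with N = R. The factor c = R^(1/\<alpha>) is chosen so that c^2 R = c^(\<alpha>+2),
  which equates the quadratic and nonlinear parts of the action up to their coefficients.\<close>

lemma ground_state_properties:
  assumes \<alpha>: "\<alpha> > 0" and \<epsilon>: "0 < \<epsilon>" "\<epsilon> < 1" and Q: "ground_state \<alpha> \<epsilon> Q"
  defines "R \<equiv> rayleigh_inf \<alpha> \<epsilon>"
  shows "R > 0"
    and "1 / 2 * \<epsilon> powr ((\<alpha> + 4) / (2 * \<alpha>)) \<le> R powr ((\<alpha> + 2) / \<alpha>)"
    and "Lp_norm (\<alpha> + 2) Q powr (\<alpha> + 2) = R powr ((\<alpha> + 2) / \<alpha>)"
    and "action \<alpha> (1 + \<epsilon>) Q = \<alpha> / (2 * (\<alpha> + 2)) * R powr ((\<alpha> + 2) / \<alpha>)"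
proof -
  define p where "p = \<alpha> + 2"
  have p: "p > 2" using \<alpha> by (simp add: p_def)
  obtain v where v: "v \<in> H2" "rayleigh_quotient \<alpha> \<epsilon> v = R" "Lp_norm (\<alpha> + 2) v = 1"
    and Q_eq: "Q = (\<lambda>x. (R powr (1 / \<alpha>)) *\<^sub>R v x)"
    using Q unfolding ground_state_def rayleigh_minimizer_def R_def H2_nonzero_def by blast
  obtain U V g where AE: "AE x in lborel. v x = U x" and P: "primitive U V" "primitive V g"
    and L: "v \<in> L2" "U \<in> L2" "V \<in> L2" "g \<in> L2" and weak: "has_L2_weak_deriv 1 v V" "has_L2_weak_deriv 2 v g"
    by (rule H2_regular_representative[OF v(1)])
  have vU: "L2sq v = L2sq U" using L2_cong_AE(2)[OF L(1) AE L2D(1)[OF L(2)]] by simp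
  have R: "R = L2sq (\<lambda>x. U x + g x) + \<epsilon> * L2sq U"
    using v(2,3) rayleigh_numerator[OF AE P L] by (simp add: rayleigh_quotient_def vU)
  have R0: "R \<ge> 0" unfolding R using \<epsilon> L2sq_nonneg by simp
  define I where "I = (LINT x|lborel. norm (v x) powr p)"
  have I: "I = 1"
  proof -
    have "I \<ge> 0" unfolding I_def by simp
    then have "I = (I powr (1 / p)) powr p" using p by (simp add: powr_powr)
    also have "I powr (1 / p) = 1" using v(3) by (simp add: Lp_norm_def I_def p_def)
    finally show ?thesis by simp
  qed
  \<comment> \<open>The value 1 rules out the default integral 0 of a nonintegrable
    function.\<close>
  then have Iint: "integrable lborel (\<lambda>x. norm (v x) powr p)"
    using not_integrable_integral_eq by (fastforce simp: I_def)
  define S where "S = 2 * R / sqrt \<epsilon>"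
  have S0: "S \<ge> 0" using R0 \<epsilon> by (simp add: S_def)
  have "I \<le> (LINT x|lborel. S powr (\<alpha> / 2) * (cmod (v x))\<^sup>2)"
    unfolding I_def
  proof (rule integral_mono_AE[OF Iint])
    show "AE x in lborel. norm (v x) powr p \<le> S powr (\<alpha> / 2) * (cmod (v x))\<^sup>2"
      using AE
    proof eventually_elim
      case (elim x)
      have "(cmod (v x))\<^sup>2 \<le> S"
        using sup_bound[OF P L(2-4) \<epsilon>, of x] elim by (simp add: S_def R)
      then have "((cmod (v x))\<^sup>2) powr (\<alpha> / 2) \<le> S powr (\<alpha> / 2)"
        using \<alpha> by (intro powr_mono2) auto
      moreover have "((cmod (v x))\<^sup>2) powr (\<alpha> / 2) = cmod (v x) powr \<alpha>"
        by (simp add: powr_powr flip: powr_numeral)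
      moreover have "norm (v x) powr p = cmod (v x) powr \<alpha> * (cmod (v x))\<^sup>2"
        by (simp add: p_def powr_add)
      ultimately show ?case by (simp add: mult_right_mono)
    qed
  qed (use L2D(2)[OF L(1)] in simp)
  also have "\<dots> = S powr (\<alpha> / 2) * L2sq U" by (simp add: L2sq_def[symmetric] vU)
  also have "\<dots> \<le> S powr (\<alpha> / 2) * (R / \<epsilon>)"
  proof (intro mult_left_mono)
    have "\<epsilon> * L2sq U \<le> R" unfolding R using L2sq_nonneg by simp
    then show "L2sq U \<le> R / \<epsilon>" using \<epsilon> by (simp add: field_simps)
  qed simp
  finally have le: "\<epsilon> \<le> S powr (\<alpha> / 2) * R" using \<epsilon> I by (simp add: field_simps)
  show Rpos: "R > 0" using le \<epsilon> R0 by (cases "R = 0") auto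
  have Spos: "S > 0" using Rpos \<epsilon> by (simp add: S_def)
  \<comment> \<open>Raising to the power 2/\<alpha> isolates S, which is linear in R; multiplying by
    sqrt \<epsilon> / 2 then replaces S by R.\<close>
  have "\<epsilon> powr (2 / \<alpha>) \<le> (S powr (\<alpha> / 2) * R) powr (2 / \<alpha>)"
    using le \<epsilon> \<alpha> by (intro powr_mono2) auto
  also have "\<dots> = S * R powr (2 / \<alpha>)" using \<alpha> Spos Rpos by (simp add: powr_mult powr_powr)
  finally have "\<epsilon> powr (2 / \<alpha>) * (sqrt \<epsilon> / 2) \<le> S * R powr (2 / \<alpha>) * (sqrt \<epsilon> / 2)"
    using \<epsilon> by (intro mult_right_mono) auto
  also have "\<dots> = R * R powr (2 / \<alpha>)" using \<epsilon> by (simp add: S_def)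
  also have R_powr: "R * R powr (2 / \<alpha>) = R powr ((\<alpha> + 2) / \<alpha>)"
  proof -
    have "R * R powr (2 / \<alpha>) = R powr (1 + 2 / \<alpha>)" using Rpos by (simp add: powr_add)
    also have "1 + 2 / \<alpha> = (\<alpha> + 2) / \<alpha>" using \<alpha> by (simp add: field_simps)
    finally show ?thesis .
  qed
  also have "\<epsilon> powr (2 / \<alpha>) * (sqrt \<epsilon> / 2) = 1 / 2 * \<epsilon> powr (2 / \<alpha> + 1 / 2)"
    using \<epsilon> by (simp add: powr_add powr_half_sqrt)
  also have "2 / \<alpha> + 1 / 2 = (\<alpha> + 4) / (2 * \<alpha>)" using \<alpha> by (simp add: field_simps)
  finally show "1 / 2 * \<epsilon> powr ((\<alpha> + 4) / (2 * \<alpha>)) \<le> R powr ((\<alpha> + 2) / \<alpha>)" .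
  define c where "c = R powr (1 / \<alpha>)"
  have c: "c > 0" using Rpos by (simp add: c_def)
  have Qc: "Q = (\<lambda>x. complex_of_real c * v x)" unfolding Q_eq c_def by (simp add: scaleR_conv_of_real)
  have "(LINT x|lborel. norm (Q x) powr p) = c powr p"
    using c I by (simp add: Qc norm_mult powr_mult I_def)
  then have "Lp_norm (\<alpha> + 2) Q powr (\<alpha> + 2) = ((c powr p) powr (1 / p)) powr p"
    by (simp add: Lp_norm_def p_def)
  also have "\<dots> = c powr p" using p c by (simp add: powr_powr)
  also have "\<dots> = R powr ((\<alpha> + 2) / \<alpha>)" by (simp add: c_def powr_powr p_def)
  finally show Qp: "Lp_norm (\<alpha> + 2) Q powr (\<alpha> + 2) = R powr ((\<alpha> + 2) / \<alpha>)" .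
  have "c\<^sup>2 * R = R * (c powr 2)" using c by simp
  also have "c powr 2 = R powr (2 / \<alpha>)" by (simp add: c_def powr_powr)
  finally have c2: "c\<^sup>2 * R = R powr ((\<alpha> + 2) / \<alpha>)" by (simp add: R_powr)
  have D: "L2sq (weak_deriv 1 Q) = c\<^sup>2 * L2sq V" "L2sq (weak_deriv 2 Q) = c\<^sup>2 * L2sq g" "L2sq Q = c\<^sup>2 * L2sq U"
    using L2sq_weak_deriv[OF has_L2_weak_deriv_scale[OF weak(1), of "complex_of_real c"]]
      L2sq_weak_deriv[OF has_L2_weak_deriv_scale[OF weak(2), of "complex_of_real c"]]
    by (simp_all add: Qc L2sq_scale vU)
  have "action \<alpha> (1 + \<epsilon>) Q = 1 / 2 * (c\<^sup>2 * L2sq g) - c\<^sup>2 * L2sq V + (1 + \<epsilon>) / 2 * (c\<^sup>2 * L2sq U) - 1 / (\<alpha> + 2) * R powr ((\<alpha> + 2) / \<alpha>)"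
    unfolding action_def Qp Lp_norm_2 real_sqrt_pow2[OF L2sq_nonneg] by (simp only: D)
  \<comment> \<open>The expansion of |U + U''|^2 shows that the quadratic part is half the
    numerator: the \<epsilon> in the frequency 1 + \<epsilon> supplies the \<epsilon> |U|^2
    term.\<close>
  also have "\<dots> = 1 / 2 * (c\<^sup>2 * R) - 1 / (\<alpha> + 2) * R powr ((\<alpha> + 2) / \<alpha>)"
    unfolding R L2sq_add_second_deriv[OF P L(2-4)] by (simp add: field_simps)
  also have "\<dots> = \<alpha> / (2 * (\<alpha> + 2)) * R powr ((\<alpha> + 2) / \<alpha>)"
    unfolding c2 using \<alpha> by (simp add: field_simps)
  finally show "action \<alpha> (1 + \<epsilon>) Q = \<alpha> / (2 * (\<alpha> + 2)) * R powr ((\<alpha> + 2) / \<alpha>)" .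
qed

theorem mainTheorem7:
  fixes \<alpha> :: real and Q :: "real \<Rightarrow> real \<Rightarrow> complex"
  assumes "\<alpha> > 0"
    and "\<forall>\<^sub>F \<epsilon> in at_right 0. ground_state \<alpha> \<epsilon> (Q \<epsilon>)"
  shows "comparable (\<lambda>\<epsilon>. action \<alpha> (1 + \<epsilon>) (Q \<epsilon>)) (\<lambda>\<epsilon>. Lp_norm (\<alpha> + 2) (Q \<epsilon>) powr (\<alpha> + 2)) \<and>
         comparable (\<lambda>\<epsilon>. Lp_norm (\<alpha> + 2) (Q \<epsilon>) powr (\<alpha> + 2)) (\<lambda>\<epsilon>. \<epsilon> powr ((\<alpha> + 4) / (2 * \<alpha>)))"
proof
  have "\<forall>\<^sub>F \<epsilon> in at_right 0. 0 < \<epsilon> \<and> \<epsilon> < (1::real)"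
    by (auto simp: eventually_at_right_field intro!: exI[of _ 1])
  with assms(2) have ev: "\<forall>\<^sub>F \<epsilon> in at_right 0. ground_state \<alpha> \<epsilon> (Q \<epsilon>) \<and> 0 < \<epsilon> \<and> \<epsilon> < 1"
    by (rule eventually_conj)
  define K where "K = \<alpha> / (2 * (\<alpha> + 2))"
  have K: "K > 0" using assms(1) by (simp add: K_def)
  show "comparable (\<lambda>\<epsilon>. action \<alpha> (1 + \<epsilon>) (Q \<epsilon>)) (\<lambda>\<epsilon>. Lp_norm (\<alpha> + 2) (Q \<epsilon>) powr (\<alpha> + 2))"
    unfolding comparable_def
  proof (intro exI conjI)
    \<comment> \<open>The action is exactly K times the norm power; \<open>comparable\<close>
      demands two distinct constants, so K is enclosed between K/2 and 2 K.\<close>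
    show "0 < K / 2" "K / 2 < 2 * K" using K by auto
    show "\<forall>\<^sub>F \<epsilon> in at_right 0. K / 2 * Lp_norm (\<alpha> + 2) (Q \<epsilon>) powr (\<alpha> + 2) \<le> action \<alpha> (1 + \<epsilon>) (Q \<epsilon>)
        \<and> action \<alpha> (1 + \<epsilon>) (Q \<epsilon>) \<le> 2 * K * Lp_norm (\<alpha> + 2) (Q \<epsilon>) powr (\<alpha> + 2)"
      using ev
    proof eventually_elim
      case (elim \<epsilon>)
      define B where "B = Lp_norm (\<alpha> + 2) (Q \<epsilon>) powr (\<alpha> + 2)"
      have "action \<alpha> (1 + \<epsilon>) (Q \<epsilon>) = K * B"
        unfolding B_def K_def using ground_state_properties(3,4)[OF assms(1), of \<epsilon> "Q \<epsilon>"] elim by simp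
      moreover have "0 \<le> K * B" using K by (simp add: B_def)
      ultimately show ?case unfolding B_def[symmetric] by linarith
    qed
  qed
  obtain C where C: "C > 0" "\<And>\<epsilon>. 0 < \<epsilon> \<Longrightarrow> \<epsilon> < 1 \<Longrightarrow> rayleigh_inf \<alpha> \<epsilon> \<le> C * \<epsilon> powr ((\<alpha> + 4) / (2 * (\<alpha> + 2)))"
    using rayleigh_inf_upper[OF assms(1)] by blast
  \<comment> \<open>The added 1 guarantees that C' exceeds the lower constant 1/2.\<close>
  define C' where "C' = C powr ((\<alpha> + 2) / \<alpha>) + 1"
  show "comparable (\<lambda>\<epsilon>. Lp_norm (\<alpha> + 2) (Q \<epsilon>) powr (\<alpha> + 2)) (\<lambda>\<epsilon>. \<epsilon> powr ((\<alpha> + 4) / (2 * \<alpha>)))"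
    unfolding comparable_def
  proof (intro exI conjI)
    have "0 \<le> C powr ((\<alpha> + 2) / \<alpha>)" by simp
    then show "(0::real) < 1 / 2" "1 / 2 < C'" unfolding C'_def by linarith+
    show "\<forall>\<^sub>F \<epsilon> in at_right 0. 1 / 2 * \<epsilon> powr ((\<alpha> + 4) / (2 * \<alpha>)) \<le> Lp_norm (\<alpha> + 2) (Q \<epsilon>) powr (\<alpha> + 2)
        \<and> Lp_norm (\<alpha> + 2) (Q \<epsilon>) powr (\<alpha> + 2) \<le> C' * \<epsilon> powr ((\<alpha> + 4) / (2 * \<alpha>))"
      using ev
    proof eventually_elim
      case (elim \<epsilon>)
      define R where "R = rayleigh_inf \<alpha> \<epsilon>"
      have props: "R > 0" "1 / 2 * \<epsilon> powr ((\<alpha> + 4) / (2 * \<alpha>)) \<le> R powr ((\<alpha> + 2) / \<alpha>)"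
        "Lp_norm (\<alpha> + 2) (Q \<epsilon>) powr (\<alpha> + 2) = R powr ((\<alpha> + 2) / \<alpha>)"
        unfolding R_def using ground_state_properties[OF assms(1), of \<epsilon> "Q \<epsilon>"] elim by auto
      have "R powr ((\<alpha> + 2) / \<alpha>) \<le> (C * \<epsilon> powr ((\<alpha> + 4) / (2 * (\<alpha> + 2)))) powr ((\<alpha> + 2) / \<alpha>)"
        using C(2)[of \<epsilon>] elim props(1) assms(1) by (intro powr_mono2) (auto simp: R_def)
      also have "\<dots> = C powr ((\<alpha> + 2) / \<alpha>) * \<epsilon> powr ((\<alpha> + 4) / (2 * (\<alpha> + 2)) * ((\<alpha> + 2) / \<alpha>))"
        using C(1) by (simp add: powr_mult powr_powr)
      \<comment> \<open>The factor \<alpha> + 2 cancels, leaving the same power of \<epsilon> as in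
        the lower bound.\<close>
      also have "(\<alpha> + 4) / (2 * (\<alpha> + 2)) * ((\<alpha> + 2) / \<alpha>) = (\<alpha> + 4) / (2 * \<alpha>)"
      proof -
        have *: "a / (2 * b) * (b / d) = a / (2 * d)" if "b \<noteq> 0" for a b d :: real
          using that by simp
        show ?thesis by (rule *) (use assms(1) in simp)
      qed
      also have "C powr ((\<alpha> + 2) / \<alpha>) * \<epsilon> powr ((\<alpha> + 4) / (2 * \<alpha>)) \<le> C' * \<epsilon> powr ((\<alpha> + 4) / (2 * \<alpha>))"
        by (simp add: C'_def mult_right_mono)
      finally show ?case using props by simp
    qed
  qed
qed

end
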